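(* Suppose that the map $(h,\zeta)\mapsto \widehat{\mathrm H}(h,\zeta)$ from $J_0\times\mathbb{C}_{k_x}$ to $\mathcal{L}\{L^2(D)\}$ is continuously Fréchet differentiable. Suppose further that for some $h_n\in J_0$ the generalized resolvent $\zeta\mapsto[1-\widehat{\mathrm H}(h_n,\zeta)]^{-1}$ has a simple pole $\zeta_n\in\mathbb{C}_{k_x}$, and let $E_n$ be the corresponding Siegert state. Then there exist an open interval $J\subset J_0$ containing $h_n$ and a unique continuously differentiable function $h\mapsto\zeta_n(h)$, $h\in J$, with values in $\mathbb{C}_{k_x}$, such that $\zeta_n(h_n)=\zeta_n$ and, for all $h\in J$, $\zeta_n(h)$ is a simple pole of the generalized resolvent $\zeta\mapsto[1-\widehat{\mathrm H}(h,\zeta)]^{-1}$. Moreover, the Siegert states $E_n(h)$ corresponding to the poles $\zeta_n(h)$ (each determined up to a nonzero scalar factor) can be chosen so that the function $h\mapsto E_n(h)$ from $J$ to $L^2(D)$ is continuously differentiable.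
   Context: Fix $k_x\in\mathbb{R}$ and put $k_{x,m}=k_x+2\pi m$, $m\in\mathbb{Z}$. The square root is $\sqrt w=e^{\frac12\log w}$ with $\log w=\ln|w|+i\arg w$, $-\frac{\pi}{2}<\arg w<\frac{3\pi}{2}$. The cut plane is $\mathbb{C}_{k_x}=\mathbb{C}\setminus\bigcup_{m\in\mathbb{Z}}\{k_{x,m}^2-is:\ s\ge 0\}$. For $\zeta\in\mathbb{C}_{k_x}$ let $$H(\zeta;x,z)=\frac{i\zeta}{2}\sum_{m\in\mathbb{Z}}\frac{e^{i(xk_{x,m}+|z|\sqrt{\zeta-k_{x,m}^2})}}{\sqrt{\zeta-k_{x,m}^2}}.$$ Let $J_0\subset\mathbb{R}$ be an open interval (the range of a coupling parameter $h$). For each $h\in J_0$ let $\varepsilon(h;\cdot):\mathbb{R}^2\to[1,\infty)$ be a bounded measurable function of $(x,z)$, $1$-periodic in $x$, and let $S_{\varepsilon(h)}$ be the support of $\varepsilon(h;\cdot)-1$ in the strip $[0,1]\times\mathbb{R}$. It is assumed that $\bigcup_{h\in J_0}S_{\varepsilon(h)}$ is bounded, and $D=[0,1]\times[z_-,z_+]$ is a rectangle containing this set. $\mathcal{L}\{L^2(D)\}$ is the space of bounded linear operators on $L^2(D)$ (complex-valued functions) with the operator norm, and $\widehat{\mathrm H}(h,\zeta)\in\mathcal{L}\{L^2(D)\}$ is the Hilbert–Schmidt operator $$\widehat{\mathrm H}(h,\zeta)[E](\mathbf r)=\int_D(\varepsilon(h;\mathbf r_0)-1)\,H(\zeta;\mathbf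 r-\mathbf r_0)\,E(\mathbf r_0)\,d\mathbf r_0 .$$ For fixed $h$, $\zeta\mapsto\widehat{\mathrm H}(h,\zeta)$ is analytic on $\mathbb{C}_{k_x}$ and the generalized resolvent $\zeta\mapsto[1-\widehat{\mathrm H}(h,\zeta)]^{-1}$ is meromorphic on $\mathbb{C}_{k_x}$. A Siegert state corresponding to a pole $\zeta_*$ of the generalized resolvent is a nonzero $E\in L^2(D)$ with $\widehat{\mathrm H}(h,\zeta_* )[E]=E$. A pole is called simple (the Siegert state is nondegenerate) if it is a pole of order one whose residue is a rank-one operator on $L^2(D)$. *)

theory Defs
  imports "HOL-Analysis.Analysis"
begin

section \<open>The Hilbert space of square-integrable complex functions\<close>

definition sq_integrable :: "('a::euclidean_space \<Rightarrow> complex) \<Rightarrow> bool" where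
  "sq_integrable f \<longleftrightarrow>
     f \<in> borel_measurable lebesgue \<and> integrable lebesgue (\<lambda>x. (cmod (f x))\<^sup>2)"

lemma sq_integrable_zero: "sq_integrable (\<lambda>x. 0)"
  by (simp add: sq_integrable_def)

lemma sq_integrable_mult_integrable:
  assumes "sq_integrable f" "sq_integrable g"
  shows "integrable lebesgue (\<lambda>x. Re (f x * cnj (g x)))"
proof (rule Bochner_Integration.integrable_bound)
  show "integrable lebesgue (\<lambda>x. (cmod (f x))\<^sup>2 + (cmod (g x))\<^sup>2)"
    using assms by (simp add: sq_integrable_def)
  have [measurable]: "f \<in> borel_measurable lebesgue" "g \<in> borel_measurable lebesgue"
    using assms by (auto simp: sq_integrable_def)
  have [measurable]: "(\<lambda>x. cnj (g x)) \<in> borel_measurable lebesgue"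
    by (rule borel_measurable_continuous_on[OF _ \<open>g \<in> _\<close>]) (intro continuous_intros)
  show "(\<lambda>x. Re (f x * cnj (g x))) \<in> borel_measurable lebesgue"
    by measurable
  have "\<bar>Re (a * cnj b)\<bar> \<le> (cmod a)\<^sup>2 + (cmod b)\<^sup>2" for a b
  proof -
    have "\<bar>Re (a * cnj b)\<bar> \<le> cmod a * cmod b"
      by (metis abs_Re_le_cmod complex_mod_cnj norm_mult)
    also have "\<dots> \<le> (cmod a)\<^sup>2 + (cmod b)\<^sup>2"
    proof -
      have "0 \<le> cmod a * cmod b"
        by simp
      with sum_squares_bound[of "cmod a" "cmod b"] show ?thesis
        by linarith
    qed
    finally show ?thesis .
  qed
  then show "AE x in lebesgue. norm (Re (f x * cnj (g x)))
      \<le> norm ((cmod (f x))\<^sup>2 + (cmod (g x))\<^sup>2)"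
    by (auto intro!: AE_I2)
qed

lemma sq_integrable_add:
  assumes "sq_integrable f" "sq_integrable g"
  shows "sq_integrable (\<lambda>x. f x + g x)"
proof -
  have "(cmod (f x + g x))\<^sup>2 = (cmod (f x))\<^sup>2 + (cmod (g x))\<^sup>2 + 2 * Re (f x * cnj (g x))" for x
    unfolding cmod_power2 by (simp add: power2_eq_square algebra_simps)
  moreover have "integrable lebesgue
      (\<lambda>x. (cmod (f x))\<^sup>2 + (cmod (g x))\<^sup>2 + 2 * Re (f x * cnj (g x)))"
    using assms
    by (intro Bochner_Integration.integrable_add integrable_mult_right
        sq_integrable_mult_integrable) (auto simp: sq_integrable_def)
  moreover have "(\<lambda>x. f x + g x) \<in> borel_measurable lebesgue"
    using assms by (intro borel_measurable_add) (auto simp: sq_integrable_def)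
  ultimately show ?thesis
    by (simp only: sq_integrable_def)
qed

lemma sq_integrable_cmult:
  assumes "sq_integrable f"
  shows "sq_integrable (\<lambda>x. c * f x)"
  using assms borel_measurable_times[OF borel_measurable_const[of c], of f lebesgue]
  by (simp add: sq_integrable_def norm_mult power_mult_distrib)

definition L2_rel :: "('a::euclidean_space \<Rightarrow> complex) \<Rightarrow> ('a \<Rightarrow> complex) \<Rightarrow> bool" where
  "L2_rel f g \<longleftrightarrow> sq_integrable f \<and> sq_integrable g \<and> (AE x in lebesgue. f x = g x)"

quotient_type (overloaded) 'a L2 = "'a::euclidean_space \<Rightarrow> complex" / partial: L2_rel
proof (rule part_equivpI)
  show "\<exists>f. L2_rel f (f :: 'a \<Rightarrow> complex)"
    using sq_integrable_zero by (auto simp: L2_rel_def)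
  show "symp (L2_rel :: ('a \<Rightarrow> complex) \<Rightarrow> _)"
    by (auto simp: symp_def L2_rel_def)
  show "transp (L2_rel :: ('a \<Rightarrow> complex) \<Rightarrow> _)"
    unfolding transp_def L2_rel_def by (auto elim!: AE_mp)
qed

lemma L2_rel_cmult: "L2_rel f g \<Longrightarrow> L2_rel (\<lambda>x. c * f x) (\<lambda>x. c * g x)"
  by (auto simp: L2_rel_def sq_integrable_cmult elim!: AE_mp)

lemma L2_rel_add:
  "L2_rel f g \<Longrightarrow> L2_rel f' g' \<Longrightarrow> L2_rel (\<lambda>x. f x + f' x) (\<lambda>x. g x + g' x)"
  by (auto simp: L2_rel_def sq_integrable_add elim!: AE_mp)

instantiation L2 :: (euclidean_space) real_vector
begin

lift_definition zero_L2 :: "'a L2" is "\<lambda>x. 0"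
  by (simp add: L2_rel_def sq_integrable_zero)

lift_definition plus_L2 :: "'a L2 \<Rightarrow> 'a L2 \<Rightarrow> 'a L2" is "\<lambda>f g x. f x + g x"
  by (rule L2_rel_add)

lift_definition uminus_L2 :: "'a L2 \<Rightarrow> 'a L2" is "\<lambda>f x. - f x"
  using L2_rel_cmult[of _ _ "-1"] by simp

lift_definition minus_L2 :: "'a L2 \<Rightarrow> 'a L2 \<Rightarrow> 'a L2" is "\<lambda>f g x. f x - g x"
  using L2_rel_add L2_rel_cmult[of _ _ "-1"] by fastforce

lift_definition scaleR_L2 :: "real \<Rightarrow> 'a L2 \<Rightarrow> 'a L2" is "\<lambda>c f x. of_real c * f x"
  by (rule L2_rel_cmult)

instance
proof
  fix a b c :: "'a L2" and r s :: real
  show "a + b + c = a + (b + c)"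
    by transfer (auto simp: L2_rel_def sq_integrable_add add.assoc)
  show "a + b = b + a"
    by transfer (auto simp: L2_rel_def sq_integrable_add add.commute)
  show "0 + a = a"
    by transfer (auto simp: L2_rel_def)
  show "- a + a = 0"
    by transfer (auto simp: L2_rel_def sq_integrable_zero)
  show "a - b = a + - b"
    by transfer (use L2_rel_add L2_rel_cmult[of _ _ "-1"] in fastforce)
  show "r *\<^sub>R (a + b) = r *\<^sub>R a + r *\<^sub>R b"
    by transfer (auto simp: L2_rel_def sq_integrable_add sq_integrable_cmult distrib_left)
  show "(r + s) *\<^sub>R a = r *\<^sub>R a + s *\<^sub>R a"
    by transfer (auto simp: L2_rel_def sq_integrable_add sq_integrable_cmult distrib_right)
  show "r *\<^sub>R s *\<^sub>R a = (r * s) *\<^sub>R a"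
    by transfer (auto simp: L2_rel_def sq_integrable_cmult mult.assoc)
  show "1 *\<^sub>R a = a"
    by transfer (auto simp: L2_rel_def)
qed

end

lift_definition scaleC_L2 :: "complex \<Rightarrow> 'a::euclidean_space L2 \<Rightarrow> 'a L2"  (infixr "*\<^sub>C" 75)
  is "\<lambda>c f x. c * f x"
  by (rule L2_rel_cmult)

instantiation L2 :: (euclidean_space) real_inner
begin

text \<open>The real part of the Hermitian product; the induced norm is the usual $L^2$ norm.\<close>

lift_definition inner_L2 :: "'a L2 \<Rightarrow> 'a L2 \<Rightarrow> real"
  is "\<lambda>f g. integral\<^sup>L lebesgue (\<lambda>x. Re (f x * cnj (g x)))"
proof -
  fix f1 f2 g1 g2 :: "'a \<Rightarrow> complex"
  assume *: "L2_rel f1 f2" "L2_rel g1 g2"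
  show "integral\<^sup>L lebesgue (\<lambda>x. Re (f1 x * cnj (g1 x))) =
        integral\<^sup>L lebesgue (\<lambda>x. Re (f2 x * cnj (g2 x)))"
  proof (rule integral_cong_AE)
    show "(\<lambda>x. Re (f1 x * cnj (g1 x))) \<in> borel_measurable lebesgue"
      "(\<lambda>x. Re (f2 x * cnj (g2 x))) \<in> borel_measurable lebesgue"
      using * unfolding L2_rel_def
      by (blast intro: borel_measurable_integrable sq_integrable_mult_integrable)+
    show "AE x in lebesgue. Re (f1 x * cnj (g1 x)) = Re (f2 x * cnj (g2 x))"
      using * by (auto simp: L2_rel_def elim!: AE_mp)
  qed
qed

definition norm_L2 :: "'a L2 \<Rightarrow> real" where "norm_L2 f = sqrt (f \<bullet> f)"
definition sgn_L2 :: "'a L2 \<Rightarrow> 'a L2" where "sgn_L2 f = f /\<^sub>R norm f"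
definition dist_L2 :: "'a L2 \<Rightarrow> 'a L2 \<Rightarrow> real" where "dist_L2 f g = norm (f - g)"
definition uniformity_L2 :: "('a L2 \<times> 'a L2) filter" where
  "uniformity_L2 = (INF e\<in>{0 <..}. principal {(x, y). dist x y < e})"
definition open_L2 :: "'a L2 set \<Rightarrow> bool" where
  "open_L2 U \<longleftrightarrow> (\<forall>x\<in>U. eventually (\<lambda>(x', y). x' = x \<longrightarrow> y \<in> U) uniformity)"

instance
proof
  fix a b c :: "'a L2" and r :: real and U :: "'a L2 set"
  show "dist a b = norm (a - b)" by (rule dist_L2_def)
  show "sgn a = a /\<^sub>R norm a" by (rule sgn_L2_def)
  show "uniformity = (INF e\<in>{0 <..}. principal {(x, y :: 'a L2). dist x y < e})"
    by (rule uniformity_L2_def)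
  show "open U \<longleftrightarrow> (\<forall>x\<in>U. eventually (\<lambda>(x', y). x' = x \<longrightarrow> y \<in> U) uniformity)"
    by (rule open_L2_def)
  show "norm a = sqrt (a \<bullet> a)" by (rule norm_L2_def)
  show "a \<bullet> b = b \<bullet> a"
    by transfer (simp add: algebra_simps)
  show "(a + b) \<bullet> c = a \<bullet> c + b \<bullet> c"
  proof transfer
    fix a b c :: "'a \<Rightarrow> complex"
    assume "L2_rel a a" "L2_rel b b" "L2_rel c c"
    then have "sq_integrable a" "sq_integrable b" "sq_integrable c"
      by (auto simp: L2_rel_def)
    then show "integral\<^sup>L lebesgue (\<lambda>x. Re ((a x + b x) * cnj (c x))) =
        integral\<^sup>L lebesgue (\<lambda>x. Re (a x * cnj (c x))) + integral\<^sup>L lebesgue (\<lambda>x. Re (b x * cnj (c x)))"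
      unfolding distrib_right plus_complex.sel
      by (intro Bochner_Integration.integral_add sq_integrable_mult_integrable)
  qed
  show "r *\<^sub>R a \<bullet> b = r * (a \<bullet> b)"
  proof transfer
    fix r :: real and a b :: "'a \<Rightarrow> complex"
    have "Re (complex_of_real r * a x * cnj (b x)) = r * Re (a x * cnj (b x))" for x
      by (simp add: algebra_simps)
    then show "integral\<^sup>L lebesgue (\<lambda>x. Re (complex_of_real r * a x * cnj (b x))) =
        r * integral\<^sup>L lebesgue (\<lambda>x. Re (a x * cnj (b x)))"
      by (simp only: Bochner_Integration.integral_mult_right_zero)
  qed
  have sq: "Re (z * cnj z) = (cmod z)\<^sup>2" for z
    by (simp add: complex_mult_cnj cmod_power2)
  show "0 \<le> a \<bullet> a"
    by transfer (simp only: sq integral_nonneg_AE, simp)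
  show "a \<bullet> a = 0 \<longleftrightarrow> a = 0"
  proof transfer
    fix a :: "'a \<Rightarrow> complex"
    assume "L2_rel a a"
    then have a: "sq_integrable a" by (simp add: L2_rel_def)
    have "integral\<^sup>L lebesgue (\<lambda>x. Re (a x * cnj (a x))) = 0 \<longleftrightarrow>
        (AE x in lebesgue. (cmod (a x))\<^sup>2 = 0)"
      unfolding sq using a
      by (intro integral_nonneg_eq_0_iff_AE) (auto simp: sq_integrable_def)
    then show "integral\<^sup>L lebesgue (\<lambda>x. Re (a x * cnj (a x))) = 0 \<longleftrightarrow> L2_rel a (\<lambda>x. 0)"
      using a by (simp add: L2_rel_def sq_integrable_zero)
  qed
qed

end

lemma scaleC_L2_add_right: "c *\<^sub>C (a + b) = c *\<^sub>C a + c *\<^sub>C b"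
  by transfer (auto simp: L2_rel_def sq_integrable_add sq_integrable_cmult distrib_left)

lemma scaleC_L2_scaleR: "c *\<^sub>C (r *\<^sub>R a) = r *\<^sub>R (c *\<^sub>C a)"
  by transfer (simp add: L2_rel_def sq_integrable_cmult mult.left_commute)

lemma norm_scaleC_L2: "norm (c *\<^sub>C a) = cmod c * norm a"
proof -
  have "(c *\<^sub>C a) \<bullet> (c *\<^sub>C a) = (cmod c)\<^sup>2 * (a \<bullet> a)"
  proof transfer
    fix c and a :: "'a \<Rightarrow> complex"
    have "Re (c * a x * cnj (c * a x)) = (cmod c)\<^sup>2 * Re (a x * cnj (a x))" for x
      unfolding cmod_power2 by (simp add: power2_eq_square algebra_simps)
    then show "integral\<^sup>L lebesgue (\<lambda>x. Re (c * a x * cnj (c * a x))) =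
        (cmod c)\<^sup>2 * integral\<^sup>L lebesgue (\<lambda>x. Re (a x * cnj (a x)))"
      by (simp only: Bochner_Integration.integral_mult_right_zero)
  qed
  then show ?thesis
    by (simp add: norm_L2_def real_sqrt_mult)
qed

lemma bounded_linear_scaleC_L2: "bounded_linear (\<lambda>E :: 'a::euclidean_space L2. c *\<^sub>C E)"
  by (rule bounded_linear_intro[where K = "cmod c"])
     (simp_all add: scaleC_L2_add_right scaleC_L2_scaleR norm_scaleC_L2 mult.commute)

definition scaleC_op ::
  "complex \<Rightarrow> ('a::euclidean_space L2 \<Rightarrow>\<^sub>L 'a L2) \<Rightarrow> ('a L2 \<Rightarrow>\<^sub>L 'a L2)" where
  "scaleC_op c T = Blinfun (\<lambda>E. c *\<^sub>C blinfun_apply T E)"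

lemma scaleC_op_apply [simp]: "blinfun_apply (scaleC_op c T) E = c *\<^sub>C blinfun_apply T E"
  unfolding scaleC_op_def
  by (subst bounded_linear_Blinfun_apply)
     (auto intro: bounded_linear_compose[OF bounded_linear_scaleC_L2] blinfun.bounded_linear_right)

section \<open>The space $L^2(D)$ and its bounded operators\<close>

text \<open>$L^2(D)$ is realised as the closed subspace of $L^2$ of the whole space formed by the
  functions that vanish almost everywhere outside \<open>D\<close> (extension by zero).  Accordingly
  $\mathcal{L}\{L^2(D)\}$ is realised, isometrically, by the complex-linear operators with range
  in $L^2(D)$ that annihilate the functions vanishing almost everywhere on \<open>D\<close>.\<close>

definition L2_on :: "'a::euclidean_space set \<Rightarrow> 'a L2 set" where
  "L2_on D = {E. AE r in lebesgue. r \<notin> D \<longrightarrow> rep_L2 E r = 0}"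

definition L2_ops :: "'a::euclidean_space set \<Rightarrow> ('a L2 \<Rightarrow>\<^sub>L 'a L2) set" where
  "L2_ops D = {T. (\<forall>c E. blinfun_apply T (c *\<^sub>C E) = c *\<^sub>C blinfun_apply T E) \<and>
                  range (blinfun_apply T) \<subseteq> L2_on D \<and>
                  (\<forall>E\<in>L2_on (- D). blinfun_apply T E = 0)}"

definition L2_ops_inverse ::
  "'a::euclidean_space set \<Rightarrow> ('a L2 \<Rightarrow>\<^sub>L 'a L2) \<Rightarrow> ('a L2 \<Rightarrow>\<^sub>L 'a L2) \<Rightarrow> bool" where
  \<comment> \<open>\<open>R\<close> is $[1-T]^{-1}$, with \<open>1\<close> the identity of $L^2(D)$\<close>
  "L2_ops_inverse D T R \<longleftrightarrow>
     R \<in> L2_ops D \<and> (\<forall>E\<in>L2_on D. R (E - T E) = E \<and> R E - T (R E) = E)"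

definition op_holomorphic_on ::
  "(complex \<Rightarrow> ('a::euclidean_space L2 \<Rightarrow>\<^sub>L 'a L2)) \<Rightarrow> complex set \<Rightarrow> bool" where
  "op_holomorphic_on G U \<longleftrightarrow>
     (\<forall>\<zeta>\<in>U. \<exists>G'. (G has_derivative (\<lambda>w. scaleC_op w G')) (at \<zeta>))"

definition rank_one :: "('a::euclidean_space L2 \<Rightarrow>\<^sub>L 'a L2) \<Rightarrow> bool" where
  "rank_one A \<longleftrightarrow> (\<exists>u. u \<noteq> 0 \<and> range (blinfun_apply A) = range (\<lambda>c. c *\<^sub>C u))"

text \<open>\<open>simple_pole D U T \<zeta>0\<close>: the generalized resolvent $\zeta \mapsto [1-T(\zeta)]^{-1}$ of an
  operator family on \<open>U\<close> has a pole of order one at \<open>\<zeta>0\<close>, i.e. Laurent expansion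
  $A/(\zeta-\zeta_0) + G(\zeta)$ with \<open>G\<close> holomorphic, whose residue \<open>A\<close> is a rank-one operator.\<close>

definition simple_pole ::
  "'a::euclidean_space set \<Rightarrow> complex set \<Rightarrow> (complex \<Rightarrow> ('a L2 \<Rightarrow>\<^sub>L 'a L2)) \<Rightarrow> complex \<Rightarrow> bool" where
  "simple_pole D U T \<zeta>0 \<longleftrightarrow>
     (\<exists>\<rho>>0. \<exists>A G. ball \<zeta>0 \<rho> \<subseteq> U \<and> A \<in> L2_ops D \<and> rank_one A \<and>
        (\<forall>\<zeta>\<in>ball \<zeta>0 \<rho>. G \<zeta> \<in> L2_ops D) \<and> op_holomorphic_on G (ball \<zeta>0 \<rho>) \<and>
        (\<forall>\<zeta>\<in>ball \<zeta>0 \<rho> - {\<zeta>0}.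
           L2_ops_inverse D (T \<zeta>) (scaleC_op (1 / (\<zeta> - \<zeta>0)) A + G \<zeta>)))"

definition continuously_frechet_differentiable_on ::
  "('a::real_normed_vector \<Rightarrow> 'b::real_normed_vector) \<Rightarrow> 'a set \<Rightarrow> bool" where
  "continuously_frechet_differentiable_on F S \<longleftrightarrow>
     (\<exists>F'. (\<forall>p\<in>S. (F has_derivative blinfun_apply (F' p)) (at p)) \<and> continuous_on S F')"

section \<open>The kernel and the integral operator\<close>

definition arg_cut :: "complex \<Rightarrow> real" where
  "arg_cut w = (THE \<theta>. - pi / 2 < \<theta> \<and> \<theta> < 3 * pi / 2 \<and> w = of_real (cmod w) * cis \<theta>)"

definition log_cut :: "complex \<Rightarrow> complex" where
  "log_cut w = of_real (ln (cmod w)) + \<i> * of_real (arg_cut w)"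

definition sqrt_cut :: "complex \<Rightarrow> complex" where
  "sqrt_cut w = exp (log_cut w / 2)"

definition k_mode :: "real \<Rightarrow> int \<Rightarrow> real" where
  "k_mode kx m = kx + 2 * pi * of_int m"

definition cut_plane :: "real \<Rightarrow> complex set" where
  "cut_plane kx = - (\<Union>m. {of_real ((k_mode kx m)\<^sup>2) - \<i> * of_real s | s. s \<ge> 0})"

text \<open>For \<open>\<zeta>\<close> in the cut plane the series converges absolutely whenever \<open>z \<noteq> 0\<close>; the
  null set \<open>z = 0\<close>, on which \<open>infsum\<close> may return its default value, is irrelevant below.\<close>

definition H_kernel :: "real \<Rightarrow> complex \<Rightarrow> real \<times> real \<Rightarrow> complex" where
  "H_kernel kx \<zeta> = (\<lambda>(x, z). \<i> * \<zeta> / 2 *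
     (\<Sum>\<^sub>\<infinity>m\<in>UNIV.
        exp (\<i> * (of_real (x * k_mode kx m) +
                  of_real \<bar>z\<bar> * sqrt_cut (\<zeta> - of_real ((k_mode kx m)\<^sup>2))))
        / sqrt_cut (\<zeta> - of_real ((k_mode kx m)\<^sup>2))))"

definition rect :: "real \<Rightarrow> real \<Rightarrow> (real \<times> real) set" where
  "rect zm zp = {0..1} \<times> {zm..zp}"

definition strip_support :: "(real \<times> real \<Rightarrow> real) \<Rightarrow> (real \<times> real) set" where
  "strip_support \<epsilon> = closure {r \<in> {0..1} \<times> UNIV. \<epsilon> r - 1 \<noteq> 0}"

definition H_fun ::
  "real \<Rightarrow> (real \<times> real) set \<Rightarrow> (real \<times> real \<Rightarrow> real) \<Rightarrow> complex \<Rightarrow>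
     (real \<times> real \<Rightarrow> complex) \<Rightarrow> real \<times> real \<Rightarrow> complex" where
  "H_fun kx D \<epsilon> \<zeta> E r =
     (if r \<in> D
      then set_lebesgue_integral lebesgue D
             (\<lambda>r0. of_real (\<epsilon> r0 - 1) * H_kernel kx \<zeta> (r - r0) * E r0)
      else 0)"

definition H_op ::
  "real \<Rightarrow> (real \<times> real) set \<Rightarrow> (real \<times> real \<Rightarrow> real) \<Rightarrow> complex \<Rightarrow>
     ((real \<times> real) L2 \<Rightarrow>\<^sub>L (real \<times> real) L2)" where
  "H_op kx D \<epsilon> \<zeta> = Blinfun (\<lambda>E. abs_L2 (H_fun kx D \<epsilon> \<zeta> (rep_L2 E)))"

definition siegert_state ::
  "real \<Rightarrow> (real \<times> real) set \<Rightarrow> (real \<times> real \<Rightarrow> real) \<Rightarrow> complex \<Rightarrow> (real \<times> real) L2 \<Rightarrow> bool" where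
  "siegert_state kx D \<epsilon> \<zeta> E \<longleftrightarrow> E \<in> L2_on D \<and> E \<noteq> 0 \<and> H_op kx D \<epsilon> \<zeta> E = E"

text \<open>A $C^1$ branch over \<open>J\<close> of simple poles passing through \<open>(hn, \<zeta>n)\<close>.\<close>

definition simple_pole_branch ::
  "real \<Rightarrow> (real \<times> real) set \<Rightarrow> (real \<Rightarrow> real \<times> real \<Rightarrow> real) \<Rightarrow> real \<Rightarrow> complex \<Rightarrow>
     real set \<Rightarrow> (real \<Rightarrow> complex) \<Rightarrow> bool" where
  "simple_pole_branch kx D \<epsilon> hn \<zeta>n J \<zeta> \<longleftrightarrow>
     \<zeta> C1_differentiable_on J \<and> \<zeta> ` J \<subseteq> cut_plane kx \<and> \<zeta> hn = \<zeta>n \<and>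
     (\<forall>h\<in>J. simple_pole D (cut_plane kx) (H_op kx D (\<epsilon> h)) (\<zeta> h))"

end

(* Near a simple pole, 1 - T(h,zeta) is made invertible by bordering it with a rank-one operator:
   if the residue A at (h_n,zeta_n) has range spanned by u, pick v with A v = u and let psi be the
   u-coefficient; then B = 1 - T + psi(.) v is invertible at (h_n,zeta_n), with an explicit inverse
   built from A and the regular part, hence invertible nearby with a C^1 inverse I. The scalar function
   d(h,zeta) = 1 - psi(I v) vanishes exactly where 1 is an eigenvalue of T, and d_zeta = 1 at
   (h_n,zeta_n), so the inverse function theorem gives the branch zeta(h); the residue is a multiple of
   psi(I .) I v and the Siegert state is E(h) = I(h,zeta(h)) v. Uniqueness on the whole interval follows
   from local uniqueness and connectedness.

   Frechet differentiability of H(h,zeta) in the hypothesis is over the reals. Complex linearity of the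
   zeta-derivative comes from the kernel: each mode is O(|m|^(-5/4) |z|^(-1/4)), locally uniformly in
   zeta, so the kernel is holomorphic in zeta for z <> 0 and dominated by a square-integrable function. *)

theory Submission
  imports Defs "HOL-Complex_Analysis.Complex_Analysis"
begin

section \<open>Completeness of \<open>L2\<close>\<close>

text \<open>Operators act here on the whole of L2, while poles are defined on
  \<open>L2_on D\<close>. The bordered operator is kept on the whole space, where it is the identity
  off \<open>D\<close>, and the piece \<open>id_blinfun - restr D\<close> is subtracted again when a
  resolvent is read off. No Fredholm theory enters: the Laurent coefficients at the given pole
  already contain an inverse of 1 - T modulo the span of u, and the border repairs exactly this
  defect. The normalisation d_zeta = 1 is the coefficient identity A T1 u = - u, with T1 the
  zeta-derivative of T. Two obstacles shape the rest. A simple pole asks for a regular part that is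
  differentiable as an operator function at the pole itself; this comes from scalar Cauchy estimates
  on matrix elements, uniform in the vectors. And invertibility of nearby operators is a fixed-point
  argument in the Banach space of operators, hence the completeness of L2.\<close>

lemma L2_rel_rep: "L2_rel (rep_L2 E) (rep_L2 E)"
  by (simp add: Quotient_rel_rep[OF Quotient_L2])

lemma sq_integrable_rep: "sq_integrable (rep_L2 E)"
  using L2_rel_rep[of E] by (simp add: L2_rel_def)

lemma borel_measurable_rep: "rep_L2 E \<in> borel_measurable lebesgue"
  using sq_integrable_rep[of E] by (simp add: sq_integrable_def)

lemma integrable_rep: "integrable lebesgue (\<lambda>x. (cmod (rep_L2 E x))\<^sup>2)"
  using sq_integrable_rep[of E] by (simp add: sq_integrable_def)

lemma rep_abs_L2:
  assumes "sq_integrable f" shows "AE x in lebesgue. rep_L2 (abs_L2 f) x = f x"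
proof -
  have "L2_rel f f" using assms by (simp add: L2_rel_def)
  then have "L2_rel (rep_L2 (abs_L2 f)) f"
    using Quotient_L2 by (metis Quotient_rep_abs)
  then show ?thesis by (simp add: L2_rel_def)
qed

lemma L2_eqI:
  assumes "AE x in lebesgue. rep_L2 E x = rep_L2 F x" shows "E = F"
proof -
  have "L2_rel (rep_L2 E) (rep_L2 F)" using assms by (simp add: L2_rel_def sq_integrable_rep)
  then show ?thesis by (simp add: Quotient_rel_rep[OF Quotient_L2])
qed

lemma rep_zero_L2: "AE x in lebesgue. rep_L2 0 x = 0"
  unfolding zero_L2_def by (intro rep_abs_L2 sq_integrable_zero)

lemma abs_L2_rep: "abs_L2 (rep_L2 E) = E"
  by (rule Quotient_abs_rep[OF Quotient_L2])

lemma rep_plus_L2: "AE x in lebesgue. rep_L2 (E + F) x = rep_L2 E x + rep_L2 F x"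
proof -
  have "E + F = abs_L2 (\<lambda>x. rep_L2 E x + rep_L2 F x)"
    by (subst (1 2) abs_L2_rep[symmetric]) (rule plus_L2.abs_eq[OF L2_rel_rep L2_rel_rep])
  then show ?thesis
    using rep_abs_L2[OF sq_integrable_add[OF sq_integrable_rep sq_integrable_rep], of E F] by simp
qed

lemma rep_scaleC_L2: "AE x in lebesgue. rep_L2 (c *\<^sub>C E) x = c * rep_L2 E x"
proof -
  have "c *\<^sub>C E = abs_L2 (\<lambda>x. c * rep_L2 E x)"
    by (subst (1) abs_L2_rep[symmetric]) (rule scaleC_L2.abs_eq[OF L2_rel_rep])
  then show ?thesis
    using rep_abs_L2[OF sq_integrable_cmult[OF sq_integrable_rep], of c E] by simp
qed

section \<open>Complex scalars and the norm of L2 classes\<close>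

lemma scaleC_of_real: "complex_of_real r *\<^sub>C E = r *\<^sub>R E"
  by transfer (simp add: L2_rel_def sq_integrable_cmult)

lemma scaleC_scaleC [simp]: "a *\<^sub>C b *\<^sub>C E = (a * b) *\<^sub>C E"
  by transfer (simp add: L2_rel_def sq_integrable_cmult mult.assoc)

lemma scaleC_add_left: "(a + b) *\<^sub>C E = a *\<^sub>C E + b *\<^sub>C E"
  by transfer (simp add: L2_rel_def sq_integrable_add sq_integrable_cmult distrib_right)

lemma scaleC_one [simp]: "1 *\<^sub>C E = E"
  by transfer (simp add: L2_rel_def)

lemma scaleC_zero_left [simp]: "0 *\<^sub>C E = 0"
  by transfer (simp add: L2_rel_def sq_integrable_zero)

lemma scaleC_minus1: "(-1) *\<^sub>C E = - E"
  by (metis of_real_1 of_real_minus scaleC_of_real scaleR_minus1_left)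

lemma scaleC_zero_right [simp]: "c *\<^sub>C 0 = 0"
  by (rule linear_0[OF bounded_linear.linear[OF bounded_linear_scaleC_L2]])

lemma scaleC_minus_right: "c *\<^sub>C (- E) = - (c *\<^sub>C E)"
  by (metis scaleC_minus1 scaleC_scaleC mult.commute)

lemma scaleC_minus_left: "(- c) *\<^sub>C E = - (c *\<^sub>C E)"
  by (metis scaleC_minus1 scaleC_scaleC mult_minus1)

lemma scaleC_eq_0_iff [simp]: "c *\<^sub>C E = 0 \<longleftrightarrow> c = 0 \<or> E = 0"
  by (metis norm_scaleC_L2 norm_eq_zero mult_eq_0_iff)

lemma bounded_bilinear_scaleC: "bounded_bilinear ((*\<^sub>C) :: complex \<Rightarrow> 'a::euclidean_space L2 \<Rightarrow> 'a L2)"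
proof
  show "\<exists>K. \<forall>a b. norm (a *\<^sub>C (b::'a L2)) \<le> norm a * norm b * K"
    by (rule exI[of _ 1]) (simp add: norm_scaleC_L2)
qed (auto simp: scaleC_L2_add_right scaleC_add_left scaleC_L2_scaleR scaleC_of_real[symmetric] scaleR_conv_of_real mult.commute)

lemma rep_minus_L2: "AE x in lebesgue. rep_L2 (E - F) x = rep_L2 E x - rep_L2 F x"
proof -
  have "E - F = E + (-1) *\<^sub>C F" by (simp only: scaleC_minus1 add_uminus_conv_diff)
  show ?thesis
    unfolding \<open>E - F = _\<close> using rep_plus_L2[of E "(-1) *\<^sub>C F"] rep_scaleC_L2[of "-1" F]
    by eventually_elim simp
qed

lemma norm_L2_sq: "(norm E)\<^sup>2 = (\<integral>x. (cmod (rep_L2 E x))\<^sup>2 \<partial>lebesgue)"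
proof -
  have "(norm E)\<^sup>2 = E \<bullet> E" by (simp add: power2_norm_eq_inner)
  also have "\<dots> = abs_L2 (rep_L2 E) \<bullet> abs_L2 (rep_L2 E)" by (simp add: abs_L2_rep)
  also have "\<dots> = (\<integral>x. Re (rep_L2 E x * cnj (rep_L2 E x)) \<partial>lebesgue)"
    by (rule inner_L2.abs_eq[OF L2_rel_rep L2_rel_rep])
  also have "\<dots> = (\<integral>x. (cmod (rep_L2 E x))\<^sup>2 \<partial>lebesgue)"
    by (simp add: complex_mult_cnj cmod_power2)
  finally show ?thesis .
qed

lemma nn_norm_L2_sq: "(\<integral>\<^sup>+x. ennreal ((cmod (rep_L2 E x))\<^sup>2) \<partial>lebesgue) = ennreal ((norm E)\<^sup>2)"
  unfolding norm_L2_sq by (rule nn_integral_eq_integral[OF integrable_rep]) simp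

lemma norm_abs_L2_sq:
  assumes "sq_integrable f" shows "(norm (abs_L2 f))\<^sup>2 = (\<integral>x. (cmod (f x))\<^sup>2 \<partial>lebesgue)"
proof -
  have [measurable]: "f \<in> borel_measurable lebesgue" "rep_L2 (abs_L2 f) \<in> borel_measurable lebesgue"
    using assms by (auto simp: sq_integrable_def borel_measurable_rep)
  show ?thesis
    unfolding norm_L2_sq using rep_abs_L2[OF assms] by (intro integral_cong_AE) auto
qed

lemma nn_norm_abs_L2_sq:
  assumes "sq_integrable f"
  shows "ennreal ((norm (abs_L2 f))\<^sup>2) = (\<integral>\<^sup>+x. ennreal ((cmod (f x))\<^sup>2) \<partial>lebesgue)"
  unfolding norm_abs_L2_sq[OF assms]
  by (rule nn_integral_eq_integral[symmetric]) (use assms in \<open>auto simp: sq_integrable_def\<close>)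

lemma sq_integrableI_nn:
  assumes "f \<in> borel_measurable lebesgue" "(\<integral>\<^sup>+x. ennreal ((cmod (f x))\<^sup>2) \<partial>lebesgue) < \<infinity>"
  shows "sq_integrable f"
  unfolding sq_integrable_def using assms
  by (auto intro!: integrableI_bounded borel_measurable_power borel_measurable_norm)

text \<open>Riesz--Fischer: a sequence with \<open>norm (X (n + 1) - X n) \<le> 2 ^ - n\<close> converges almost everywhere
  because \<open>(\<Sum>n. 2 ^ n * cmod (X (n + 1) x - X n x) ^ 2)\<close> has finite integral; Fatou does the rest.\<close>

lemma L2_fast_Cauchy_convergent:
  fixes X :: "nat \<Rightarrow> 'a::euclidean_space L2"
  assumes X: "\<And>m n. n \<le> m \<Longrightarrow> norm (X m - X n) \<le> (1/2)^n"
  shows "\<exists>L. X \<longlonglongrightarrow> L"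
proof -
  define x where "x n = rep_L2 (X n)" for n
  have [measurable]: "x n \<in> borel_measurable lebesgue" for n
    unfolding x_def by (rule borel_measurable_rep)
  have nn: "(\<integral>\<^sup>+y. ennreal ((cmod (x m y - x n y))\<^sup>2) \<partial>lebesgue) \<le> ennreal ((1/4)^n)" if "n \<le> m" for m n
  proof -
    have "(\<integral>\<^sup>+y. ennreal ((cmod (x m y - x n y))\<^sup>2) \<partial>lebesgue) = (\<integral>\<^sup>+y. ennreal ((cmod (rep_L2 (X m - X n) y))\<^sup>2) \<partial>lebesgue)"
      using rep_minus_L2[of "X m" "X n"] by (intro nn_integral_cong_AE) (auto simp: x_def)
    also have "\<dots> = ennreal ((norm (X m - X n))\<^sup>2)" by (rule nn_norm_L2_sq)
    also have "\<dots> \<le> ennreal (((1/2)^n)\<^sup>2)"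
      using X[OF that] by (intro ennreal_leI power_mono) auto
    also have "((1/2)^n)\<^sup>2 = ((1/4)^n :: real)" by (subst power_mult[symmetric], subst mult.commute, subst power_mult) (simp add: power2_eq_square)
    finally show ?thesis .
  qed
  have "(\<integral>\<^sup>+y. (\<Sum>n. ennreal (2^n * (cmod (x (Suc n) y - x n y))\<^sup>2)) \<partial>lebesgue)
      = (\<Sum>n. \<integral>\<^sup>+y. ennreal (2^n * (cmod (x (Suc n) y - x n y))\<^sup>2) \<partial>lebesgue)"
    by (rule nn_integral_suminf) measurable
  also have "\<dots> \<le> (\<Sum>n. ennreal ((1/2)^n))"
  proof (intro suminf_le allI)
    fix n
    have "(\<integral>\<^sup>+y. ennreal (2^n * (cmod (x (Suc n) y - x n y))\<^sup>2) \<partial>lebesgue)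
       = ennreal (2^n) * (\<integral>\<^sup>+y. ennreal ((cmod (x (Suc n) y - x n y))\<^sup>2) \<partial>lebesgue)"
      by (simp add: ennreal_mult nn_integral_cmult)
    also have "\<dots> \<le> ennreal (2^n) * ennreal ((1/4)^n)"
      by (intro mult_left_mono nn) auto
    also have "\<dots> = ennreal ((1/2)^n)"
      by (simp flip: ennreal_mult power_mult_distrib)
    finally show "(\<integral>\<^sup>+y. ennreal (2^n * (cmod (x (Suc n) y - x n y))\<^sup>2) \<partial>lebesgue) \<le> ennreal ((1/2)^n)" .
  qed auto
  also have "(\<Sum>n. ennreal ((1/2)^n)) = ennreal (\<Sum>n. (1/2)^n)"
    by (intro suminf_ennreal2 summable_geometric) auto
  also have "\<dots> < \<infinity>"
    by (simp only: infinity_ennreal_def ennreal_less_top)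
  finally have "(\<integral>\<^sup>+y. (\<Sum>n. ennreal (2^n * (cmod (x (Suc n) y - x n y))\<^sup>2)) \<partial>lebesgue) \<noteq> \<infinity>"
    by (rule less_imp_neq)
  then have fin: "AE y in lebesgue. (\<Sum>n. ennreal (2^n * (cmod (x (Suc n) y - x n y))\<^sup>2)) \<noteq> \<infinity>"
    by (rule nn_integral_PInf_AE[rotated]) measurable
  have conv: "AE y in lebesgue. convergent (\<lambda>n. x n y)"
    using fin
  proof (eventually_elim)
    case (elim y)
    define a where "a n = cmod (x (Suc n) y - x n y)" for n
    have "summable (\<lambda>n. 2^n * (a n)\<^sup>2)"
      using elim by (intro summable_suminf_not_top) (auto simp: a_def infinity_ennreal_def)
    then obtain K where K: "\<And>n. norm (2^n * (a n)\<^sup>2) \<le> K"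
      using summable_imp_Bseq[of "\<lambda>n. 2^n * (a n)\<^sup>2"] by (auto simp: Bseq_def)
    \<comment> \<open>The weight \<open>2^n\<close> pays here: a bounded
      \<open>2^n * (a n)\<^sup>2\<close> forces geometric decay of \<open>a n\<close> itself with
      ratio \<open>sqrt (1/2)\<close>, so the telescoping series converges absolutely.\<close>
    have "a n \<le> sqrt K * (sqrt (1/2))^n" for n
    proof -
      have "(a n)\<^sup>2 \<le> K * (1/2)^n" using K[of n] by (simp add: power_divide field_simps)
      then have "a n \<le> sqrt (K * (1/2)^n)" by (simp add: real_le_rsqrt)
      then show ?thesis by (simp add: real_sqrt_mult real_sqrt_power)
    qed
    moreover have "summable (\<lambda>n. sqrt K * (sqrt (1/2))^n)"
      by (intro summable_mult summable_geometric) (simp add: real_sqrt_lt_1_iff)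
    ultimately have "summable a"
      using summable_comparison_test[OF exI[of _ 0], of a "\<lambda>n. sqrt K * (sqrt (1/2))^n"]
      by (simp add: a_def)
    then have "summable (\<lambda>n. x (Suc n) y - x n y)"
      unfolding a_def by (rule summable_norm_cancel)
    then have "convergent (\<lambda>n. x n y - x 0 y)"
      unfolding summable_iff_convergent sum_lessThan_telescope[of "\<lambda>n. x n y"] .
    from convergent_add[OF this convergent_const[of "x 0 y"]] show ?case by simp
  qed
  define f where "f y = lim (\<lambda>n. x n y)" for y
  have [measurable]: "f \<in> borel_measurable lebesgue"
    unfolding f_def by measurable
  have lim: "AE y in lebesgue. (\<lambda>n. x n y) \<longlonglongrightarrow> f y"
    using conv by eventually_elim (simp add: f_def convergent_LIMSEQ_iff)
  have fat: "(\<integral>\<^sup>+y. ennreal ((cmod (f y - x n y))\<^sup>2) \<partial>lebesgue) \<le> ennreal ((1/4)^n)" for n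
  proof -
    have "(\<integral>\<^sup>+y. ennreal ((cmod (f y - x n y))\<^sup>2) \<partial>lebesgue) =
       (\<integral>\<^sup>+y. liminf (\<lambda>m. ennreal ((cmod (x m y - x n y))\<^sup>2)) \<partial>lebesgue)"
      using lim
      by (intro nn_integral_cong_AE, eventually_elim)
        (rule lim_imp_Liminf[symmetric], simp, intro tendsto_intros)
    also have "\<dots> \<le> liminf (\<lambda>m. \<integral>\<^sup>+y. ennreal ((cmod (x m y - x n y))\<^sup>2) \<partial>lebesgue)"
      by (rule nn_integral_liminf) measurable
    also have "\<dots> \<le> ennreal ((1/4)^n)"
      by (rule order.trans[OF Liminf_mono Liminf_const[THEN eq_refl]])
         (auto intro!: eventually_sequentiallyI[of n] nn)
    finally show ?thesis .
  qed
  have sq: "sq_integrable (\<lambda>y. f y - x n y)" for n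
    by (rule sq_integrableI_nn) (use fat[of n] in \<open>auto simp: less_top[symmetric] top_unique\<close>)
  have "sq_integrable (\<lambda>y. (f y - x 0 y) + x 0 y)"
    by (intro sq_integrable_add sq) (simp add: x_def sq_integrable_rep)
  then have sqf: "sq_integrable f" by simp
  have le: "norm (X n - abs_L2 f) \<le> (1/2)^n" for n
  proof -
    have "AE y in lebesgue. rep_L2 (abs_L2 f - X n) y = f y - x n y"
      using rep_minus_L2[of "abs_L2 f" "X n"] rep_abs_L2[OF sqf] by (auto simp: x_def)
    then have "ennreal ((norm (abs_L2 f - X n))\<^sup>2) = (\<integral>\<^sup>+y. ennreal ((cmod (f y - x n y))\<^sup>2) \<partial>lebesgue)"
      unfolding nn_norm_L2_sq[symmetric] by (intro nn_integral_cong_AE) auto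
    also have "\<dots> \<le> ennreal ((1/4)^n)" by (rule fat)
    finally have "(norm (abs_L2 f - X n))\<^sup>2 \<le> (1/4)^n" by (simp add: ennreal_le_iff)
    also have "(1/4)^n = (((1/2)^n)\<^sup>2 :: real)" by (subst power_mult[symmetric], subst mult.commute, subst power_mult) (simp add: power2_eq_square)
    finally show ?thesis by (subst norm_minus_commute) (auto intro: power2_le_imp_le)
  qed
  have "(\<lambda>n. X n - abs_L2 f) \<longlonglongrightarrow> 0"
    by (rule Lim_null_comparison[of _ "\<lambda>n. (1/2)^n"]) (use le in \<open>auto intro: LIMSEQ_power_zero\<close>)
  then show ?thesis using LIM_zero_cancel by blast
qed

instance L2 :: (euclidean_space) complete_space
proof
  fix X :: "nat \<Rightarrow> 'a L2" assume "Cauchy X"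
  then have "\<forall>n. \<exists>N. \<forall>i\<ge>N. \<forall>j\<ge>N. norm (X i - X j) < (1/2)^n"
    by (metis CauchyD zero_less_power zero_less_divide_1_iff zero_less_numeral)
  then obtain N where N: "\<And>n i j. N n \<le> i \<Longrightarrow> N n \<le> j \<Longrightarrow> norm (X i - X j) < (1/2)^n"
    by metis
  \<comment> \<open>Summing all \<open>N k\<close> with k <= n makes \<open>r m\<close> admissible
    for every index n <= m at once; the extra n makes \<open>r\<close> strictly increasing.\<close>
  define r where "r n = (\<Sum>k\<le>n. N k) + n" for n
  have rN: "N n \<le> r m" if "n \<le> m" for n m
    unfolding r_def using member_le_sum[of n "{..m}" N] that by simp
  have "strict_mono r" by (rule strict_monoI_Suc) (simp add: r_def)
  have "\<exists>L. (X \<circ> r) \<longlonglongrightarrow> L"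
    by (rule L2_fast_Cauchy_convergent) (auto intro!: less_imp_le N rN)
  then obtain L where "(X \<circ> r) \<longlonglongrightarrow> L" ..
  then have "X \<longlonglongrightarrow> L"
    using Cauchy_converges_subseq \<open>Cauchy X\<close> \<open>strict_mono r\<close> by (metis LIMSEQ_subseq_LIMSEQ)
  then show "convergent X" by (auto simp: convergent_def)
qed

instance L2 :: (euclidean_space) banach ..

section \<open>Inverses of bounded operators\<close>

lemma blinfun_compose_assoc: "(f o\<^sub>L g) o\<^sub>L h = f o\<^sub>L (g o\<^sub>L h)"
  by (rule blinfun_eqI) simp

lemma blinfun_compose_id [simp]: "id_blinfun o\<^sub>L f = f" "f o\<^sub>L id_blinfun = f"
  by (rule blinfun_eqI, simp)+

text \<open>The inverse of \<open>B\<^sub>0 - N\<close> solves the fixed-point equation \<open>X = J + X o N o J\<close> in the Banach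
  space of operators, with \<open>J\<close> the inverse of \<open>B\<^sub>0\<close>.\<close>

lemma blinfun_inverse_perturb:
  fixes B0 J B :: "'a::banach \<Rightarrow>\<^sub>L 'a"
  assumes BJ: "B0 o\<^sub>L J = id_blinfun" and JB: "J o\<^sub>L B0 = id_blinfun"
    and small: "norm (B0 - B) * norm J \<le> 1/2"
  shows "\<exists>I. B o\<^sub>L I = id_blinfun \<and> I o\<^sub>L B = id_blinfun"
proof -
  define N where "N = B0 - B"
  have B: "B = B0 - N" by (simp add: N_def)
  interpret bounded_bilinear "(o\<^sub>L)" by (rule bounded_bilinear_blinfun_compose)
  have "\<exists>!X. J + (X o\<^sub>L (N o\<^sub>L J)) = X"
  proof (rule banach_fix_type[of "1/2"]; (intro allI)?)
    fix X Y :: "'a \<Rightarrow>\<^sub>L 'a"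
    have "dist (J + (X o\<^sub>L (N o\<^sub>L J))) (J + (Y o\<^sub>L (N o\<^sub>L J))) = norm ((X - Y) o\<^sub>L (N o\<^sub>L J))"
      by (simp add: dist_norm diff_left)
    also have "\<dots> \<le> norm (X - Y) * (norm N * norm J)"
      by (intro order.trans[OF norm_blinfun_compose] mult_left_mono norm_blinfun_compose) auto
    also have "\<dots> \<le> norm (X - Y) * (1/2)"
      using small by (intro mult_left_mono) (auto simp: N_def)
    finally show "dist (J + (X o\<^sub>L (N o\<^sub>L J))) (J + (Y o\<^sub>L (N o\<^sub>L J))) \<le> 1/2 * dist X Y"
      by (simp add: dist_norm)
  qed auto
  then obtain X where X: "J + (X o\<^sub>L (N o\<^sub>L J)) = X" by blast
  \<comment> \<open>The first fixed point gives a left inverse and the mirrored equation a right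
    inverse; associativity then makes them equal.\<close>
  have "\<exists>!Y. J + ((J o\<^sub>L N) o\<^sub>L Y) = Y"
  proof (rule banach_fix_type[of "1/2"]; (intro allI)?)
    fix X Y :: "'a \<Rightarrow>\<^sub>L 'a"
    have "dist (J + ((J o\<^sub>L N) o\<^sub>L X)) (J + ((J o\<^sub>L N) o\<^sub>L Y)) = norm ((J o\<^sub>L N) o\<^sub>L (X - Y))"
      by (simp add: dist_norm diff_right)
    also have "\<dots> \<le> (norm J * norm N) * norm (X - Y)"
      by (intro order.trans[OF norm_blinfun_compose] mult_right_mono norm_blinfun_compose) auto
    also have "\<dots> \<le> (1/2) * norm (X - Y)"
      using small by (intro mult_right_mono) (auto simp: N_def mult.commute)
    finally show "dist (J + ((J o\<^sub>L N) o\<^sub>L X)) (J + ((J o\<^sub>L N) o\<^sub>L Y)) \<le> 1/2 * dist X Y"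
      by (simp add: dist_norm)
  qed auto
  then obtain Y where Y: "J + ((J o\<^sub>L N) o\<^sub>L Y) = Y" by blast
  \<comment> \<open>Inserting \<open>J o\<^sub>L B0\<close> on the right exposes X - X o N o J,
    which the fixed-point equation identifies with \<open>J\<close>.\<close>
  have "X o\<^sub>L B = (X o\<^sub>L B) o\<^sub>L (J o\<^sub>L B0)" by (simp add: JB)
  also have "\<dots> = ((X o\<^sub>L (B0 o\<^sub>L J)) - (X o\<^sub>L (N o\<^sub>L J))) o\<^sub>L B0"
    by (simp add: B diff_left diff_right blinfun_compose_assoc)
  also have "(X o\<^sub>L (B0 o\<^sub>L J)) - (X o\<^sub>L (N o\<^sub>L J)) = J"
    unfolding BJ blinfun_compose_id using X by (rule add_implies_diff[symmetric])
  finally have XB: "X o\<^sub>L B = id_blinfun" by (simp add: JB)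
  have "B o\<^sub>L Y = (B0 o\<^sub>L J) o\<^sub>L (B o\<^sub>L Y)" by (simp add: BJ)
  also have "\<dots> = B0 o\<^sub>L (((J o\<^sub>L B0) o\<^sub>L Y) - ((J o\<^sub>L N) o\<^sub>L Y))"
    by (simp add: B diff_left diff_right blinfun_compose_assoc)
  also have "((J o\<^sub>L B0) o\<^sub>L Y) - ((J o\<^sub>L N) o\<^sub>L Y) = J"
    unfolding JB blinfun_compose_id using Y by (rule add_implies_diff[symmetric])
  finally have BY: "B o\<^sub>L Y = id_blinfun" by (simp add: BJ)
  have "X = Y" using XB BY blinfun_compose_assoc[of X B Y] by simp
  then show ?thesis using XB BY by blast
qed

text \<open>The resolvent identity I - J = I o (B0 - B) o J, combined with smallness, first bounds
  \<open>norm I\<close> by \<open>2 * norm J\<close> and is then used again with this bound. It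
  makes inversion continuous at \<open>B0\<close> for whichever inverses have been chosen
  nearby.\<close>

lemma norm_blinfun_inverse_perturb:
  fixes B0 J B I :: "'a::real_normed_vector \<Rightarrow>\<^sub>L 'a"
  assumes BJ: "B0 o\<^sub>L J = id_blinfun" and IB: "I o\<^sub>L B = id_blinfun"
    and small: "norm (B0 - B) * norm J \<le> 1/2"
  shows "norm (I - J) \<le> 2 * (norm J)\<^sup>2 * norm (B0 - B)"
proof -
  interpret bounded_bilinear "(o\<^sub>L)" by (rule bounded_bilinear_blinfun_compose)
  have eq: "I - J = I o\<^sub>L ((B0 - B) o\<^sub>L J)"
    by (simp add: diff_left diff_right BJ) (simp add: blinfun_compose_assoc[symmetric] IB)
  have "norm (I - J) \<le> norm I * (norm (B0 - B) * norm J)"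
    unfolding eq by (intro order.trans[OF norm_blinfun_compose] mult_left_mono norm_blinfun_compose) auto
  then have *: "norm (I - J) \<le> norm I * (norm (B0 - B) * norm J)" .
  also have "\<dots> \<le> norm I * (1/2)" using small by (intro mult_left_mono) auto
  finally have "norm I \<le> 2 * norm J"
    using norm_triangle_sub[of I J] by simp
  then have "norm I * (norm (B0 - B) * norm J) \<le> (2 * norm J) * (norm (B0 - B) * norm J)"
    by (intro mult_right_mono) auto
  with * show ?thesis by (simp add: power2_eq_square algebra_simps)
qed

text \<open>Where \<open>g\<close> vanishes the product rule needs only continuity of
  \<open>f\<close>: the term \<open>bil (f y - f x) (g y)\<close> is o(1) times O(norm (y - x)).
  This breaks the circularity in differentiating an inverse, whose increment contains the inverse
  itself.\<close>

lemma has_derivative_bilinear_null: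
  assumes bb: "bounded_bilinear bil"
    and g: "(g has_derivative g') (at x)" "g x = 0" and f: "isCont f x"
  shows "((\<lambda>y. bil (f y) (g y)) has_derivative (\<lambda>h. bil (f x) (g' h))) (at x)"
proof -
  interpret bounded_bilinear bil by (rule bb)
  have bl: "bounded_linear g'" using g by (rule_tac has_derivative_bounded_linear)
  obtain K where K: "K > 0" "\<And>h. norm (g' h) \<le> norm h * K"
    using bounded_linear.pos_bounded[OF bl] by auto
  have 1: "((\<lambda>y. bil (f x) (g y)) has_derivative (\<lambda>h. bil (f x) (g' h))) (at x)"
    by (rule bounded_linear.has_derivative[OF bounded_linear_right g(1)])
  have "((\<lambda>y. bil (f y - f x) (g y)) has_derivative (\<lambda>h. 0)) (at x)"
  proof (rule has_derivativeI)
    obtain C where C: "C > 0" "\<And>a b. norm (bil a b) \<le> norm a * norm b * C"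
      using pos_bounded by blast
    have gn: "((\<lambda>y. norm (g y - g x - g' (y - x)) / norm (y - x)) \<longlongrightarrow> 0) (at x)"
      using g(1) by (simp add: has_derivative_iff_norm)
    have "((\<lambda>y. norm (f y - f x) * (norm (g y - g x - g' (y - x)) / norm (y - x) + K) * C) \<longlongrightarrow> 0 * (0 + K) * C) (at x)"
      by (intro tendsto_intros gn tendsto_norm_zero LIM_zero f[unfolded isCont_def])
    then have lim: "((\<lambda>y. norm (f y - f x) * (norm (g y - g x - g' (y - x)) / norm (y - x) + K) * C) \<longlongrightarrow> 0) (at x)"
      by simp
    have "((\<lambda>y. (bil (f y - f x) (g y) - bil (f x - f x) (g x) - 0) /\<^sub>R norm (y - x)) \<longlongrightarrow> 0) (at x within UNIV)"
    proof (rule Lim_null_comparison[OF _ lim], rule eventually_at_filter[THEN iffD2], rule always_eventually, intro allI impI)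
      fix y assume y: "y \<noteq> x"
      have "norm (g y) \<le> norm (g y - g x - g' (y - x)) + norm (g' (y - x))"
        using norm_triangle_ineq[of "g y - g x - g' (y - x)" "g' (y - x)"] g(2) by simp
      also have "\<dots> \<le> norm (g y - g x - g' (y - x)) + norm (y - x) * K" using K(2)[of "y - x"] by simp
      finally have gy: "norm (g y) / norm (y - x) \<le> norm (g y - g x - g' (y - x)) / norm (y - x) + K"
        using y by (simp add: field_simps)
      have "norm (bil (f y - f x) (g y)) / norm (y - x) \<le> norm (f y - f x) * norm (g y) * C / norm (y - x)"
        by (intro divide_right_mono C) auto
      also have "\<dots> = norm (f y - f x) * (norm (g y) / norm (y - x)) * C" by simp
      also have "\<dots> \<le> norm (f y - f x) * (norm (g y - g x - g' (y - x)) / norm (y - x) + K) * C"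
        using gy C by (intro mult_right_mono mult_left_mono) auto
      finally show "norm ((bil (f y - f x) (g y) - bil (f x - f x) (g x) - 0) /\<^sub>R norm (y - x))
         \<le> norm (f y - f x) * (norm (g y - g x - g' (y - x)) / norm (y - x) + K) * C"
        by (simp add: g(2) zero_right divide_inverse mult.commute)
    qed
    then show "((\<lambda>y. (bil (f y - f x) (g y) - bil (f x - f x) (g x) - 0) /\<^sub>R norm (y - x)) \<longlongrightarrow> 0) (at x)"
      by simp
  qed auto
  from has_derivative_add[OF 1 this] show ?thesis by (simp add: diff_left)
qed

text \<open>Write I q = I p + I q o (B p - B q) o I p. The middle factor vanishes at q = p, so
  continuity of \<open>I\<close>, which the Lipschitz estimate supplies, is enough to differentiate
  the product.\<close>

lemma has_derivative_blinfun_inverse: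
  fixes B I :: "'b::real_normed_vector \<Rightarrow> ('a::real_normed_vector \<Rightarrow>\<^sub>L 'a)"
  assumes inv: "\<And>q. q \<in> S \<Longrightarrow> B q o\<^sub>L I q = id_blinfun \<and> I q o\<^sub>L B q = id_blinfun"
    and S: "open S" "p \<in> S"
    and B: "(B has_derivative B') (at p)"
  shows "(I has_derivative (\<lambda>x. - (I p o\<^sub>L (B' x o\<^sub>L I p)))) (at p)"
proof -
  interpret bounded_bilinear "(o\<^sub>L)" by (rule bounded_bilinear_blinfun_compose)
  have Bc: "(B \<longlongrightarrow> B p) (at p)" using has_derivative_continuous[OF B] by (simp add: continuous_at)
  have ev: "eventually (\<lambda>q. q \<in> S) (at p)" using S by (simp add: eventually_at_topological) blast
  have "((\<lambda>q. norm (B p - B q) * norm (I p)) \<longlongrightarrow> norm (B p - B p) * norm (I p)) (at p)"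
    by (intro tendsto_intros Bc)
  then have "eventually (\<lambda>q. norm (B p - B q) * norm (I p) < 1/2) (at p)"
    by (intro order_tendstoD(2)) auto
  with ev have ev2: "eventually (\<lambda>q. norm (I q - I p) \<le> 2 * (norm (I p))\<^sup>2 * norm (B p - B q)) (at p)"
  proof eventually_elim
    case (elim q)
    then show ?case using inv[of p] inv[of q] S by (intro norm_blinfun_inverse_perturb) auto
  qed
  have "((\<lambda>q. 2 * (norm (I p))\<^sup>2 * norm (B p - B q)) \<longlongrightarrow> 2 * (norm (I p))\<^sup>2 * norm (B p - B p)) (at p)"
    by (intro tendsto_intros Bc)
  then have "((\<lambda>q. I q - I p) \<longlongrightarrow> 0) (at p)"
    by (intro Lim_null_comparison[OF ev2]) simp
  then have cont: "isCont I p" by (simp add: isCont_def LIM_zero_iff)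
  have "((\<lambda>q. B p - B q) has_derivative (\<lambda>x. - B' x)) (at p)"
    using has_derivative_diff[OF has_derivative_const B, of "B p"] by simp
  then have "((\<lambda>q. (B p - B q) o\<^sub>L I p) has_derivative (\<lambda>x. (- B' x) o\<^sub>L I p)) (at p)"
    by (rule bounded_linear.has_derivative[OF bounded_linear_left])
  from has_derivative_bilinear_null[OF bounded_bilinear_blinfun_compose this _ cont]
  have D: "((\<lambda>q. I q o\<^sub>L ((B p - B q) o\<^sub>L I p)) has_derivative (\<lambda>x. I p o\<^sub>L ((- B' x) o\<^sub>L I p))) (at p)"
    by (simp add: zero_left)
  have eq: "I q = I p + (I q o\<^sub>L ((B p - B q) o\<^sub>L I p))" if "q \<in> S" for q
    using inv[OF that] inv[OF S(2)] by (simp add: diff_left diff_right) (simp add: blinfun_compose_assoc[symmetric])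
  have "((\<lambda>q. I p + (I q o\<^sub>L ((B p - B q) o\<^sub>L I p))) has_derivative (\<lambda>x. - (I p o\<^sub>L (B' x o\<^sub>L I p)))) (at p)"
    using has_derivative_add[OF has_derivative_const D, of "I p"] by (simp add: minus_left minus_right)
  then show ?thesis
    by (rule has_derivative_transform_within_open[OF _ S]) (use eq in auto)
qed

section \<open>Holomorphic families of operators\<close>

lemma scaleC_inner: "(c *\<^sub>C E) \<bullet> F = E \<bullet> (cnj c *\<^sub>C F)"
  by transfer (simp add: algebra_simps)

text \<open>The Hermitian product, linear in its first argument, rebuilt from its real part:
  replacing \<open>F\<close> by \<open>\<i> *\<^sub>C F\<close> multiplies the product by - i and so
  exposes the imaginary part.\<close>

definition cip :: "'a::euclidean_space L2 \<Rightarrow> 'a L2 \<Rightarrow> complex" where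
  "cip E F = Complex (E \<bullet> F) (E \<bullet> (\<i> *\<^sub>C F))"

lemma cip_add: "cip (E + E') F = cip E F + cip E' F"
  by (simp add: cip_def complex_eq_iff inner_add_left)

lemma cip_diff: "cip (E - E') F = cip E F - cip E' F"
  by (simp add: cip_def complex_eq_iff inner_diff_left)

lemma scaleC_Re_Im: "c *\<^sub>C E = Re c *\<^sub>R E + Im c *\<^sub>R (\<i> *\<^sub>C E)"
proof -
  have "c *\<^sub>C E = (complex_of_real (Re c) + complex_of_real (Im c) * \<i>) *\<^sub>C E"
    by (subst complex_eq) (simp add: mult.commute)
  also have "\<dots> = Re c *\<^sub>R E + Im c *\<^sub>R (\<i> *\<^sub>C E)"
    by (simp only: scaleC_add_left scaleC_of_real flip: scaleC_scaleC)
  finally show ?thesis .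
qed

lemma cip_scaleC: "cip (c *\<^sub>C E) F = c * cip E F"
proof -
  have 1: "(c *\<^sub>C E) \<bullet> G = Re c * (E \<bullet> G) - Im c * (E \<bullet> (\<i> *\<^sub>C G))" for G
    unfolding scaleC_inner by (subst scaleC_Re_Im) (simp add: inner_add_right inner_diff_right)
  have 2: "\<i> *\<^sub>C \<i> *\<^sub>C F = - F"
    by (simp only: scaleC_scaleC i_squared scaleC_minus1)
  show ?thesis
    by (simp add: cip_def complex_eq_iff 1 2 del: scaleC_scaleC)
qed

lemma Re_cip_self: "Re (cip E E) = (norm E)\<^sup>2"
  by (simp add: cip_def power2_norm_eq_inner)

lemma cmod_cip_le: "cmod (cip E F) \<le> 2 * norm E * norm F"
proof -
  have "cmod (cip E F) \<le> \<bar>E \<bullet> F\<bar> + \<bar>E \<bullet> (\<i> *\<^sub>C F)\<bar>"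
    using cmod_le[of "cip E F"] by (simp add: cip_def)
  also have "\<dots> \<le> norm E * norm F + norm E * norm (\<i> *\<^sub>C F)"
    by (intro add_mono Cauchy_Schwarz_ineq2)
  finally show ?thesis by (simp add: norm_scaleC_L2)
qed

lemma bounded_linear_cip: "bounded_linear (\<lambda>E. cip E F)"
proof (rule bounded_linear_intro[where K = "2 * norm F"])
  show "cip (r *\<^sub>R E) F = r *\<^sub>R cip E F" for r E
    using cip_scaleC[of "of_real r" E F] by (simp add: scaleC_of_real scaleR_conv_of_real)
  show "norm (cip E F) \<le> norm E * (2 * norm F)" for E
    using cmod_cip_le[of E F] by (simp add: algebra_simps)
qed (simp add: cip_add)

lemma norm_scaleC_op: "norm (scaleC_op c T) \<le> cmod c * norm T"
proof (rule norm_blinfun_bound)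
  fix E
  have "cmod c * norm (blinfun_apply T E) \<le> cmod c * (norm T * norm E)"
    by (intro mult_left_mono norm_blinfun) simp
  then show "norm (blinfun_apply (scaleC_op c T) E) \<le> cmod c * norm T * norm E"
    by (simp add: norm_scaleC_L2 mult.assoc)
qed simp

lemma bounded_bilinear_scaleC_op:
  "bounded_bilinear (scaleC_op :: complex \<Rightarrow> ('a::euclidean_space L2 \<Rightarrow>\<^sub>L 'a L2) \<Rightarrow> _)"
proof
  interpret s: bounded_bilinear "(*\<^sub>C) :: complex \<Rightarrow> 'a L2 \<Rightarrow> _" by (rule bounded_bilinear_scaleC)
  fix a a' r and T T' :: "'a L2 \<Rightarrow>\<^sub>L 'a L2"
  show "scaleC_op (a + a') T = scaleC_op a T + scaleC_op a' T"
    by (rule blinfun_eqI) (simp add: blinfun.add_left s.add_left)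
  show "scaleC_op a (T + T') = scaleC_op a T + scaleC_op a T'"
    by (rule blinfun_eqI) (simp add: blinfun.add_left s.add_right)
  show "scaleC_op (r *\<^sub>R a) T = r *\<^sub>R scaleC_op a T"
    by (rule blinfun_eqI) (simp add: blinfun.scaleR_left s.scaleR_left)
  show "scaleC_op a (r *\<^sub>R T) = r *\<^sub>R scaleC_op a T"
    by (rule blinfun_eqI) (simp add: blinfun.scaleR_left s.scaleR_right)
  show "\<exists>K. \<forall>a T. norm (scaleC_op a (T :: 'a L2 \<Rightarrow>\<^sub>L 'a L2)) \<le> norm a * norm T * K"
    by (intro exI[of _ 1]) (simp add: norm_scaleC_op)
qed

interpretation scaleC_op: bounded_bilinear "scaleC_op :: complex \<Rightarrow> ('a::euclidean_space L2 \<Rightarrow>\<^sub>L 'a L2) \<Rightarrow> _"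
  by (rule bounded_bilinear_scaleC_op)

interpretation scaleC: bounded_bilinear "(*\<^sub>C) :: complex \<Rightarrow> 'a::euclidean_space L2 \<Rightarrow> _"
  by (rule bounded_bilinear_scaleC)

lemma scaleC_op_scaleC_op [simp]: "scaleC_op a (scaleC_op b T) = scaleC_op (a * b) T"
  by (rule blinfun_eqI) simp

lemma scaleC_op_one [simp]: "scaleC_op 1 T = T"
  by (rule blinfun_eqI) simp

text \<open>The singularity of the quotient at \<open>z0\<close> is removable, so the maximum
  modulus principle carries the trivial bound 2 B / r from the circle, where the denominator has
  modulus r, to the whole disc.\<close>

lemma difference_quotient_bound:
  assumes f: "f holomorphic_on ball z0 \<rho>" and \<rho>: "0 < r" "r < \<rho>"
    and B: "\<And>z. dist z0 z = r \<Longrightarrow> cmod (f z) \<le> B" "cmod (f z0) \<le> B"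
  defines "h \<equiv> \<lambda>z. if z = z0 then deriv f z0 else (f z - f z0) / (z - z0)"
  shows "h holomorphic_on ball z0 \<rho>" and "\<And>z. z \<in> cball z0 r \<Longrightarrow> cmod (h z) \<le> 2 * B / r"
proof -
  show h: "h holomorphic_on ball z0 \<rho>"
    unfolding h_def using f \<rho> by (intro pole_lemma) (auto simp: interior_open)
  fix z assume z: "z \<in> cball z0 r"
  show "cmod (h z) \<le> 2 * B / r"
  proof (rule maximum_modulus_frontier[of h "cball z0 r"])
    have "cball z0 r \<subseteq> ball z0 \<rho>" using \<rho> by auto
    then show "h holomorphic_on interior (cball z0 r)" "continuous_on (closure (cball z0 r)) h"
      using h holomorphic_on_subset[OF h, of "interior (cball z0 r)"] interior_subset[of "cball z0 r"]
      by (auto simp del: interior_cball intro!: continuous_on_subset[OF holomorphic_on_imp_continuous_on])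
    fix w assume "w \<in> frontier (cball z0 r)"
    then have w: "dist z0 w = r" using \<rho> by (simp add: frontier_cball)
    then have "h w = (f w - f z0) / (w - z0)" using \<rho> by (auto simp: h_def)
    moreover have "cmod (w - z0) = r" using w by (simp add: dist_norm norm_minus_commute)
    moreover have "cmod (f w - f z0) \<le> 2 * B"
      using norm_triangle_ineq4[of "f w" "f z0"] B(1)[OF w] B(2) by simp
    ultimately show "cmod (h w) \<le> 2 * B / r"
      using \<rho> by (simp add: norm_divide divide_right_mono)
  qed (use z in auto)
qed

text \<open>Each division by z - z0 costs a factor 2 / r, which gives 4 B / r^2 on the disc;
  Cauchy's inequality on circles of radius r / 2 then bounds the derivative by 8 B / r^3. The bound
  is linear in \<open>B\<close>, which makes it uniform over the matrix elements of an operator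
  family.\<close>

lemma second_difference_quotient_lipschitz:
  assumes f: "f holomorphic_on ball z0 \<rho>" and \<rho>: "0 < r" "r < \<rho>"
    and B: "\<And>z. z \<in> ball z0 \<rho> \<Longrightarrow> cmod (f z) \<le> B"
    and z: "z \<in> ball z0 (r/2) - {z0}" "z' \<in> ball z0 (r/2) - {z0}"
  defines "q \<equiv> \<lambda>z. (f z - f z0 - (z - z0) * deriv f z0) / (z - z0)\<^sup>2"
  shows "cmod (q z - q z') \<le> 8 * B / r^3 * cmod (z - z')"
proof -
  define h where "h z = (if z = z0 then deriv f z0 else (f z - f z0) / (z - z0))" for z
  define k where "k z = (if z = z0 then deriv h z0 else (h z - h z0) / (z - z0))" for z
  have Bf: "cmod (f z) \<le> B" if "z \<in> cball z0 r" for z using that \<rho> by (intro B) auto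
  have h: "h holomorphic_on ball z0 \<rho>" "\<And>z. z \<in> cball z0 r \<Longrightarrow> cmod (h z) \<le> 2 * B / r"
    using difference_quotient_bound[OF f \<rho>, of B] Bf \<rho>
    by (force simp: h_def[abs_def])+
  have k: "k holomorphic_on ball z0 \<rho>" "\<And>z. z \<in> cball z0 r \<Longrightarrow> cmod (k z) \<le> 2 * (2 * B / r) / r"
    using difference_quotient_bound[OF h(1) \<rho>, of "2 * B / r"] h(2) \<rho>
    by (force simp: k_def[abs_def])+
  have qk: "q w = k w" if "w \<noteq> z0" for w
    using that by (simp add: q_def k_def h_def power2_eq_square divide_simps)
  have "cmod (k z - k z') \<le> (8 * B / r^3) * cmod (z - z')"
  proof (rule field_differentiable_bound[of "ball z0 (r/2)" k "deriv k"])
    fix w assume w: "w \<in> ball z0 (r/2)"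
    then have "w \<in> ball z0 \<rho>" using \<rho> by auto
    then show "(k has_field_derivative deriv k w) (at w within ball z0 (r/2))"
      using k(1) holomorphic_derivI[OF k(1)] by (auto intro: has_field_derivative_at_within)
    have sub: "cball w (r/2) \<subseteq> cball z0 r"
    proof
      fix v assume "v \<in> cball w (r/2)"
      then show "v \<in> cball z0 r" using w dist_triangle[of z0 v w] by simp
    qed
    then have sub': "ball w (r/2) \<subseteq> ball z0 \<rho>" "cball w (r/2) \<subseteq> ball z0 \<rho>"
      using \<rho> ball_subset_cball[of w "r/2"] by fastforce+
    have "cmod ((deriv ^^ 1) k w) \<le> fact 1 * (2 * (2 * B / r) / r) / (r/2)^1"
    proof (rule Cauchy_inequality)
      show "k holomorphic_on ball w (r/2)" "continuous_on (cball w (r/2)) k"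
        using k(1) sub' by (blast intro: holomorphic_on_subset holomorphic_on_imp_continuous_on)+
      fix v assume "cmod (w - v) = r/2"
      then have "v \<in> cball w (r/2)" by (simp add: dist_norm)
      then show "cmod (k v) \<le> 2 * (2 * B / r) / r" using sub k(2) by blast
    qed (use \<rho> in simp)
    then show "cmod (deriv k w) \<le> 8 * B / r^3" by (simp add: power3_eq_cube)
  qed (use z in auto)
  then show ?thesis using z qk by auto
qed

text \<open>Removable singularity for operator families. Differentiability of the quotient is in
  doubt only at \<open>z0\<close>, where it concerns the second difference quotient
  \<open>q\<close>. The scalar estimate makes \<open>q\<close> Lipschitz in operator norm, so it
  extends continuously to \<open>z0\<close>, and near \<open>z0\<close> the function
  \<open>G\<close> is M' z0 plus (z - z0) times this extension.\<close>

lemma op_holomorphic_difference_quotient: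
  fixes M :: "complex \<Rightarrow> ('a::euclidean_space L2 \<Rightarrow>\<^sub>L 'a L2)"
  assumes M: "op_holomorphic_on M (ball z0 \<rho>)" and \<rho>: "\<rho> > 0"
  obtains G where "op_holomorphic_on G (ball z0 \<rho>)"
    "\<And>z. z \<in> ball z0 \<rho> \<Longrightarrow> M z = M z0 + scaleC_op (z - z0) (G z)"
proof -
  from M obtain M' where M': "\<And>z. z \<in> ball z0 \<rho> \<Longrightarrow> (M has_derivative (\<lambda>w. scaleC_op w (M' z))) (at z)"
    unfolding op_holomorphic_on_def by metis
  have "isCont M z0" using M'[of z0] \<rho> by (auto intro: has_derivative_continuous)
  then have "\<forall>\<^sub>F z in nhds z0. dist (M z) (M z0) < 1"
    using isCont_def tendsto_at_iff_tendsto_nhds tendstoD zero_less_one by metis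
  then obtain s where s: "s > 0" "\<And>z. dist z z0 < s \<Longrightarrow> dist (M z) (M z0) < 1"
    unfolding eventually_nhds_metric by auto
  \<comment> \<open>The uniform norm bound on \<open>M\<close> comes from continuity at
    \<open>z0\<close>, hence on a possibly smaller ball.\<close>
  define \<rho>' where "\<rho>' = min \<rho> s"
  have \<rho>': "\<rho>' > 0" "ball z0 \<rho>' \<subseteq> ball z0 \<rho>" using \<rho> s by (auto simp: \<rho>'_def)
  define C where "C = norm (M z0) + 1"
  have C: "norm (M z) \<le> C" if "z \<in> ball z0 \<rho>'" for z
    using s(2)[of z] that norm_triangle_sub[of "M z" "M z0"] by (auto simp: \<rho>'_def C_def dist_norm dist_commute norm_minus_commute)
  define r where "r = \<rho>' / 2"
  have r: "0 < r" "r < \<rho>'" using \<rho>' by (auto simp: r_def)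
  define K where "K = 8 * (2 * C) / r^3"
  have K0: "K \<ge> 0" using r by (auto simp: K_def C_def)
  define q where "q z = scaleC_op (1 / (z - z0)\<^sup>2) (M z - M z0 - scaleC_op (z - z0) (M' z0))" for z
  define S where "S = ball z0 (r/2) - {z0}"
  have lip: "norm (q z - q z') \<le> K * norm (z - z')" if z: "z \<in> S" "z' \<in> S" for z z'
  proof (rule norm_blinfun_bound)
    fix E
    \<comment> \<open>Testing against the vector \<open>X\<close> itself turns the scalar estimate
      into a bound on \<open>(norm X)\<^sup>2\<close> with a factor \<open>norm X\<close>, which
      cancels.\<close>
    define X where "X = blinfun_apply (q z - q z') E"
    define f where "f w = cip (M w E) X" for w
    have df: "(f has_field_derivative cip (M' w E) X) (at w)" if "w \<in> ball z0 \<rho>" for w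
    proof -
      have "((\<lambda>v. cip (M v E) X) has_derivative (\<lambda>h. cip (scaleC_op h (M' w) E) X)) (at w)"
        by (intro bounded_linear.has_derivative[OF bounded_linear_cip]
            bounded_linear.has_derivative[OF blinfun.bounded_linear_left] M' that)
      moreover have "(\<lambda>h. cip (scaleC_op h (M' w) E) X) = (*) (cip (M' w E) X)"
        by (rule ext) (simp add: cip_scaleC mult.commute)
      ultimately show ?thesis by (simp only: f_def[abs_def] has_field_derivative_def)
    qed
    have hol: "f holomorphic_on ball z0 \<rho>'"
      unfolding holomorphic_on_def field_differentiable_def
      using df \<rho>' by (blast intro: has_field_derivative_at_within)
    have bd: "cmod (f w) \<le> 2 * C * norm E * norm X" if "w \<in> ball z0 \<rho>'" for w
    proof -
      have "norm (M w E) \<le> C * norm E"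
        by (rule order.trans[OF norm_blinfun mult_right_mono[OF C[OF that]]]) simp
      then have "2 * norm (M w E) * norm X \<le> 2 * (C * norm E) * norm X" by (intro mult_right_mono mult_left_mono) auto
      with cmod_cip_le[of "M w E" X] show ?thesis unfolding f_def by (simp add: mult.assoc)
    qed
    have d0: "deriv f z0 = cip (M' z0 E) X" using df[of z0] \<rho> by (auto intro: DERIV_imp_deriv)
    have qf: "cip (q w E) X = (f w - f z0 - (w - z0) * deriv f z0) / (w - z0)\<^sup>2" for w
      unfolding q_def d0 f_def by (simp add: cip_scaleC cip_diff blinfun.diff_left)
    have "(norm X)\<^sup>2 = Re (cip X X)" by (simp add: Re_cip_self)
    also have "\<dots> \<le> cmod (cip X X)" by (rule complex_Re_le_cmod)
    also have "cip X X = cip (q z E) X - cip (q z' E) X"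
      by (subst (1) X_def) (simp add: blinfun.diff_left cip_diff)
    also have "cmod \<dots> \<le> 8 * (2 * C * norm E * norm X) / r^3 * cmod (z - z')"
      unfolding qf using z unfolding S_def
      by (intro second_difference_quotient_lipschitz[OF hol r bd]) auto
    also have "\<dots> = (K * norm (z - z') * norm E) * norm X" by (simp add: K_def)
    finally have "norm X * norm X \<le> (K * norm (z - z') * norm E) * norm X" by (simp add: power2_eq_square)
    then have "norm X \<le> K * norm (z - z') * norm E"
      using K0 by (cases "norm X = 0") (auto simp: mult_le_cancel_right)
    then show "norm (blinfun_apply (q z - q z') E) \<le> K * norm (z - z') * norm E" by (simp add: X_def)
  qed (use K0 in simp)
  have "uniformly_continuous_on S q"
    unfolding uniformly_continuous_on_def
  proof (intro allI impI)
    fix e :: real assume "e > 0"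
    have "dist (q z') (q z) < e" if "z \<in> S" "z' \<in> S" "dist z' z < e / (K + 1)" for z z'
    proof -
      have "norm (q z' - q z) \<le> K * norm (z' - z)" by (rule lip[OF that(2,1)])
      also have "\<dots> \<le> (K + 1) * norm (z' - z)" by (intro mult_right_mono) auto
      also have "\<dots> < e" using that(3) K0 by (simp add: dist_norm field_simps)
      finally show ?thesis by (simp add: dist_norm)
    qed
    then show "\<exists>d>0. \<forall>x\<in>S. \<forall>x'\<in>S. dist x' x < d \<longrightarrow> dist (q x') (q x) < e"
      using \<open>e > 0\<close> K0 by (intro exI[of _ "e / (K + 1)"]) auto
  qed
  \<comment> \<open>Completeness of the space of operators is what allows the extension across the
    puncture.\<close>
  then obtain g where g: "uniformly_continuous_on (closure S) g" "\<And>x. x \<in> S \<Longrightarrow> q x = g x"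
    using uniformly_continuous_on_extension_on_closure by metis
  have cl: "ball z0 (r/2) \<subseteq> closure S"
  proof -
    have "z0 islimpt ball z0 (r/2)" using r by (simp add: islimpt_ball)
    then have "z0 islimpt S" unfolding S_def using islimpt_punctured by auto
    then show ?thesis by (auto simp: S_def closure_def)
  qed
  have "continuous_on (ball z0 (r/2)) g"
    using uniformly_continuous_imp_continuous[OF g(1)] cl continuous_on_subset by blast
  then have gc: "isCont g z0" using r by (simp add: continuous_on_eq_continuous_at)
  define G where "G z = (if z = z0 then M' z0 else scaleC_op (1 / (z - z0)) (M z - M z0))" for z
  \<comment> \<open>Only continuity of \<open>g\<close> at \<open>z0\<close> is at hand, but its
    factor z - z0 vanishes there.\<close>
  have "((\<lambda>z. scaleC_op (z - z0) (g z)) has_derivative (\<lambda>h. scaleC_op h (g z0))) (at z0)"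
  proof -
    have "((\<lambda>z. z - z0) has_derivative (\<lambda>h. h)) (at z0)" by (auto intro!: derivative_eq_intros)
    from has_derivative_bilinear_null[OF bounded_bilinear.flip[OF bounded_bilinear_scaleC_op] this _ gc]
    show ?thesis by simp
  qed
  then have "((\<lambda>z. M' z0 + scaleC_op (z - z0) (g z)) has_derivative (\<lambda>h. scaleC_op h (g z0))) (at z0)"
    using has_derivative_add[OF has_derivative_const] by fastforce
  then have G0: "(G has_derivative (\<lambda>h. scaleC_op h (g z0))) (at z0)"
  proof (rule has_derivative_transform_within_open[where s = "ball z0 (r/2)"])
    fix z assume z: "z \<in> ball z0 (r/2)"
    show "M' z0 + scaleC_op (z - z0) (g z) = G z"
    proof (cases "z = z0")
      case False
      then have "scaleC_op (z - z0) (g z) = scaleC_op (1 / (z - z0)) (M z - M z0 - scaleC_op (z - z0) (M' z0))"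
        using g(2)[of z] z by (simp add: S_def q_def flip: g(2)) (simp add: power2_eq_square)
      then show ?thesis using False by (simp add: G_def scaleC_op.diff_right)
    qed (simp add: G_def scaleC_op.zero_left)
  qed (use r in auto)
  have "op_holomorphic_on G (ball z0 \<rho>)"
    unfolding op_holomorphic_on_def
  proof
    fix z assume z: "z \<in> ball z0 \<rho>"
    show "\<exists>G'. (G has_derivative (\<lambda>w. scaleC_op w G')) (at z)"
    proof (cases "z = z0")
      case False
      have a: "((\<lambda>z. 1 / (z - z0)) has_derivative (\<lambda>h. h * (- 1 / (z - z0)\<^sup>2))) (at z)"
        using False by (auto intro!: derivative_eq_intros simp: power2_eq_square field_simps)
      have b: "((\<lambda>z. M z - M z0) has_derivative (\<lambda>w. scaleC_op w (M' z))) (at z)"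
        using has_derivative_diff[OF M'[OF z] has_derivative_const] by simp
      have "((\<lambda>z. scaleC_op (1 / (z - z0)) (M z - M z0)) has_derivative
        (\<lambda>h. scaleC_op (1 / (z - z0)) (scaleC_op h (M' z)) + scaleC_op (h * (- 1 / (z - z0)\<^sup>2)) (M z - M z0))) (at z)"
        by (rule scaleC_op.FDERIV[OF a b])
      also have "(\<lambda>h. scaleC_op (1 / (z - z0)) (scaleC_op h (M' z)) + scaleC_op (h * (- 1 / (z - z0)\<^sup>2)) (M z - M z0))
         = (\<lambda>h. scaleC_op h (scaleC_op (1 / (z - z0)) (M' z) + scaleC_op (- 1 / (z - z0)\<^sup>2) (M z - M z0)))"
        by (simp add: scaleC_op.add_right mult.commute)
      finally have "(G has_derivative \<dots>) (at z)"
        by (rule has_derivative_transform_within_open[where s = "- {z0}"]) (use False in \<open>auto simp: G_def\<close>)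
      then show ?thesis by blast
    qed (use G0 in blast)
  qed
  moreover have "M z = M z0 + scaleC_op (z - z0) (G z)" for z
    by (simp add: G_def scaleC_op.zero_left)
  ultimately show thesis by (rule that)
qed

section \<open>Operators on $L^2(D)$\<close>

lemma sq_integrable_indicator:
  assumes D: "D \<in> sets lebesgue" and f: "sq_integrable f"
  shows "sq_integrable (\<lambda>x. indicator D x * f x)"
  unfolding sq_integrable_def
proof
  have [measurable]: "f \<in> borel_measurable lebesgue" "(indicator D :: _ \<Rightarrow> complex) \<in> borel_measurable lebesgue"
    using f D by (auto simp: sq_integrable_def)
  show m: "(\<lambda>x. indicator D x * f x) \<in> borel_measurable lebesgue" by measurable
  have "integrable lebesgue (\<lambda>x. (cmod (f x))\<^sup>2)" using f by (simp add: sq_integrable_def)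
  then show "integrable lebesgue (\<lambda>x. (cmod (indicator D x * f x))\<^sup>2)"
    by (rule Bochner_Integration.integrable_bound) (use m in \<open>auto simp: indicator_def\<close>)
qed

text \<open>The projection onto \<open>L2_on D\<close> with kernel \<open>L2_on (- D)\<close>. It
  turns the almost-everywhere conditions in \<open>L2_ops D\<close> into operator equations.\<close>

definition restr :: "'a::euclidean_space set \<Rightarrow> 'a L2 \<Rightarrow>\<^sub>L 'a L2" where
  "restr D = Blinfun (\<lambda>E. abs_L2 (\<lambda>x. indicator D x * rep_L2 E x))"

lemma restr_AE:
  assumes D: "D \<in> sets lebesgue"
  shows "AE x in lebesgue. rep_L2 (restr D E) x = indicator D x * rep_L2 E x"
proof -
  define R where "R E = abs_L2 (\<lambda>x. indicator D x * rep_L2 E x)" for E :: "'a L2"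
  have ae: "AE x in lebesgue. rep_L2 (R E) x = indicator D x * rep_L2 E x" for E
    unfolding R_def by (intro rep_abs_L2 sq_integrable_indicator D sq_integrable_rep)
  have "bounded_linear R"
  proof (rule bounded_linear_intro[where K = 1])
    show "R (E + F) = R E + R F" for E F
    proof (rule L2_eqI)
      show "AE x in lebesgue. rep_L2 (R (E + F)) x = rep_L2 (R E + R F) x"
        using ae[of "E + F"] ae[of E] ae[of F] rep_plus_L2[of E F] rep_plus_L2[of "R E" "R F"]
        by eventually_elim (simp add: distrib_left)
    qed
    show "R (r *\<^sub>R E) = r *\<^sub>R R E" for r E
      unfolding scaleC_of_real[symmetric]
    proof (rule L2_eqI)
      show "AE x in lebesgue. rep_L2 (R (complex_of_real r *\<^sub>C E)) x = rep_L2 (complex_of_real r *\<^sub>C R E) x"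
        using ae[of "complex_of_real r *\<^sub>C E"] ae[of E] rep_scaleC_L2[of r E] rep_scaleC_L2[of r "R E"]
        by eventually_elim simp
    qed
    show "norm (R E) \<le> norm E * 1" for E
    proof -
      have "ennreal ((norm (R E))\<^sup>2) \<le> ennreal ((norm E)\<^sup>2)"
        unfolding nn_norm_L2_sq[symmetric]
        by (intro nn_integral_mono_AE, use ae[of E] in eventually_elim) (simp add: indicator_def)
      then show ?thesis by (simp add: power2_le_iff_abs_le)
    qed
  qed
  then show ?thesis using ae[of E]
    by (simp add: restr_def bounded_linear_Blinfun_apply R_def[abs_def])
qed

lemma restr_scaleC:
  assumes "D \<in> sets lebesgue" shows "restr D (c *\<^sub>C E) = c *\<^sub>C restr D E"
proof (rule L2_eqI)
  show "AE x in lebesgue. rep_L2 (restr D (c *\<^sub>C E)) x = rep_L2 (c *\<^sub>C restr D E) x"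
    using restr_AE[OF assms, of "c *\<^sub>C E"] restr_AE[OF assms, of E] rep_scaleC_L2[of c E] rep_scaleC_L2[of c "restr D E"]
    by eventually_elim simp
qed

lemma restr_restr:
  assumes "D \<in> sets lebesgue" shows "restr D (restr D E) = restr D E"
proof (rule L2_eqI)
  show "AE x in lebesgue. rep_L2 (restr D (restr D E)) x = rep_L2 (restr D E) x"
    using restr_AE[OF assms, of "restr D E"] restr_AE[OF assms, of E]
    by eventually_elim (simp add: indicator_def)
qed

lemma L2_on_iff:
  assumes "D \<in> sets lebesgue" shows "E \<in> L2_on D \<longleftrightarrow> restr D E = E"
proof
  assume "E \<in> L2_on D"
  then have "AE r in lebesgue. r \<notin> D \<longrightarrow> rep_L2 E r = 0" by (simp add: L2_on_def)
  with restr_AE[OF assms, of E]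
  have "AE x in lebesgue. rep_L2 (restr D E) x = rep_L2 E x"
    by eventually_elim (auto simp: indicator_def)
  then show "restr D E = E" by (rule L2_eqI)
next
  assume "restr D E = E"
  then show "E \<in> L2_on D" using restr_AE[OF assms, of E] by (auto simp: L2_on_def indicator_def)
qed

lemma L2_on_Compl_iff:
  assumes "D \<in> sets lebesgue" shows "E \<in> L2_on (- D) \<longleftrightarrow> restr D E = 0"
proof
  assume "E \<in> L2_on (- D)"
  then have "AE r in lebesgue. r \<in> D \<longrightarrow> rep_L2 E r = 0" by (simp add: L2_on_def)
  with restr_AE[OF assms, of E] rep_zero_L2
  have "AE x in lebesgue. rep_L2 (restr D E) x = rep_L2 0 x"
    by eventually_elim (auto simp: indicator_def)
  then show "restr D E = 0" by (rule L2_eqI)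
next
  assume 0: "restr D E = 0"
  have "AE r in lebesgue. r \<in> D \<longrightarrow> rep_L2 E r = 0"
    using restr_AE[OF assms, of E] rep_zero_L2 unfolding 0 by eventually_elim (auto simp: indicator_def)
  then show "E \<in> L2_on (- D)" by (simp add: L2_on_def)
qed

text \<open>\<open>E - restr D E\<close> lies in \<open>L2_on (- D)\<close>, so annihilating that
  space is the equation T o restr D = T. In equational form the conditions are visibly stable under
  sums and limits.\<close>

lemma L2_ops_iff:
  assumes D: "D \<in> sets lebesgue"
  shows "T \<in> L2_ops D \<longleftrightarrow> (\<forall>c E. T (c *\<^sub>C E) = c *\<^sub>C T E) \<and> (\<forall>E. restr D (T E) = T E) \<and> (\<forall>E. T (restr D E) = T E)"
proof
  assume T: "T \<in> L2_ops D"
  have "restr D (E - restr D E) = 0" for E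
    by (simp add: blinfun.diff_right restr_restr[OF D])
  then have "T (E - restr D E) = 0" for E
    using T unfolding L2_ops_def by (auto simp: L2_on_Compl_iff[OF D])
  then show "(\<forall>c E. T (c *\<^sub>C E) = c *\<^sub>C T E) \<and> (\<forall>E. restr D (T E) = T E) \<and> (\<forall>E. T (restr D E) = T E)"
    using T by (auto simp: L2_ops_def L2_on_iff[OF D] subset_iff blinfun.diff_right)
next
  assume "(\<forall>c E. T (c *\<^sub>C E) = c *\<^sub>C T E) \<and> (\<forall>E. restr D (T E) = T E) \<and> (\<forall>E. T (restr D E) = T E)"
  then show "T \<in> L2_ops D"
    by (auto simp: L2_ops_def L2_on_iff[OF D] L2_on_Compl_iff[OF D]) (metis blinfun.zero_right)
qed

lemma L2_ops_inverse_iff: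
  assumes D: "D \<in> sets lebesgue"
  shows "L2_ops_inverse D T R \<longleftrightarrow> R \<in> L2_ops D \<and>
    (\<forall>E. restr D E = E \<longrightarrow> R (E - T E) = E \<and> R E - T (R E) = E)"
  by (auto simp: L2_ops_inverse_def L2_on_iff[OF D])

context
  fixes D :: "'a::euclidean_space set" assumes D: "D \<in> sets lebesgue"
begin

lemma L2_ops_add: "S \<in> L2_ops D \<Longrightarrow> T \<in> L2_ops D \<Longrightarrow> S + T \<in> L2_ops D"
  by (simp add: L2_ops_iff[OF D] blinfun.bilinear_simps scaleC.add_right)

lemma L2_ops_diff: "S \<in> L2_ops D \<Longrightarrow> T \<in> L2_ops D \<Longrightarrow> S - T \<in> L2_ops D"
  by (simp add: L2_ops_iff[OF D] blinfun.bilinear_simps scaleC.diff_right)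

lemma L2_ops_scaleC_op: "T \<in> L2_ops D \<Longrightarrow> scaleC_op a T \<in> L2_ops D"
  by (simp add: L2_ops_iff[OF D] restr_scaleC[OF D] mult.commute)

text \<open>Used at a pole, where the regular part of the resolvent is known only as a limit of
  members of \<open>L2_ops D\<close>. For fixed \<open>c\<close> and \<open>E\<close> each defining
  equation is continuous in \<open>T\<close>.\<close>

lemma closed_L2_ops: "closed (L2_ops D)"
proof -
  have "L2_ops D = {T :: 'a L2 \<Rightarrow>\<^sub>L 'a L2. (\<forall>c E. T (c *\<^sub>C E) = c *\<^sub>C T E) \<and> (\<forall>E. restr D (T E) = T E) \<and> (\<forall>E. T (restr D E) = T E)}"
    using L2_ops_iff[OF D] by auto
  also have "closed \<dots>"
    by (intro closed_Collect_conj closed_Collect_all closed_Collect_eq continuous_intros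
        bounded_linear.continuous_on[OF bounded_linear_scaleC_L2])
  finally show ?thesis .
qed

end

text \<open>The functional psi of the bordering. \<open>restr D\<close> makes it blind to values off
  \<open>D\<close>, and the normalisation gives a nonzero \<open>u\<close> in \<open>L2_on D\<close>
  the coefficient 1.\<close>

definition proj_coeff :: "'a::euclidean_space set \<Rightarrow> 'a L2 \<Rightarrow> 'a L2 \<Rightarrow> complex" where
  "proj_coeff D u E = cip (restr D E) u / of_real ((norm u)\<^sup>2)"

lemma bounded_linear_proj_coeff: "bounded_linear (proj_coeff D u)"
  unfolding proj_coeff_def[abs_def]
  by (intro bounded_linear_compose[OF bounded_linear_divide]
      bounded_linear_compose[OF bounded_linear_cip] blinfun.bounded_linear_right)

lemmas proj_coeff_add = linear_add[OF bounded_linear.linear[OF bounded_linear_proj_coeff]]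
  and proj_coeff_diff = linear_diff[OF bounded_linear.linear[OF bounded_linear_proj_coeff]]
  and proj_coeff_zero [simp] = linear_0[OF bounded_linear.linear[OF bounded_linear_proj_coeff]]

definition rank_op :: "'a::euclidean_space set \<Rightarrow> 'a L2 \<Rightarrow> 'a L2 \<Rightarrow> 'a L2 \<Rightarrow>\<^sub>L 'a L2" where
  "rank_op D v u = Blinfun (\<lambda>E. proj_coeff D u E *\<^sub>C v)"

lemma rank_op_apply [simp]: "rank_op D v u E = proj_coeff D u E *\<^sub>C v"
  unfolding rank_op_def
  by (subst bounded_linear_Blinfun_apply)
    (auto intro: bounded_linear_compose[OF scaleC.bounded_linear_left] bounded_linear_proj_coeff)

context
  fixes D :: "'a::euclidean_space set" assumes D: "D \<in> sets lebesgue"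
begin

lemma proj_coeff_scaleC: "proj_coeff D u (c *\<^sub>C E) = c * proj_coeff D u E"
  by (simp add: proj_coeff_def restr_scaleC[OF D] cip_scaleC)

lemma proj_coeff_restr: "proj_coeff D u (restr D E) = proj_coeff D u E"
  by (simp add: proj_coeff_def restr_restr[OF D])

lemma proj_coeff_self:
  assumes "u \<noteq> 0" "restr D u = u" shows "proj_coeff D u u = 1"
proof -
  \<comment> \<open>Multiplication by \<open>\<i>\<close> is skew for the real inner product, so
    \<open>cip u u\<close> has no imaginary part.\<close>
  have "u \<bullet> (\<i> *\<^sub>C u) = 0"
  proof -
    have "(\<i> *\<^sub>C u) \<bullet> u = - (u \<bullet> (\<i> *\<^sub>C u))"
      by (simp add: scaleC_inner scaleC_minus_left)
    then show ?thesis by (simp add: inner_commute)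
  qed
  then have "cip u u = of_real ((norm u)\<^sup>2)"
    by (simp add: cip_def complex_eq_iff power2_norm_eq_inner)
  then show ?thesis using assms by (simp add: proj_coeff_def)
qed

end

section \<open>Simple poles of the resolvent\<close>

lemma op_holomorphic_isCont: "op_holomorphic_on G U \<Longrightarrow> z \<in> U \<Longrightarrow> isCont G z"
  unfolding op_holomorphic_on_def by (blast intro: has_derivative_continuous)

text \<open>Comparing coefficients of the Laurent expansion in \<open>(1 - T(z)) R(z) = 1 = R(z) (1 - T(z))\<close>.\<close>

lemma simple_pole_laurent_identities:
  fixes T :: "complex \<Rightarrow> ('a::euclidean_space L2 \<Rightarrow>\<^sub>L 'a L2)"
  assumes D: "D \<in> sets lebesgue" and pole: "simple_pole D U T z0"
    and T: "isCont T z0" and Tops: "\<And>\<zeta>. \<zeta> \<in> U \<Longrightarrow> T \<zeta> \<in> L2_ops D"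
  obtains A G0 where "A \<in> L2_ops D" "rank_one A" "G0 \<in> L2_ops D"
    "\<And>E. restr D E = E \<Longrightarrow> T z0 (A E) = A E"
    "\<And>E. restr D E = E \<Longrightarrow> A (T z0 E) = A E"
    "\<And>F. restr D F = F \<Longrightarrow> A F = 0 \<Longrightarrow> G0 F - T z0 (G0 F) = F"
    "\<And>T1 E. (T has_derivative (\<lambda>w. scaleC_op w T1)) (at z0) \<Longrightarrow> restr D E = E \<Longrightarrow>
        G0 (E - T z0 E) = E + A (T1 E)"
proof -
  from pole obtain \<rho> A G where \<rho>: "\<rho> > 0" "ball z0 \<rho> \<subseteq> U" and A: "A \<in> L2_ops D" "rank_one A"
    and G: "\<And>\<zeta>. \<zeta> \<in> ball z0 \<rho> \<Longrightarrow> G \<zeta> \<in> L2_ops D" "op_holomorphic_on G (ball z0 \<rho>)"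
    and R: "\<And>\<zeta>. \<zeta> \<in> ball z0 \<rho> - {z0} \<Longrightarrow>
         L2_ops_inverse D (T \<zeta>) (scaleC_op (1 / (\<zeta> - z0)) A + G \<zeta>)"
    unfolding simple_pole_def by blast
  have Gc: "(G \<longlongrightarrow> G z0) (at z0)"
    using op_holomorphic_isCont[OF G(2), of z0] \<rho> by (simp add: isCont_def)
  have Tc: "(T \<longlongrightarrow> T z0) (at z0)" using T by (simp add: isCont_def)
  have ev: "\<forall>\<^sub>F \<zeta> in at z0. \<zeta> \<in> ball z0 \<rho> - {z0}"
    using \<rho> eventually_at_ball[of \<rho> z0 UNIV] by (auto simp: eventually_at_filter elim: eventually_mono)
  have R1: "(1 / (\<zeta> - z0)) *\<^sub>C A (E - T \<zeta> E) + G \<zeta> (E - T \<zeta> E) = E"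
   and R2: "(1 / (\<zeta> - z0)) *\<^sub>C A E + G \<zeta> E - T \<zeta> ((1 / (\<zeta> - z0)) *\<^sub>C A E + G \<zeta> E) = E"
    if "restr D E = E" "\<zeta> \<in> ball z0 \<rho> - {z0}" for E \<zeta>
    using R[OF that(2)] that(1) by (auto simp: L2_ops_inverse_iff[OF D] blinfun.add_left)
  have id0: "((\<lambda>\<zeta>. \<zeta> - z0) \<longlongrightarrow> 0) (at z0)" using LIM_offset_zero_cancel by (auto intro: tendsto_eq_intros)
  have nb: "at z0 \<noteq> bot" by simp
  have Acl: "A (c *\<^sub>C E) = c *\<^sub>C A E" for c E using A by (auto simp: L2_ops_iff[OF D])
  \<comment> \<open>Order -1 of R (1 - T) = 1: multiply by \<zeta> - z0, let \<zeta> tend to z0 and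
    use uniqueness of limits.\<close>
  have P1: "A (T z0 E) = A E" if E: "restr D E = E" for E
  proof -
    have "((\<lambda>\<zeta>. A (E - T \<zeta> E) + (\<zeta> - z0) *\<^sub>C G \<zeta> (E - T \<zeta> E)) \<longlongrightarrow>
       A (E - T z0 E) + 0 *\<^sub>C G z0 (E - T z0 E)) (at z0)"
      by (intro tendsto_intros scaleC.tendsto blinfun.tendsto Tc Gc id0)
    moreover have "\<forall>\<^sub>F \<zeta> in at z0. A (E - T \<zeta> E) + (\<zeta> - z0) *\<^sub>C G \<zeta> (E - T \<zeta> E) = (\<zeta> - z0) *\<^sub>C E"
      using ev
    proof eventually_elim
      case (elim \<zeta>)
      then have "(\<zeta> - z0) *\<^sub>C E = (\<zeta> - z0) *\<^sub>C ((1 / (\<zeta> - z0)) *\<^sub>C A (E - T \<zeta> E) + G \<zeta> (E - T \<zeta> E))"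
        using R1[OF E] by simp
      then show ?case using elim by (simp add: scaleC.add_right)
    qed
    ultimately have "((\<lambda>\<zeta>. (\<zeta> - z0) *\<^sub>C E) \<longlongrightarrow> A (E - T z0 E) + 0 *\<^sub>C G z0 (E - T z0 E)) (at z0)"
      by (rule Lim_transform_eventually)
    moreover have "((\<lambda>\<zeta>. (\<zeta> - z0) *\<^sub>C E) \<longlongrightarrow> 0 *\<^sub>C E) (at z0)"
      by (intro scaleC.tendsto id0 tendsto_const)
    ultimately have "A (E - T z0 E) + 0 *\<^sub>C G z0 (E - T z0 E) = 0 *\<^sub>C E"
      using tendsto_unique[OF nb] by blast
    then show ?thesis by (simp add: blinfun.diff_right)
  qed
  show thesis
  proof (rule that[of A "G z0"])
    show "T z0 (A E) = A E" if E: "restr D E = E" for E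
    proof -
      have "((\<lambda>\<zeta>. (A E + (\<zeta> - z0) *\<^sub>C G \<zeta> E) - T \<zeta> (A E + (\<zeta> - z0) *\<^sub>C G \<zeta> E) - (\<zeta> - z0) *\<^sub>C E) \<longlongrightarrow>
         (A E + 0 *\<^sub>C G z0 E) - T z0 (A E + 0 *\<^sub>C G z0 E) - 0 *\<^sub>C E) (at z0)"
        by (intro tendsto_intros scaleC.tendsto blinfun.tendsto Tc Gc id0)
      moreover have "\<forall>\<^sub>F \<zeta> in at z0. (A E + (\<zeta> - z0) *\<^sub>C G \<zeta> E) - T \<zeta> (A E + (\<zeta> - z0) *\<^sub>C G \<zeta> E) - (\<zeta> - z0) *\<^sub>C E
         = 0"
        using ev
      proof eventually_elim
        case (elim \<zeta>)
        let ?R = "(1 / (\<zeta> - z0)) *\<^sub>C A E + G \<zeta> E"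
        have R: "A E + (\<zeta> - z0) *\<^sub>C G \<zeta> E = (\<zeta> - z0) *\<^sub>C ?R"
          using elim by (simp add: scaleC.add_right)
        have "(\<zeta> - z0) *\<^sub>C ?R - T \<zeta> ((\<zeta> - z0) *\<^sub>C ?R) = (\<zeta> - z0) *\<^sub>C (?R - T \<zeta> ?R)"
          using Tops[of \<zeta>] \<rho> elim by (auto simp: L2_ops_iff[OF D] scaleC.diff_right)
        then show ?case unfolding R using R2[OF E elim] by simp
      qed
      ultimately have "((\<lambda>\<zeta>. 0) \<longlongrightarrow> (A E + 0 *\<^sub>C G z0 E) - T z0 (A E + 0 *\<^sub>C G z0 E) - 0 *\<^sub>C E) (at z0)"
        by (rule Lim_transform_eventually)
      then have "(A E + 0 *\<^sub>C G z0 E) - T z0 (A E + 0 *\<^sub>C G z0 E) - 0 *\<^sub>C E = 0"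
        using tendsto_unique[OF nb] tendsto_const by blast
      then show ?thesis by simp
    qed
    \<comment> \<open>On the kernel of \<open>A\<close> the singular part of the resolvent drops
      out, so the limit is taken without any factor \<zeta> - z0.\<close>
    show "G z0 F - T z0 (G z0 F) = F" if F: "restr D F = F" "A F = 0" for F
    proof -
      have "((\<lambda>\<zeta>. G \<zeta> F - T \<zeta> (G \<zeta> F)) \<longlongrightarrow> G z0 F - T z0 (G z0 F)) (at z0)"
        by (intro tendsto_intros blinfun.tendsto Tc Gc)
      moreover have "\<forall>\<^sub>F \<zeta> in at z0. G \<zeta> F - T \<zeta> (G \<zeta> F) = F"
        using ev by eventually_elim (use R2[OF F(1)] F(2) in simp)
      ultimately have "((\<lambda>\<zeta>. F) \<longlongrightarrow> G z0 F - T z0 (G z0 F)) (at z0)"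
        by (rule Lim_transform_eventually)
      then show ?thesis using tendsto_unique[OF nb] tendsto_const by metis
    qed
    \<comment> \<open>Order zero of R (1 - T) = 1. By \<open>P1\<close> the singular part is - A
      applied to the difference quotient of \<open>T\<close>, with limit - A (T1 E); this is the
      only identity that involves the derivative of \<open>T\<close>.\<close>
    show "G z0 (E - T z0 E) = E + A (T1 E)"
      if T1: "(T has_derivative (\<lambda>w. scaleC_op w T1)) (at z0)" and E: "restr D E = E" for T1 E
    proof -
      have "((\<lambda>\<zeta>. (1 / norm (\<zeta> - z0)) *\<^sub>R (T \<zeta> - T z0 - scaleC_op (\<zeta> - z0) T1)) \<longlongrightarrow> 0) (at z0)"
        using T1 by (simp add: has_derivative_at2 diff_diff_eq)
      then have "((\<lambda>\<zeta>. norm ((1 / norm (\<zeta> - z0)) *\<^sub>R (T \<zeta> - T z0 - scaleC_op (\<zeta> - z0) T1))) \<longlongrightarrow> 0) (at z0)"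
        by (rule tendsto_norm_zero)
      then have "((\<lambda>\<zeta>. scaleC_op (1 / (\<zeta> - z0)) (T \<zeta> - T z0 - scaleC_op (\<zeta> - z0) T1)) \<longlongrightarrow> 0) (at z0)"
      proof (rule Lim_null_comparison[rotated])
        show "\<forall>\<^sub>F \<zeta> in at z0. norm (scaleC_op (1 / (\<zeta> - z0)) (T \<zeta> - T z0 - scaleC_op (\<zeta> - z0) T1)) \<le>
            norm ((1 / norm (\<zeta> - z0)) *\<^sub>R (T \<zeta> - T z0 - scaleC_op (\<zeta> - z0) T1))"
          by (rule always_eventually, intro allI, rule order.trans[OF norm_scaleC_op]) (simp add: norm_divide)
      qed
      then have q: "((\<lambda>\<zeta>. (scaleC_op (1 / (\<zeta> - z0)) (T \<zeta> - T z0 - scaleC_op (\<zeta> - z0) T1)) E) \<longlongrightarrow> blinfun_apply 0 E) (at z0)"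
        by (intro blinfun.tendsto tendsto_const)
      have q': "((\<lambda>\<zeta>. (1 / (\<zeta> - z0)) *\<^sub>C (T \<zeta> E - T z0 E)) \<longlongrightarrow> T1 E) (at z0)"
      proof -
        have "((\<lambda>\<zeta>. (scaleC_op (1 / (\<zeta> - z0)) (T \<zeta> - T z0 - scaleC_op (\<zeta> - z0) T1)) E + T1 E) \<longlongrightarrow> blinfun_apply 0 E + T1 E) (at z0)"
          by (intro tendsto_intros q)
        moreover have "\<forall>\<^sub>F \<zeta> in at z0. (scaleC_op (1 / (\<zeta> - z0)) (T \<zeta> - T z0 - scaleC_op (\<zeta> - z0) T1)) E + T1 E
            = (1 / (\<zeta> - z0)) *\<^sub>C (T \<zeta> E - T z0 E)"
          using ev
        proof eventually_elim
          case (elim \<zeta>)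
          then have "scaleC_op (1 / (\<zeta> - z0)) (T \<zeta> - T z0 - scaleC_op (\<zeta> - z0) T1) = scaleC_op (1 / (\<zeta> - z0)) (T \<zeta> - T z0) - T1"
            unfolding scaleC_op.diff_right[of _ "T \<zeta> - T z0"] by simp
          then show ?case by (simp add: blinfun.diff_left)
        qed
        ultimately have "((\<lambda>\<zeta>. (1 / (\<zeta> - z0)) *\<^sub>C (T \<zeta> E - T z0 E)) \<longlongrightarrow> blinfun_apply 0 E + T1 E) (at z0)"
          by (rule Lim_transform_eventually)
        then show ?thesis by simp
      qed
      have "((\<lambda>\<zeta>. G \<zeta> (E - T \<zeta> E) - A ((1 / (\<zeta> - z0)) *\<^sub>C (T \<zeta> E - T z0 E))) \<longlongrightarrow>
           G z0 (E - T z0 E) - A (T1 E)) (at z0)"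
        by (intro tendsto_diff blinfun.tendsto Tc Gc q' tendsto_const)
      moreover have "\<forall>\<^sub>F \<zeta> in at z0. G \<zeta> (E - T \<zeta> E) - A ((1 / (\<zeta> - z0)) *\<^sub>C (T \<zeta> E - T z0 E)) = E"
        using ev
      proof eventually_elim
        case (elim \<zeta>)
        have "A (E - T \<zeta> E) = - A (T \<zeta> E - T z0 E)" using P1[OF E] by (simp add: blinfun.diff_right)
        then show ?case using R1[OF E elim] by (simp add: Acl scaleC_minus_right algebra_simps)
      qed
      ultimately have "((\<lambda>\<zeta>. E) \<longlongrightarrow> G z0 (E - T z0 E) - A (T1 E)) (at z0)"
        by (rule Lim_transform_eventually)
      then have "E = G z0 (E - T z0 E) - A (T1 E)"
        using tendsto_unique[OF nb] tendsto_const by metis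
      then show ?thesis by (metis diff_add_cancel)
    qed
  qed (use A G \<rho> P1 in auto)
qed

text \<open>On \<open>L2_on D\<close> the residue \<open>A\<close> annihilates the range of 1 - T0
  and sends \<open>v\<close> to \<open>u\<close>, so it sees only the border, while on the kernel of
  \<open>A\<close> the operator \<open>G0\<close> solves (1 - T0) x = F. Hence the border fills the
  missing direction \<open>v\<close> in the range and detects the direction \<open>u\<close> in the
  kernel.\<close>

lemma bordered_inverse:
  fixes T0 A G0 T1 :: "'a::euclidean_space L2 \<Rightarrow>\<^sub>L 'a L2"
  assumes D: "D \<in> sets lebesgue" and T0: "T0 \<in> L2_ops D" and A: "A \<in> L2_ops D" "rank_one A"
    and G0: "G0 \<in> L2_ops D"
    and TA: "\<And>E. restr D E = E \<Longrightarrow> T0 (A E) = A E"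
    and AT: "\<And>E. restr D E = E \<Longrightarrow> A (T0 E) = A E"
    and TG: "\<And>F. restr D F = F \<Longrightarrow> A F = 0 \<Longrightarrow> G0 F - T0 (G0 F) = F"
    and GT: "\<And>E. restr D E = E \<Longrightarrow> G0 (E - T0 E) = E + A (T1 E)"
  obtains u v J where "u \<noteq> 0" "restr D u = u" "T0 u = u" "restr D v = v"
    "(id_blinfun - T0 + rank_op D v u) o\<^sub>L J = id_blinfun"
    "J o\<^sub>L (id_blinfun - T0 + rank_op D v u) = id_blinfun"
    "J v = u" "proj_coeff D u (J (T1 u)) = - 1"
proof -
  note pcs = proj_coeff_scaleC[OF D]
  have Acl: "A (c *\<^sub>C E) = c *\<^sub>C A E" and PA [simp]: "restr D (A E) = A E" and AP: "A (restr D E) = A E" for c E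
    using A by (auto simp: L2_ops_iff[OF D])
  have PT [simp]: "restr D (T0 E) = T0 E" and TP: "T0 (restr D E) = T0 E" for E
    using T0 by (auto simp: L2_ops_iff[OF D])
  have PG [simp]: "restr D (G0 E) = G0 E" for E
    using G0 by (auto simp: L2_ops_iff[OF D])
  from A(2) obtain u where u: "u \<noteq> 0" "range A = range (\<lambda>c. c *\<^sub>C u)"
    unfolding rank_one_def by blast
  have "u \<in> range (\<lambda>c. c *\<^sub>C u)" by (rule range_eqI[of _ _ 1]) simp
  then obtain v0 where v0: "A v0 = u" using u(2) by (metis imageE)
  define v where "v = restr D v0"
  have v: "A v = u" "restr D v = v" by (simp_all add: v_def AP v0 restr_restr[OF D])
  have Pu: "restr D u = u" using PA[of v] v by simp
  define \<psi> where "\<psi> = proj_coeff D u"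
  have \<psi>u: "\<psi> u = 1" unfolding \<psi>_def using proj_coeff_self[OF D u(1) Pu] .
  have Arep: "A E = \<psi> (A E) *\<^sub>C u" for E
  proof -
    have "A E \<in> range (\<lambda>c. c *\<^sub>C u)" using u(2) by blast
    then obtain c where "A E = c *\<^sub>C u" by auto
    then show ?thesis using \<psi>u by (simp add: \<psi>_def pcs)
  qed
  \<comment> \<open>Found by solving B x = F. Applying \<open>A\<close> gives \<psi> x = \<psi> (A
    F). On \<open>D\<close> it remains to solve (1 - T0) x = K F, where \<open>K F\<close> is in the
    kernel of \<open>A\<close>: the solution is \<open>G0 (K F)\<close> up to a multiple of
    \<open>u\<close>, and the known value of \<psi> x fixes that multiple. Off \<open>D\<close> the
    operator is the identity.\<close>
  define K where "K = restr D - (rank_op D v u o\<^sub>L A)"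
  define J where "J = (G0 o\<^sub>L K) + (id_blinfun - restr D) + ((rank_op D u u o\<^sub>L A) - (rank_op D u u o\<^sub>L (G0 o\<^sub>L K)))"
  have K: "K F = restr D F - \<psi> (A F) *\<^sub>C v" for F by (simp add: K_def blinfun.bilinear_simps \<psi>_def)
  have J: "J F = G0 (K F) + (F - restr D F) + (\<psi> (A F) - \<psi> (G0 (K F))) *\<^sub>C u" for F
    by (simp add: J_def blinfun.bilinear_simps \<psi>_def scaleC.diff_left)
  have \<psi>P: "\<psi> (restr D E) = \<psi> E" for E by (simp add: \<psi>_def proj_coeff_restr[OF D])
  have \<psi>lin: "\<psi> (E + F) = \<psi> E + \<psi> F" "\<psi> (E - F) = \<psi> E - \<psi> F" "\<psi> (c *\<^sub>C E) = c * \<psi> E" "\<psi> 0 = 0" for E F c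
    by (simp_all add: \<psi>_def proj_coeff_add proj_coeff_diff pcs)
  have Tu: "T0 u = u" using TA[OF v(2)] v by simp
  define B where "B = id_blinfun - T0 + rank_op D v u"
  have B: "B E = E - T0 E + \<psi> E *\<^sub>C v" for E by (simp add: B_def blinfun.bilinear_simps \<psi>_def)
  have \<psi>J: "\<psi> (J F) = \<psi> (A F)" for F
    by (simp add: J \<psi>lin \<psi>u \<psi>P)
  have "B o\<^sub>L J = id_blinfun"
  proof (rule blinfun_eqI)
    fix F
    have "A (K F) = 0"
      using Arep[of F] by (simp add: K blinfun.diff_right AP Acl v)
    moreover have "restr D (K F) = K F"
      by (simp add: K blinfun.diff_right restr_restr[OF D] restr_scaleC[OF D] v)
    ultimately have GK: "G0 (K F) = K F + T0 (G0 (K F))" using TG[of "K F"] by (simp add: algebra_simps)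
    have "T0 (F - restr D F) = 0" by (simp add: blinfun.diff_right TP)
    then have "J F - T0 (J F) = (G0 (K F) - T0 (G0 (K F))) + (F - restr D F)"
      using T0 Tu by (simp add: J blinfun.add_right L2_ops_iff[OF D])
    also have "\<dots> = F - \<psi> (A F) *\<^sub>C v" by (subst (1) GK) (simp add: K)
    finally show "(B o\<^sub>L J) F = id_blinfun F" by (simp add: B \<psi>J)
  qed
  moreover have "J o\<^sub>L B = id_blinfun"
  proof (rule blinfun_eqI)
    fix E
    define E1 where "E1 = restr D E"
    have E1: "restr D E1 = E1" "T0 E = T0 E1" "A E = A E1" "\<psi> E = \<psi> E1"
      by (simp_all add: E1_def TP AP \<psi>P restr_restr[OF D])
    have AB: "A (B E) = \<psi> E *\<^sub>C u"
      by (simp add: B blinfun.bilinear_simps Acl v E1 AT[OF E1(1)])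
    then have \<psi>AB: "\<psi> (A (B E)) = \<psi> E" by (simp add: \<psi>lin \<psi>u)
    have KB: "K (B E) = E1 - T0 E1"
      unfolding K \<psi>AB by (simp add: B blinfun.bilinear_simps restr_scaleC[OF D] v E1 E1_def[symmetric])
    have "J (B E) = E1 + A (T1 E1) + (B E - restr D (B E)) + (\<psi> E - \<psi> (E1 + A (T1 E1))) *\<^sub>C u"
      unfolding J \<psi>AB KB GT[OF E1(1)] by simp
    also have "B E - restr D (B E) = E - E1"
      by (simp add: B blinfun.bilinear_simps restr_scaleC[OF D] v E1_def)
    \<comment> \<open>\<open>A (T1 E1)\<close>, the defect of \<open>G0\<close> as a left inverse,
      is a multiple of \<open>u\<close>, and the correction along \<open>u\<close> built into
      \<open>J\<close> removes it.\<close>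
    also have "(\<psi> E - \<psi> (E1 + A (T1 E1))) *\<^sub>C u = - A (T1 E1)"
      by (subst (2) Arep) (simp add: \<psi>lin E1 scaleC_minus_left)
    finally show "(J o\<^sub>L B) E = id_blinfun E" by simp
  qed
  moreover have "J v = u"
    by (simp add: J K v \<psi>u \<psi>lin)
  \<comment> \<open>At the eigenvector \<open>u\<close> the left side of \<open>GT\<close> vanishes,
    which leaves A (T1 u) = - u. This is the source of the derivative 1 of d at the pole.\<close>
  moreover have "\<psi> (J (T1 u)) = - 1"
  proof -
    have "A (T1 u) = - u" using GT[OF Pu] by (simp add: Tu eq_neg_iff_add_eq_0 add.commute)
    then show ?thesis using \<psi>lin(3)[of "-1" u] \<psi>u by (simp add: \<psi>J scaleC_minus1)
  qed
  ultimately show thesis using that[of u v J] u Pu v Tu by (simp add: B_def \<psi>_def)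
qed


section \<open>Algebra of holomorphic operator families\<close>

lemma op_holomorphic_compose:
  assumes F: "op_holomorphic_on F U" and G: "op_holomorphic_on G U"
    and lin: "\<And>z c E. z \<in> U \<Longrightarrow> F z (c *\<^sub>C E) = c *\<^sub>C F z E"
  shows "op_holomorphic_on (\<lambda>z. F z o\<^sub>L G z) U"
  unfolding op_holomorphic_on_def
proof
  fix z assume z: "z \<in> U"
  from F G z obtain F' G' where F': "(F has_derivative (\<lambda>w. scaleC_op w F')) (at z)"
    and G': "(G has_derivative (\<lambda>w. scaleC_op w G')) (at z)"
    unfolding op_holomorphic_on_def by metis
  have "((\<lambda>z. F z o\<^sub>L G z) has_derivative (\<lambda>w. (F z o\<^sub>L scaleC_op w G') + (scaleC_op w F' o\<^sub>L G z))) (at z)"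
    by (rule bounded_bilinear.FDERIV[OF bounded_bilinear_blinfun_compose F' G'])
  \<comment> \<open>Bounded linear functions are only real-linear as such, so moving
    \<open>w\<close> out past \<open>F z\<close> uses \<open>lin\<close>.\<close>
  also have "(\<lambda>w. (F z o\<^sub>L scaleC_op w G') + (scaleC_op w F' o\<^sub>L G z)) = (\<lambda>w. scaleC_op w ((F z o\<^sub>L G') + (F' o\<^sub>L G z)))"
    by (intro ext blinfun_eqI) (simp add: blinfun.bilinear_simps lin[OF z] scaleC.add_right)
  finally show "\<exists>G'. ((\<lambda>z. F z o\<^sub>L G z) has_derivative (\<lambda>w. scaleC_op w G')) (at z)" by blast
qed

lemma op_holomorphic_scaleC_op:
  assumes f: "f holomorphic_on U" "open U" and G: "op_holomorphic_on G U"
  shows "op_holomorphic_on (\<lambda>z. scaleC_op (f z) (G z)) U"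
  unfolding op_holomorphic_on_def
proof
  fix z assume z: "z \<in> U"
  from G z obtain G' where G': "(G has_derivative (\<lambda>w. scaleC_op w G')) (at z)"
    unfolding op_holomorphic_on_def by metis
  have f': "(f has_derivative (\<lambda>w. deriv f z * w)) (at z)"
    using holomorphic_derivI[OF f z] by (simp add: has_field_derivative_def)
  have "((\<lambda>z. scaleC_op (f z) (G z)) has_derivative (\<lambda>w. scaleC_op (f z) (scaleC_op w G') + scaleC_op (deriv f z * w) (G z))) (at z)"
    by (rule scaleC_op.FDERIV[OF f' G'])
  also have "(\<lambda>w. scaleC_op (f z) (scaleC_op w G') + scaleC_op (deriv f z * w) (G z))
     = (\<lambda>w. scaleC_op w (scaleC_op (f z) G' + scaleC_op (deriv f z) (G z)))"
    by (simp add: scaleC_op.add_right mult.commute)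
  finally show "\<exists>G'. ((\<lambda>z. scaleC_op (f z) (G z)) has_derivative (\<lambda>w. scaleC_op w G')) (at z)" by blast
qed

lemma op_holomorphic_add:
  assumes "op_holomorphic_on F U" "op_holomorphic_on G U"
  shows "op_holomorphic_on (\<lambda>z. F z + G z) U"
  unfolding op_holomorphic_on_def
proof
  fix z assume "z \<in> U"
  with assms obtain F' G' where "(F has_derivative (\<lambda>w. scaleC_op w F')) (at z)"
    "(G has_derivative (\<lambda>w. scaleC_op w G')) (at z)"
    unfolding op_holomorphic_on_def by metis
  from has_derivative_add[OF this] show "\<exists>G'. ((\<lambda>z. F z + G z) has_derivative (\<lambda>w. scaleC_op w G')) (at z)"
    unfolding scaleC_op.add_right[symmetric] by blast
qed

lemma op_holomorphic_const: "op_holomorphic_on (\<lambda>z. S) U"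
  unfolding op_holomorphic_on_def
  by (intro ballI exI[of _ 0]) (simp add: scaleC_op.zero_right)

lemma op_holomorphic_subset: "op_holomorphic_on F U \<Longrightarrow> V \<subseteq> U \<Longrightarrow> op_holomorphic_on F V"
  unfolding op_holomorphic_on_def by blast

lemma clinear_inverse:
  assumes "B o\<^sub>L I = id_blinfun" "I o\<^sub>L B = id_blinfun" "\<And>c E. B (c *\<^sub>C E) = c *\<^sub>C B E"
  shows "I (c *\<^sub>C E) = c *\<^sub>C I E"
proof -
  have "I (c *\<^sub>C E) = I (c *\<^sub>C B (I E))" by (metis assms(1) blinfun_apply_blinfun_compose blinfun_apply_id_blinfun)
  also have "\<dots> = (I o\<^sub>L B) (c *\<^sub>C I E)" by (simp add: assms(3))
  finally show ?thesis by (simp add: assms(2))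
qed

text \<open>With \<open>x = I v\<close> and \<open>d = 1 - \<psi> x\<close>, the resolvent is \<open>I + d\<inverse> \<psi>(I _) x\<close> (Sherman--Morrison), up to
  the identity on the complement of \<open>L2_on D\<close>.\<close>

lemma bordered_resolvent:
  fixes T I :: "'a::euclidean_space L2 \<Rightarrow>\<^sub>L 'a L2"
  assumes D: "D \<in> sets lebesgue" and T: "T \<in> L2_ops D"
    and v: "restr D v = v"
    and BI: "(id_blinfun - T + rank_op D v u) o\<^sub>L I = id_blinfun"
    and IB: "I o\<^sub>L (id_blinfun - T + rank_op D v u) = id_blinfun"
  defines "d \<equiv> 1 - proj_coeff D u (I v)"
  shows "I (c *\<^sub>C E) = c *\<^sub>C I E"
    and "restr D (I E) = I E - (E - restr D E)" and "I (restr D E) = I E - (E - restr D E)"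
    and "I - (id_blinfun - restr D) \<in> L2_ops D"
    and "I o\<^sub>L (rank_op D v u o\<^sub>L I) \<in> L2_ops D"
    and "T (I v) = I v - d *\<^sub>C v"
    and "T E = E \<Longrightarrow> E = proj_coeff D u E *\<^sub>C I v"
    and "T E = E \<Longrightarrow> E \<noteq> 0 \<Longrightarrow> d = 0"
    and "d \<noteq> 0 \<Longrightarrow> L2_ops_inverse D T (scaleC_op (1 / d) (I o\<^sub>L (rank_op D v u o\<^sub>L I)) + (I - (id_blinfun - restr D)))"
proof -
  define \<psi> where "\<psi> = proj_coeff D u"
  have \<psi>P: "\<psi> (restr D E) = \<psi> E" for E by (simp add: \<psi>_def proj_coeff_restr[OF D])
  have \<psi>lin: "\<psi> (E + F) = \<psi> E + \<psi> F" "\<psi> (E - F) = \<psi> E - \<psi> F" "\<psi> (c *\<^sub>C E) = c * \<psi> E" "\<psi> 0 = 0" for E F c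
    by (simp_all add: \<psi>_def proj_coeff_add proj_coeff_diff proj_coeff_scaleC[OF D])
  define B where "B = id_blinfun - T + rank_op D v u"
  have B: "B E = E - T E + \<psi> E *\<^sub>C v" for E by (simp add: B_def blinfun.bilinear_simps \<psi>_def)
  have Tc: "T (c *\<^sub>C E) = c *\<^sub>C T E" and PT: "restr D (T E) = T E" and TP: "T (restr D E) = T E" for c E
    using T by (auto simp: L2_ops_iff[OF D])
  have BI': "B (I E) = E" and IB': "I (B E) = E" for E
    using BI IB by (metis B_def blinfun_apply_blinfun_compose blinfun_apply_id_blinfun)+
  have Bc: "B (c *\<^sub>C E) = c *\<^sub>C B E" for c E by (simp add: B Tc \<psi>lin scaleC.bilinear_simps scaleC.add_right scaleC.diff_right)
  show Ic: "I (c *\<^sub>C E) = c *\<^sub>C I E" for c E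
    using clinear_inverse[OF BI IB] Bc unfolding B_def .
  \<comment> \<open>Off \<open>D\<close> the operator \<open>B\<close> acts as the identity, hence
    so does \<open>I\<close>; this is why \<open>id_blinfun - restr D\<close> is subtracted from
    \<open>I\<close>.\<close>
  have QB: "restr D (B E) = B E - (E - restr D E)" "B (restr D E) = B E - (E - restr D E)" for E
    by (simp_all add: B blinfun.bilinear_simps PT TP v \<psi>P restr_scaleC[OF D])
  show PI: "restr D (I E) = I E - (E - restr D E)" for E
    using QB(1)[of "I E"] by (simp add: BI')
  show IP: "I (restr D E) = I E - (E - restr D E)" for E
  proof -
    have "B (E - restr D E) = E - restr D E" by (simp add: blinfun.diff_right QB)
    then have "I (E - restr D E) = E - restr D E" using IB' by metis
    then show ?thesis by (simp add: blinfun.diff_right algebra_simps)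
  qed
  show R1: "I - (id_blinfun - restr D) \<in> L2_ops D"
    unfolding L2_ops_iff[OF D]
    by (simp add: blinfun.bilinear_simps Ic PI IP restr_scaleC[OF D] restr_restr[OF D] scaleC.diff_right)
  have Px: "restr D (I v) = I v" using PI[of v] v by simp
  have \<psi>I: "\<psi> (I (restr D E)) = \<psi> (I E)" for E unfolding IP by (simp add: \<psi>lin \<psi>P)
  show R2: "I o\<^sub>L (rank_op D v u o\<^sub>L I) \<in> L2_ops D"
    unfolding L2_ops_iff[OF D] using \<psi>I \<psi>lin(3)
    by (simp add: Ic restr_scaleC[OF D] Px \<psi>_def)
  have d: "d = 1 - \<psi> (I v)" by (simp add: d_def \<psi>_def)
  show Tx: "T (I v) = I v - d *\<^sub>C v"
    using BI'[of v] by (simp add: B d scaleC.diff_left algebra_simps)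
  \<comment> \<open>An eigenvector satisfies \<open>B E = \<psi> E *\<^sub>C v\<close>, so applying
    \<open>I\<close> confines the eigenspace to the multiples of \<open>I v\<close>; applying \<psi>
    as well forces d = 0 unless E = 0.\<close>
  show eig: "E = proj_coeff D u E *\<^sub>C I v" if "T E = E" for E
    using IB'[of E] that by (simp add: B Ic \<psi>_def)
  show "d = 0" if "T E = E" "E \<noteq> 0"
  proof -
    have "\<psi> E = \<psi> E * \<psi> (I v)" using arg_cong[OF eig[OF that(1)], of \<psi>] by (simp add: \<psi>lin \<psi>_def[symmetric])
    moreover have "\<psi> E \<noteq> 0" using eig[OF that(1)] that(2) by (auto simp: \<psi>_def)
    ultimately show ?thesis by (simp add: d)
  qed
  show "L2_ops_inverse D T (scaleC_op (1 / d) (I o\<^sub>L (rank_op D v u o\<^sub>L I)) + (I - (id_blinfun - restr D)))"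
    (is "L2_ops_inverse D T ?R") if d0: "d \<noteq> 0"
    unfolding L2_ops_inverse_iff[OF D]
  proof (intro conjI allI impI)
    show "?R \<in> L2_ops D" by (intro L2_ops_add[OF D] L2_ops_scaleC_op[OF D] R1 R2)
    fix E assume E: "restr D E = E"
    define R where "R = ?R"
    have R: "R F = (\<psi> (I F) / d) *\<^sub>C I v + I F - (F - restr D F)" for F
      by (simp add: R_def blinfun.bilinear_simps Ic \<psi>_def)
    have ITE: "I (E - T E) = E - \<psi> E *\<^sub>C I v"
      using IB'[of E] by (simp add: B blinfun.bilinear_simps Ic algebra_simps)
    have "\<psi> (I (E - T E)) = \<psi> E * d" by (simp add: ITE \<psi>lin d algebra_simps)
    then have \<psi>d: "\<psi> (I (E - T E)) / d = \<psi> E" using d0 by simp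
    have "R (E - T E) = E" unfolding R unfolding \<psi>d unfolding ITE by (simp add: blinfun.diff_right PT E)
    then show "?R (E - T E) = E" by (simp only: R_def)
    have "T (I E) = I E + \<psi> (I E) *\<^sub>C v - E" using BI'[of E] by (simp add: B algebra_simps)
    then have "R E - T (R E) = E"
      using d0 by (simp add: R E blinfun.bilinear_simps Tc Tx scaleC.diff_right)
    then show "?R E - T (?R E) = E" by (simp only: R_def)
  qed
qed

text \<open>At a simple zero, d \<zeta> = (\<zeta> - z) g \<zeta> with g z nonzero, so in the
  Sherman-Morrison formula the singular term is 1 / (\<zeta> - z) times a holomorphic operator
  \<open>M\<close>. Splitting \<open>M\<close> into \<open>M z\<close> and a difference quotient
  separates the residue from the regular part.\<close>

lemma simple_pole_from_zero:
  fixes T I :: "complex \<Rightarrow> ('a::euclidean_space L2 \<Rightarrow>\<^sub>L 'a L2)"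
  assumes D: "D \<in> sets lebesgue" and S: "ball z \<rho> \<subseteq> U" "\<rho> > 0"
    and T: "\<And>\<zeta>. \<zeta> \<in> ball z \<rho> \<Longrightarrow> T \<zeta> \<in> L2_ops D" "op_holomorphic_on T (ball z \<rho>)"
    and v: "restr D v = v"
    and BI: "\<And>\<zeta>. \<zeta> \<in> ball z \<rho> \<Longrightarrow> (id_blinfun - T \<zeta> + rank_op D v u) o\<^sub>L I \<zeta> = id_blinfun"
    and IB: "\<And>\<zeta>. \<zeta> \<in> ball z \<rho> \<Longrightarrow> I \<zeta> o\<^sub>L (id_blinfun - T \<zeta> + rank_op D v u) = id_blinfun"
    and d: "\<And>\<zeta>. d \<zeta> = 1 - proj_coeff D u (I \<zeta> v)"
    and dz: "d z = 0" "(d has_field_derivative d') (at z)" "d' \<noteq> 0"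
  shows "simple_pole D U T z"
proof -
  have z: "z \<in> ball z \<rho>" using S by simp
  note facts = bordered_resolvent[OF D T(1) v BI IB]
  have Ihol: "op_holomorphic_on I (ball z \<rho>)"
    unfolding op_holomorphic_on_def
  proof
    fix \<zeta> assume \<zeta>: "\<zeta> \<in> ball z \<rho>"
    from T(2) \<zeta> obtain T' where "(T has_derivative (\<lambda>w. scaleC_op w T')) (at \<zeta>)"
      unfolding op_holomorphic_on_def by metis
    then have B: "((\<lambda>\<zeta>. id_blinfun - T \<zeta> + rank_op D v u) has_derivative (\<lambda>w. - scaleC_op w T')) (at \<zeta>)"
      by (auto intro!: derivative_eq_intros)
    have "(I has_derivative (\<lambda>w. - (I \<zeta> o\<^sub>L ((- scaleC_op w T') o\<^sub>L I \<zeta>)))) (at \<zeta>)"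
      by (rule has_derivative_blinfun_inverse[OF _ open_ball \<zeta> B]) (use BI IB in blast)
    also have "(\<lambda>w. - (I \<zeta> o\<^sub>L ((- scaleC_op w T') o\<^sub>L I \<zeta>))) = (\<lambda>w. scaleC_op w (I \<zeta> o\<^sub>L (T' o\<^sub>L I \<zeta>)))"
      by (intro ext blinfun_eqI) (simp add: blinfun.bilinear_simps facts(1)[OF \<zeta> \<zeta> \<zeta>])
    finally show "\<exists>G'. (I has_derivative (\<lambda>w. scaleC_op w G')) (at \<zeta>)" by blast
  qed
  have Ic: "I \<zeta> (c *\<^sub>C E) = c *\<^sub>C I \<zeta> E" if "\<zeta> \<in> ball z \<rho>" for \<zeta> c E
    by (rule facts(1)[OF that that that])
  have dhol: "d holomorphic_on ball z \<rho>"
  proof -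
    have "\<exists>D. (d has_field_derivative D) (at \<zeta>)" if \<zeta>: "\<zeta> \<in> ball z \<rho>" for \<zeta>
    proof -
      from Ihol \<zeta> obtain I' where "(I has_derivative (\<lambda>w. scaleC_op w I')) (at \<zeta>)"
        unfolding op_holomorphic_on_def by metis
      then have "((\<lambda>\<zeta>. 1 - proj_coeff D u (I \<zeta> v)) has_derivative (\<lambda>w. 0 - proj_coeff D u (scaleC_op w I' v))) (at \<zeta>)"
        by (intro has_derivative_diff has_derivative_const bounded_linear.has_derivative[OF bounded_linear_proj_coeff]
            bounded_linear.has_derivative[OF blinfun.bounded_linear_left])
      also have "(\<lambda>w. 0 - proj_coeff D u (scaleC_op w I' v)) = (*) (- proj_coeff D u (I' v))"
        by (rule ext) (simp add: proj_coeff_scaleC[OF D] mult.commute)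
      finally have "(d has_field_derivative - proj_coeff D u (I' v)) (at \<zeta>)"
        unfolding d[abs_def] has_field_derivative_def .
      then show ?thesis ..
    qed
    then show ?thesis
      unfolding holomorphic_on_def field_differentiable_def by (blast intro: has_field_derivative_at_within)
  qed
  define g where "g \<zeta> = (if \<zeta> = z then deriv d z else (d \<zeta> - d z) / (\<zeta> - z))" for \<zeta>
  have g: "g holomorphic_on ball z \<rho>"
    unfolding g_def[abs_def] using dhol S by (intro pole_lemma) (auto simp: interior_open)
  have gz: "g z \<noteq> 0" using dz DERIV_imp_deriv[OF dz(2)] by (simp add: g_def)
  have "isCont g z"
    using holomorphic_on_imp_continuous_on[OF g] z continuous_on_eq_continuous_at[OF open_ball] by blast
  then obtain r0 where r0: "r0 > 0" "\<And>\<zeta>. dist z \<zeta> < r0 \<Longrightarrow> g \<zeta> \<noteq> 0"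
    using continuous_at_avoid[where f = g and x = z and a = 0] gz by blast
  define r where "r = min r0 \<rho>"
  have r: "r > 0" "ball z r \<subseteq> ball z \<rho>" "\<And>\<zeta>. \<zeta> \<in> ball z r \<Longrightarrow> g \<zeta> \<noteq> 0"
    using r0 S by (auto simp: r_def)
  define Q where "Q = rank_op D v u"
  define M where "M \<zeta> = scaleC_op (1 / g \<zeta>) (I \<zeta> o\<^sub>L (Q o\<^sub>L I \<zeta>))" for \<zeta>
  have Ir: "op_holomorphic_on I (ball z r)" by (rule op_holomorphic_subset[OF Ihol r(2)])
  have Mhol: "op_holomorphic_on M (ball z r)"
    unfolding M_def[abs_def]
  proof (intro op_holomorphic_scaleC_op op_holomorphic_compose op_holomorphic_const Ir)
    show "(\<lambda>\<zeta>. 1 / g \<zeta>) holomorphic_on ball z r"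
      using r holomorphic_on_subset[OF g r(2)] by (intro holomorphic_intros) auto
    show "Q (c *\<^sub>C E) = c *\<^sub>C Q E" for c E by (simp add: Q_def proj_coeff_scaleC[OF D])
  qed (use Ic r in auto)
  have Mops: "M \<zeta> \<in> L2_ops D" if "\<zeta> \<in> ball z r" for \<zeta>
  proof -
    have "\<zeta> \<in> ball z \<rho>" using that r by blast
    then show ?thesis unfolding M_def Q_def by (intro L2_ops_scaleC_op[OF D] facts(5))
  qed
  obtain G where G: "op_holomorphic_on G (ball z r)"
    "\<And>\<zeta>. \<zeta> \<in> ball z r \<Longrightarrow> M \<zeta> = M z + scaleC_op (\<zeta> - z) (G \<zeta>)"
    using op_holomorphic_difference_quotient[OF Mhol r(1)] by blast
  have Gops1: "G \<zeta> \<in> L2_ops D" if "\<zeta> \<in> ball z r - {z}" for \<zeta>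
  proof -
    have "scaleC_op (1 / (\<zeta> - z)) (M \<zeta> - M z) = G \<zeta>"
      using G(2)[of \<zeta>] that by simp
    moreover have "scaleC_op (1 / (\<zeta> - z)) (M \<zeta> - M z) \<in> L2_ops D"
      using that r by (intro L2_ops_scaleC_op[OF D] L2_ops_diff[OF D] Mops) auto
    ultimately show ?thesis by simp
  qed
  \<comment> \<open>At \<open>z\<close> itself division by \<zeta> - z is impossible, so membership
    comes from closedness of \<open>L2_ops D\<close>.\<close>
  have "G z \<in> L2_ops D"
  proof (rule Lim_in_closed_set[OF closed_L2_ops[OF D], of G "at z"])
    show "(G \<longlongrightarrow> G z) (at z)" using op_holomorphic_isCont[OF G(1), of z] r by (simp add: isCont_def)
    show "\<forall>\<^sub>F \<zeta> in at z. G \<zeta> \<in> L2_ops D"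
      unfolding eventually_at using r(1) Gops1 by (intro exI[of _ r]) (auto simp: dist_commute)
  qed simp
  then have Gops: "G \<zeta> \<in> L2_ops D" if "\<zeta> \<in> ball z r" for \<zeta> using Gops1 that by blast
  define G' where "G' \<zeta> = G \<zeta> + (I \<zeta> - (id_blinfun - restr D))" for \<zeta>
  have "rank_one (M z)"
    unfolding rank_one_def
  proof (intro exI[of _ "I z v"] conjI)
    have c1: "proj_coeff D u (I z v) = 1" using dz(1) d[of z] by simp
    then show n0: "I z v \<noteq> 0" by auto
    have Mz: "M z E = (proj_coeff D u (I z E) / g z) *\<^sub>C I z v" for E
      by (simp add: M_def Q_def Ic[OF z])
    show "range (M z) = range (\<lambda>c. c *\<^sub>C I z v)"
    proof safe
      fix c
      \<comment> \<open>Surjectivity onto the line: since I z o B = id, the argument of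
        \<open>M z\<close> can be chosen so that \<open>I z\<close> returns any multiple of
        \<open>I z v\<close>, whose coefficient under psi is 1 because d z = 0.\<close>
      define B where "B = id_blinfun - T z + rank_op D v u"
      have "I z (B F) = F" for F using IB[OF z] by (metis B_def blinfun_apply_blinfun_compose blinfun_apply_id_blinfun)
      then have "M z (B ((c * g z) *\<^sub>C I z v)) = c *\<^sub>C I z v"
        using gz by (simp add: Mz proj_coeff_scaleC[OF D] c1)
      then show "c *\<^sub>C I z v \<in> range (M z)" by (metis rangeI)
    qed (use Mz in auto)
  qed
  moreover have "L2_ops_inverse D (T \<zeta>) (scaleC_op (1 / (\<zeta> - z)) (M z) + G' \<zeta>)" if \<zeta>: "\<zeta> \<in> ball z r - {z}" for \<zeta>
  proof -
    have \<zeta>': "\<zeta> \<in> ball z \<rho>" using \<zeta> r by blast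
    have dg: "d \<zeta> = (\<zeta> - z) * g \<zeta>" using \<zeta> dz by (simp add: g_def)
    have d0: "d \<zeta> \<noteq> 0" using \<zeta> r(3)[of \<zeta>] by (auto simp: dg)
    have "scaleC_op (1 / d \<zeta>) (I \<zeta> o\<^sub>L (Q o\<^sub>L I \<zeta>)) = scaleC_op (1 / (\<zeta> - z)) (M \<zeta>)"
      by (simp add: M_def dg)
    also have "\<dots> = scaleC_op (1 / (\<zeta> - z)) (M z) + G \<zeta>"
      using \<zeta> by (subst G(2)) (auto simp: scaleC_op.add_right)
    finally have eq: "scaleC_op (1 / d \<zeta>) (I \<zeta> o\<^sub>L (Q o\<^sub>L I \<zeta>)) = scaleC_op (1 / (\<zeta> - z)) (M z) + G \<zeta>" .
    show ?thesis
      using facts(9)[OF \<zeta>' \<zeta>' \<zeta>'] d0 eq unfolding d Q_def G'_def by (simp only: add.assoc not_False_eq_True simp_thms)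
  qed
  moreover have "op_holomorphic_on G' (ball z r)"
    unfolding G'_def[abs_def] diff_conv_add_uminus[of "I _"]
    by (intro op_holomorphic_add G(1) Ir op_holomorphic_const)
  moreover have "G' \<zeta> \<in> L2_ops D" if "\<zeta> \<in> ball z r" for \<zeta>
  proof -
    have "\<zeta> \<in> ball z \<rho>" using that r by blast
    from facts(4)[OF this this this] show ?thesis unfolding G'_def using Gops[OF that]
      by (intro L2_ops_add[OF D]) auto
  qed
  moreover have "ball z r \<subseteq> U" using r S by blast
  ultimately show ?thesis
    unfolding simple_pole_def using r(1) Mops[of z] by (intro exI[of _ r] conjI exI[of _ "M z"] exI[of _ G']) auto
qed

section \<open>Branches of simple poles\<close>

lemma rank_one_nonzero:
  assumes "rank_one A" obtains E where "A E \<noteq> 0"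
proof -
  from assms obtain u where u: "u \<noteq> 0" "range A = range (\<lambda>c. c *\<^sub>C u)" unfolding rank_one_def by blast
  have "u \<in> range (\<lambda>c. c *\<^sub>C u)" by (rule range_eqI[of _ _ 1]) simp
  then obtain E where "A E = u" using u(2) by (metis imageE)
  then show thesis using that u by blast
qed

text \<open>The residue has eigenvectors in its range and is not zero. A competing branch, known
  only through its poles, can thus be compared through the zeros of d.\<close>

lemma simple_pole_eigenvector:
  assumes D: "D \<in> sets lebesgue" and pole: "simple_pole D U T z" and T: "isCont T z"
    and Tops: "\<And>\<zeta>. \<zeta> \<in> U \<Longrightarrow> T \<zeta> \<in> L2_ops D"
  obtains E where "T z E = E" "E \<noteq> 0"
proof (rule simple_pole_laurent_identities[OF D pole T Tops])
  fix A assume A: "A \<in> L2_ops D" "rank_one A" "\<And>E. restr D E = E \<Longrightarrow> T z (A E) = A E"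
  obtain E where E: "A E \<noteq> 0" using rank_one_nonzero[OF A(2)] .
  have "A (restr D E) = A E" using A(1) by (simp add: L2_ops_iff[OF D])
  then show thesis using that A(3)[of "restr D E"] E by (simp add: restr_restr[OF D])
qed

text \<open>Inside \<open>J\<close> the preimage of \<open>V\<close> under \<open>f\<close> is
  exactly the coincidence set: open as a preimage, closed as the zero set of f - g. It contains
  \<open>a\<close>, so it is all of \<open>J\<close>.\<close>

lemma connected_local_unique:
  fixes f g :: "'a::topological_space \<Rightarrow> 'b::real_normed_vector"
  assumes J: "connected J" and f: "continuous_on J f" and g: "continuous_on J g"
    and a: "a \<in> J" "f a = g a" and V: "open V"
    and VJ: "\<And>h. h \<in> J \<Longrightarrow> g h \<in> V" "\<And>h. h \<in> J \<Longrightarrow> f h \<in> V \<Longrightarrow> f h = g h"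
  shows "h \<in> J \<Longrightarrow> f h = g h"
proof -
  have "J \<inter> f -` V = J \<inter> (\<lambda>h. f h - g h) -` {0}"
  proof (intro set_eqI iffI)
    fix h assume "h \<in> J \<inter> f -` V"
    then show "h \<in> J \<inter> (\<lambda>h. f h - g h) -` {0}" using VJ(2)[of h] by simp
  next
    fix h assume "h \<in> J \<inter> (\<lambda>h. f h - g h) -` {0}"
    then show "h \<in> J \<inter> f -` V" using VJ(1)[of h] by simp
  qed
  moreover have "openin (top_of_set J) (J \<inter> f -` V)"
    by (rule continuous_openin_preimage_gen[OF f V])
  moreover have "closedin (top_of_set J) (J \<inter> (\<lambda>h. f h - g h) -` {0})"
    by (intro continuous_closedin_preimage continuous_intros f g)
  ultimately have "J \<inter> f -` V = {} \<or> J \<inter> f -` V = J"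
    using J by (simp add: connected_clopen)
  moreover have "a \<in> J \<inter> f -` V" using a VJ(1)[of a] by simp
  ultimately show "f h = g h" if "h \<in> J" using VJ(2)[OF that] that by blast
qed

text \<open>Nothing about the kernel remains here. Since \<open>T\<close> is differentiable over the
  reals, complex linearity of its \<zeta>-derivative is a separate hypothesis. It is asked for only
  in \<open>interior U\<close>, where a disc around the point is available to verify it; the ball in
  the definition of a simple pole consists of such points.\<close>

theorem simple_pole_branch_exists:
  fixes T :: "real \<times> complex \<Rightarrow> ('a::euclidean_space L2 \<Rightarrow>\<^sub>L 'a L2)"
    and T' :: "real \<times> complex \<Rightarrow> ((real \<times> complex) \<Rightarrow>\<^sub>L ('a L2 \<Rightarrow>\<^sub>L 'a L2))"
  assumes D: "D \<in> sets lebesgue" and J0: "open J0" "hn \<in> J0" and zn: "\<zeta>n \<in> U"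
    and Tops: "\<And>h \<zeta>. h \<in> J0 \<Longrightarrow> \<zeta> \<in> U \<Longrightarrow> T (h, \<zeta>) \<in> L2_ops D"
    and T': "\<And>p. p \<in> J0 \<times> U \<Longrightarrow> (T has_derivative T' p) (at p)"
    and T'c: "continuous_on (J0 \<times> U) T'"
    and lin: "\<And>h \<zeta> w. h \<in> J0 \<Longrightarrow> \<zeta> \<in> interior U \<Longrightarrow> T' (h, \<zeta>) (0, w) = scaleC_op w (T' (h, \<zeta>) (0, 1))"
    and pole: "simple_pole D U (\<lambda>\<zeta>. T (hn, \<zeta>)) \<zeta>n"
  defines "branch \<equiv> \<lambda>J \<zeta>. \<zeta> C1_differentiable_on J \<and> \<zeta> ` J \<subseteq> U \<and> \<zeta> hn = \<zeta>n \<and>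
     (\<forall>h\<in>J. simple_pole D U (\<lambda>z. T (h, z)) (\<zeta> h))"
  shows "\<exists>J \<zeta> E. open J \<and> is_interval J \<and> hn \<in> J \<and> J \<subseteq> J0 \<and> branch J \<zeta> \<and>
     (\<forall>\<eta>. branch J \<eta> \<longrightarrow> (\<forall>h\<in>J. \<eta> h = \<zeta> h)) \<and> E C1_differentiable_on J \<and>
     (\<forall>h\<in>J. E h \<in> L2_on D \<and> E h \<noteq> 0 \<and> T (h, \<zeta> h) (E h) = E h \<and>
         (\<forall>F. F \<noteq> 0 \<longrightarrow> T (h, \<zeta> h) F = F \<longrightarrow> (\<exists>c. c \<noteq> 0 \<and> F = c *\<^sub>C E h)))"
proof -
  obtain \<rho> where \<rho>: "\<rho> > 0" "ball \<zeta>n \<rho> \<subseteq> U" using pole unfolding simple_pole_def by blast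
  then have \<rho>i: "ball \<zeta>n \<rho> \<subseteq> interior U" by (simp add: interior_maximal)
  have Tz: "((\<lambda>z. T (h, z)) has_derivative (\<lambda>w. T' (h, \<zeta>) (0, w))) (at \<zeta>)" if "h \<in> J0" "\<zeta> \<in> U" for h \<zeta>
  proof -
    have "((\<lambda>z. (h, z)) has_derivative (\<lambda>w. (0, w))) (at \<zeta>)" by (auto intro!: derivative_eq_intros)
    moreover have "(T has_derivative T' (h, \<zeta>)) (at (h, \<zeta>))" using T' that by blast
    ultimately show ?thesis by (rule has_derivative_compose)
  qed
  have TzC: "((\<lambda>z. T (h, z)) has_derivative (\<lambda>w. scaleC_op w (T' (h, \<zeta>) (0, 1)))) (at \<zeta>)"
    if "h \<in> J0" "\<zeta> \<in> ball \<zeta>n \<rho>" for h \<zeta>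
  proof -
    have "\<zeta> \<in> U" "\<zeta> \<in> interior U" using that \<rho> \<rho>i by blast+
    then show ?thesis using Tz[of h \<zeta>] that(1) by (subst ext[OF lin[OF that(1), of \<zeta>], symmetric])
  qed
  have Tzc: "isCont (\<lambda>z. T (h, z)) \<zeta>" if "h \<in> J0" "\<zeta> \<in> U" for h \<zeta>
    using has_derivative_continuous[OF Tz[OF that]] .
  define p0 where "p0 = (hn, \<zeta>n)"
  define T1 where "T1 = T' p0 (0, 1)"
  obtain A G0 where "A \<in> L2_ops D" "rank_one A" "G0 \<in> L2_ops D"
    "\<And>E. restr D E = E \<Longrightarrow> T p0 (A E) = A E"
    "\<And>E. restr D E = E \<Longrightarrow> A (T p0 E) = A E"
    "\<And>F. restr D F = F \<Longrightarrow> A F = 0 \<Longrightarrow> G0 F - T p0 (G0 F) = F"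
    "\<And>E. restr D E = E \<Longrightarrow> G0 (E - T p0 E) = E + A (T1 E)"
    using simple_pole_laurent_identities[OF D pole Tzc[OF J0(2) zn] Tops[OF J0(2)]] TzC[OF J0(2), of \<zeta>n] \<rho>(1)
    unfolding p0_def T1_def by (metis centre_in_ball)
  from bordered_inverse[OF D Tops[OF J0(2) zn, folded p0_def] this] obtain u v J where
    u: "u \<noteq> 0" "restr D u = u" "T p0 u = u" and v: "restr D v = v" and
    J: "(id_blinfun - T p0 + rank_op D v u) o\<^sub>L J = id_blinfun"
    "J o\<^sub>L (id_blinfun - T p0 + rank_op D v u) = id_blinfun" and
    Jv: "J v = u" and JT1: "proj_coeff D u (J (T1 u)) = - 1"
    by metis
  define B where "B p = id_blinfun - T p + rank_op D v u" for p
  define W0 where "W0 = J0 \<times> ball \<zeta>n \<rho>"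
  have W0: "open W0" "W0 \<subseteq> J0 \<times> U" unfolding W0_def using J0 \<rho> by (auto intro: open_Times)
  have Bd: "(B has_derivative (\<lambda>x. - T' p x)) (at p)" if "p \<in> W0" for p
    using T'[of p] that W0(2) unfolding B_def by (auto intro!: derivative_eq_intros)
  have Bc: "continuous_on W0 B"
    using Bd has_derivative_continuous by (blast intro: continuous_at_imp_continuous_on)
  \<comment> \<open>The bound 1/2 is the smallness condition of
    \<open>blinfun_inverse_perturb\<close>, with \<open>J\<close> the inverse at
    \<open>p0\<close>.\<close>
  define W where "W = W0 \<inter> (\<lambda>p. norm (B p0 - B p) * norm J) -` {..<1/2}"
  have Wop: "open W" unfolding W_def
    by (intro continuous_open_preimage W0 continuous_intros Bc open_lessThan)
  have W_sub: "W \<subseteq> W0" "W \<subseteq> J0 \<times> U" using W0 by (auto simp: W_def)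
  have "\<exists>I. B p o\<^sub>L I = id_blinfun \<and> I o\<^sub>L B p = id_blinfun" if "p \<in> W" for p
    using that by (intro blinfun_inverse_perturb[OF J[folded B_def]]) (simp add: W_def)
  then obtain I where I: "\<And>p. p \<in> W \<Longrightarrow> B p o\<^sub>L I p = id_blinfun \<and> I p o\<^sub>L B p = id_blinfun" by metis
  have p0W: "p0 \<in> W" using J0 \<rho> by (auto simp: W_def W0_def p0_def)
  have Ip0: "I p0 = J"
  proof -
    have "I p0 = I p0 o\<^sub>L (B p0 o\<^sub>L J)" using J[folded B_def] by (simp add: blinfun_eqI)
    also have "\<dots> = (I p0 o\<^sub>L B p0) o\<^sub>L J" by (simp add: blinfun_eqI)
    finally show ?thesis using I[OF p0W] by (simp add: blinfun_eqI)
  qed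
  have Id: "(I has_derivative (\<lambda>x. I p o\<^sub>L (T' p x o\<^sub>L I p))) (at p)" if "p \<in> W" for p
  proof -
    have "(I has_derivative (\<lambda>x. - (I p o\<^sub>L (- T' p x o\<^sub>L I p)))) (at p)"
      using has_derivative_blinfun_inverse[OF I Wop that Bd] that W_sub by blast
    also have "(\<lambda>x. - (I p o\<^sub>L (- T' p x o\<^sub>L I p))) = (\<lambda>x. I p o\<^sub>L (T' p x o\<^sub>L I p))"
      by (intro ext blinfun_eqI) (simp add: blinfun.minus_left blinfun.minus_right)
    finally show ?thesis .
  qed
  have Ic: "continuous_on W I"
    using Id has_derivative_continuous by (blast intro: continuous_at_imp_continuous_on)
  have TopsW: "T p \<in> L2_ops D" if "p \<in> W" for p using Tops[of "fst p" "snd p"] that W_sub(2) by auto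
  note facts = bordered_resolvent[OF D TopsW v I[THEN conjunct1, unfolded B_def] I[THEN conjunct2, unfolded B_def]]
  define d where "d p = 1 - proj_coeff D u (I p v)" for p
  define d' where "d' p x = - proj_coeff D u (I p (T' p x (I p v)))" for p x
  have dd: "(d has_derivative d' p) (at p)" if "p \<in> W" for p
  proof -
    have "((\<lambda>p. 1 - proj_coeff D u (I p v)) has_derivative (\<lambda>x. 0 - proj_coeff D u ((I p o\<^sub>L (T' p x o\<^sub>L I p)) v))) (at p)"
      by (intro has_derivative_diff has_derivative_const bounded_linear.has_derivative[OF bounded_linear_proj_coeff]
            bounded_linear.has_derivative[OF blinfun.bounded_linear_left] Id that)
    then show ?thesis by (simp add: d_def[abs_def] d'_def[abs_def])
  qed
  have d'c: "continuous_on W (\<lambda>p. d' p x)" for x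
    unfolding d'_def
    by (intro continuous_intros bounded_linear.continuous_on[OF bounded_linear_proj_coeff]
        Ic continuous_on_subset[OF T'c W_sub(2)])
  define a where "a p = d' p (1, 0)" for p
  define b where "b p = d' p (0, 1)" for p
  \<comment> \<open>The derivative of \<open>d\<close> is real-linear in h but complex-linear in
    \<zeta>, so its \<zeta>-part is multiplication by one number \<open>b p\<close>, invertible as
    soon as \<open>b p\<close> is nonzero.\<close>
  have d'ab: "d' p (s, w) = s *\<^sub>R a p + w * b p" if "p \<in> W" for p s w
  proof -
    have lin_d': "linear (d' p)" using dd[OF that] has_derivative_bounded_linear bounded_linear.linear by blast
    have "d' p (s, w) = d' p (s *\<^sub>R (1, 0) + (0, w))" by simp
    also have "\<dots> = s *\<^sub>R a p + d' p (0, w)"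
      by (simp only: linear_add[OF lin_d'] linear_cmul[OF lin_d'] a_def)
    also have "d' p (0, w) = w * b p"
    proof -
      have "T' p (0, w) = scaleC_op w (T' p (0, 1))"
      proof -
        have "p \<in> J0 \<times> ball \<zeta>n \<rho>" using that W_sub(1) unfolding W0_def by blast
        then have "fst p \<in> J0" "snd p \<in> ball \<zeta>n \<rho>" by (auto simp only: mem_Times_iff)
        with \<rho>i have "fst p \<in> J0" "snd p \<in> interior U" by blast+
        from lin[OF this, of w] show ?thesis by (simp only: prod.collapse)
      qed
      then show ?thesis using that by (simp add: d'_def b_def facts(1) proj_coeff_scaleC[OF D])
    qed
    finally show ?thesis .
  qed
  have bp0: "b p0 = 1" using JT1 by (simp add: b_def d'_def Ip0 Jv T1_def)
  have dp0: "d p0 = 0" using proj_coeff_self[OF D u(1,2)] by (simp add: d_def Ip0 Jv)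
  \<comment> \<open>Keeping h as first coordinate turns the implicit equation d = 0 into an
    inversion: locally the branch is the preimage under \<Phi> of the points (h, 0).\<close>
  define \<Phi> where "\<Phi> p = (fst p, d p)" for p
  define \<Phi>' where "\<Phi>' p = Blinfun (\<lambda>x. (fst x, d' p x))" for p
  have \<Phi>': "blinfun_apply (\<Phi>' p) = (\<lambda>x. (fst x, d' p x))" if "p \<in> W" for p
    unfolding \<Phi>'_def
    by (rule bounded_linear_Blinfun_apply)
      (intro bounded_linear_Pair bounded_linear_fst has_derivative_bounded_linear[OF dd[OF that]])
  \<comment> \<open>Since b p0 = 1, the derivative at \<open>p0\<close> sends (s, w) to (s, s a + w)
    with a = a p0; subtracting s a inverts it.\<close>
  define invf where "invf = Blinfun (\<lambda>(s, t). (s, t - s *\<^sub>R a p0))"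
  have invf: "blinfun_apply invf = (\<lambda>(s, t). (s, t - s *\<^sub>R a p0))"
    unfolding invf_def split_beta'
    by (rule bounded_linear_Blinfun_apply)
       (intro bounded_linear_Pair bounded_linear_fst bounded_linear_snd bounded_linear_sub
          bounded_linear_compose[OF bounded_linear_scaleR_left])
  obtain U' V g g' where U': "open U'" "U' \<subseteq> W" "p0 \<in> U'" and V: "open V" "\<Phi> p0 \<in> V"
    and hom: "homeomorphism U' V \<Phi> g"
    and g': "\<And>y. y \<in> V \<Longrightarrow> (g has_derivative (g' y)) (at y)"
    "\<And>y. y \<in> V \<Longrightarrow> g' y = inv (blinfun_apply (\<Phi>'(g y)))"
    "\<And>y. y \<in> V \<Longrightarrow> bij (blinfun_apply (\<Phi>'(g y)))"
  proof (rule inverse_function_theorem[of W \<Phi> \<Phi>' p0 invf])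
    show "(\<Phi> has_derivative blinfun_apply (\<Phi>' p)) (at p)" if "p \<in> W" for p
      unfolding \<Phi>_def \<Phi>'[OF that] by (auto intro!: derivative_eq_intros dd that)
    show "continuous_on W \<Phi>'"
    proof (rule continuous_on_blinfun_componentwise)
      fix i :: "real \<times> complex"
      have "continuous_on W (\<lambda>p. (fst i, d' p i))" by (intro continuous_intros d'c)
      then show "continuous_on W (\<lambda>p. \<Phi>' p i)"
        by (rule continuous_on_eq) (simp add: \<Phi>')
    qed
    show "invf o\<^sub>L \<Phi>' p0 = id_blinfun"
      by (rule blinfun_eqI) (auto simp: invf \<Phi>'[OF p0W] d'ab[OF p0W] bp0)
  qed (use Wop p0W in auto)
  have gV: "g y \<in> U'" "\<Phi> (g y) = y" if "y \<in> V" for y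
    using hom that unfolding homeomorphism_def by auto
  have gU: "g (\<Phi> p) = p" "\<Phi> p \<in> V" if "p \<in> U'" for p
    using hom that unfolding homeomorphism_def by auto
  \<comment> \<open>The inverse function theorem keeps the derivative of \<Phi> bijective on
    \<open>U'\<close>; a zero of \<open>b\<close> would put (0, 1) into its kernel.\<close>
  have bnz: "b p \<noteq> 0" if "p \<in> U'" for p
  proof
    assume "b p = 0"
    have "p \<in> W" using that U' by blast
    have "bij (blinfun_apply (\<Phi>' p))" using g'(3)[of "\<Phi> p"] gU[OF that] by simp
    moreover have "\<Phi>' p (0, 1) = \<Phi>' p (0, 0)"
      using \<open>b p = 0\<close> by (simp add: \<Phi>'[OF \<open>p \<in> W\<close>] d'ab[OF \<open>p \<in> W\<close>])
    ultimately show False by (auto dest!: bij_is_inj injD)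
  qed
  \<comment> \<open>A product neighbourhood inside \<open>U'\<close>: for h in \<open>S1\<close>, a
    zero of \<open>d\<close> with second coordinate in \<open>S2\<close> must be the one found by
    \<open>g\<close>. Uniqueness of the branch rests on this.\<close>
  obtain S1 S2 where S0: "open S1" "open S2" "p0 \<in> S1 \<times> S2" "S1 \<times> S2 \<subseteq> U'"
    using U'(1,3) by (rule open_prod_elim)
  then have S: "open S1" "open S2" "hn \<in> S1" "\<zeta>n \<in> S2" "S1 \<times> S2 \<subseteq> U'"
    by (auto simp: p0_def)
  define \<zeta> where "\<zeta> h = snd (g (h, 0))" for h
  have \<Phi>p0: "\<Phi> p0 = (hn, 0)" by (simp add: \<Phi>_def dp0) (simp add: p0_def)
  define H where "H = (\<lambda>h. (h, 0 :: complex)) -` V"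
  have H: "open H" "hn \<in> H" unfolding H_def using V \<Phi>p0
    by (auto intro!: open_vimage continuous_intros)
  have gh: "g (h, 0) = (h, \<zeta> h)" "d (h, \<zeta> h) = 0" "(h, \<zeta> h) \<in> U'" if "h \<in> H" for h
  proof -
    have "\<Phi> (g (h, 0)) = (h, 0)" "g (h, 0) \<in> U'" using gV that by (auto simp: H_def)
    then show "g (h, 0) = (h, \<zeta> h)" "d (h, \<zeta> h) = 0" "(h, \<zeta> h) \<in> U'"
      by (auto simp: \<Phi>_def \<zeta>_def prod_eq_iff) (metis prod.collapse)+
  qed
  have z0: "\<zeta> hn = \<zeta>n" using gU(1)[OF U'(3)] by (simp add: \<Phi>p0 \<zeta>_def) (simp add: p0_def)
  \<comment> \<open>Implicit differentiation of d (h, \<zeta> h) = 0. The explicit quotient is what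
    shows the derivative to be continuous.\<close>
  define \<zeta>' where "\<zeta>' h = - a (h, \<zeta> h) / b (h, \<zeta> h)" for h
  have zd: "(\<zeta> has_vector_derivative \<zeta>' h) (at h)" if h: "h \<in> H" for h
  proof -
    have yV: "(h, 0) \<in> V" using h by (simp add: H_def)
    have "((\<lambda>h. (h, 0 :: complex)) has_derivative (\<lambda>s. (s, 0))) (at h)" by (auto intro!: derivative_eq_intros)
    from has_derivative_compose[OF this g'(1)[OF yV]]
    have "((\<lambda>h. g (h, 0)) has_derivative (\<lambda>s. g' (h, 0) (s, 0))) (at h)" .
    then have der: "(\<zeta> has_derivative (\<lambda>s. snd (g' (h, 0) (s, 0)))) (at h)"
      unfolding \<zeta>_def by (rule has_derivative_snd)
    have pW: "(h, \<zeta> h) \<in> W" using gh(3)[OF h] U' by blast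
    have "snd (g' (h, 0) (s, 0)) = s *\<^sub>R \<zeta>' h" for s
    proof -
      have "\<Phi>' (h, \<zeta> h) (g' (h, 0) (s, 0)) = (s, 0)"
        using g'(2,3)[OF yV] unfolding gh(1)[OF h] by (simp add: bij_is_surj surj_f_inv_f)
      then have "s *\<^sub>R a (h, \<zeta> h) + snd (g' (h, 0) (s, 0)) * b (h, \<zeta> h) = 0"
        by (cases "g' (h, 0) (s, 0)") (auto simp: \<Phi>'[OF pW] d'ab[OF pW])
      then have "snd (g' (h, 0) (s, 0)) = - (s *\<^sub>R a (h, \<zeta> h)) / b (h, \<zeta> h)"
        using bnz[OF gh(3)[OF h]] by (simp add: field_simps eq_neg_iff_add_eq_0 add.commute)
      then show ?thesis by (simp add: \<zeta>'_def scaleR_conv_of_real)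
    qed
    then show ?thesis using der by (simp add: has_vector_derivative_def)
  qed
  have zc: "continuous_on H \<zeta>"
    using zd has_vector_derivative_continuous by (blast intro: continuous_at_imp_continuous_on)
  have pair: "continuous_on H (\<lambda>h. (h, \<zeta> h))" by (intro continuous_intros zc)
  have pairW: "(\<lambda>h. (h, \<zeta> h)) ` H \<subseteq> W" using gh(3) U' by blast
  have zc': "continuous_on H \<zeta>'"
    unfolding \<zeta>'_def a_def b_def
    by (intro continuous_intros continuous_on_compose2[OF d'c pair pairW]) (use bnz gh(3) in \<open>auto simp: b_def\<close>)
  \<comment> \<open>Uniqueness needs the values of \<zeta> to stay in \<open>S2\<close>; taking a
    ball inside \<open>H1\<close> then makes the domain connected.\<close>
  define H1 where "H1 = (H \<inter> \<zeta> -` S2) \<inter> S1 \<inter> J0"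
  have H1: "open H1" "hn \<in> H1"
    using H S J0 z0 continuous_open_preimage[OF zc H(1) S(2)] by (auto simp: H1_def)
  then obtain \<delta> where \<delta>: "\<delta> > 0" "ball hn \<delta> \<subseteq> H1" using openE by blast
  define JJ where "JJ = ball hn \<delta>"
  have JJ: "open JJ" "hn \<in> JJ" "is_interval JJ" "JJ \<subseteq> J0" "JJ \<subseteq> H" "JJ \<subseteq> S1" "\<And>h. h \<in> JJ \<Longrightarrow> \<zeta> h \<in> S2"
    unfolding JJ_def using \<delta> by (auto simp: H1_def is_interval_ball_real)
  have pW: "(h, \<zeta> h) \<in> W" "d (h, \<zeta> h) = 0" "b (h, \<zeta> h) \<noteq> 0" if "h \<in> JJ" for h
  proof -
    have "h \<in> H" using that JJ(5) by blast
    then show "(h, \<zeta> h) \<in> W" "d (h, \<zeta> h) = 0" "b (h, \<zeta> h) \<noteq> 0"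
      using pairW gh(2,3) bnz by blast+
  qed
  define E where "E h = I (h, \<zeta> h) v" for h
  have poleJ: "simple_pole D U (\<lambda>z. T (h, z)) (\<zeta> h)" if h: "h \<in> JJ" for h
  proof -
    obtain Q1 Q2 where Q: "open Q1" "open Q2" "(h, \<zeta> h) \<in> Q1 \<times> Q2" "Q1 \<times> Q2 \<subseteq> W"
      using Wop pW(1)[OF h] by (rule open_prod_elim)
    obtain r where r: "r > 0" "ball (\<zeta> h) r \<subseteq> Q2" using Q(2,3) openE by blast
    have inW: "(h, z) \<in> W" if "z \<in> ball (\<zeta> h) r" for z using that r Q by blast
    have inW': "h \<in> J0" "z \<in> U" "z \<in> ball \<zeta>n \<rho>" if "z \<in> ball (\<zeta> h) r" for z
      using subsetD[OF W_sub(1) inW[OF that]] subsetD[OF W_sub(2) inW[OF that]]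
      unfolding W0_def mem_Sigma_iff by blast+
    show ?thesis
    proof (rule simple_pole_from_zero[where \<rho> = r and u = u and v = v and I = "\<lambda>z. I (h, z)" and d = "\<lambda>z. d (h, z)", OF D])
      show "ball (\<zeta> h) r \<subseteq> U" using inW' by blast
      show "op_holomorphic_on (\<lambda>z. T (h, z)) (ball (\<zeta> h) r)"
        unfolding op_holomorphic_on_def using TzC inW' by blast
      have "((\<lambda>z. (h, z)) has_derivative (\<lambda>w. (0, w))) (at (\<zeta> h))" by (auto intro!: derivative_eq_intros)
      from has_derivative_compose[OF this dd[OF pW(1)[OF h]]]
      have "((\<lambda>z. d (h, z)) has_derivative (\<lambda>w. d' (h, \<zeta> h) (0, w))) (at (\<zeta> h))" .
      also have "(\<lambda>w. d' (h, \<zeta> h) (0, w)) = (*) (b (h, \<zeta> h))"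
        by (rule ext) (simp add: d'ab[OF pW(1)[OF h]] mult.commute)
      finally show "((\<lambda>z. d (h, z)) has_field_derivative b (h, \<zeta> h)) (at (\<zeta> h))"
        by (simp add: has_field_derivative_def)
    qed (use r v TopsW inW I pW[OF h] in \<open>auto simp: B_def d_def\<close>)
  qed
  have "\<zeta> C1_differentiable_on JJ"
    unfolding C1_differentiable_on_def using zd continuous_on_subset[OF zc' JJ(5)] JJ(5) by blast
  moreover have "\<zeta> ` JJ \<subseteq> U" using pW(1) W_sub(2) by blast
  ultimately have br: "branch JJ \<zeta>" using z0 poleJ by (simp add: branch_def)
  \<comment> \<open>A competing branch might a priori leave \<open>S2\<close>. Where it lies in
    \<open>S2\<close>, its pole has an eigenvector, so d vanishes and injectivity of \<Phi> on
    \<open>U'\<close> forces equality; connectedness does the rest.\<close>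
  have uniq: "\<eta> h = \<zeta> h" if \<eta>: "branch JJ \<eta>" and h: "h \<in> JJ" for \<eta> h
  proof (rule connected_local_unique[OF _ _ _ JJ(2) _ S(2) JJ(7) _ h])
    show "connected JJ" by (simp add: JJ_def)
    show "continuous_on JJ \<eta>" using \<eta> unfolding branch_def by (blast intro: C1_differentiable_imp_continuous_on)
    show "continuous_on JJ \<zeta>" using continuous_on_subset[OF zc JJ(5)] .
    show "\<eta> hn = \<zeta> hn" using \<eta> z0 by (simp add: branch_def)
    fix k assume k: "k \<in> JJ" "\<eta> k \<in> S2"
    have kU: "(k, \<eta> k) \<in> U'" using k JJ(6) S(5) by blast
    then have kW: "(k, \<eta> k) \<in> W" using U'(2) by blast
    have kJ: "k \<in> J0" using k JJ(4) by blast
    have "simple_pole D U (\<lambda>z. T (k, z)) (\<eta> k)" "\<eta> k \<in> U" using \<eta> k unfolding branch_def by auto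
    from simple_pole_eigenvector[OF D this(1) Tzc[OF kJ this(2)] Tops[OF kJ]]
    obtain E where "T (k, \<eta> k) E = E" "E \<noteq> 0" by blast
    then have "d (k, \<eta> k) = 0" using facts(8)[OF kW kW kW] by (simp add: d_def)
    then have "g (k, 0) = (k, \<eta> k)" using gU(1)[OF kU] by (simp add: \<Phi>_def)
    then show "\<eta> k = \<zeta> k" by (simp add: \<zeta>_def)
  qed
  have EC1: "E C1_differentiable_on JJ"
    unfolding C1_differentiable_on_def
  \<comment> \<open>The chain rule: the inverse has derivative I o T' o I, taken in the direction
    (1, \<zeta>' h) tangent to the branch.\<close>
  proof (intro exI[of _ "\<lambda>h. I (h, \<zeta> h) (T' (h, \<zeta> h) (1, \<zeta>' h) (I (h, \<zeta> h) v))"] conjI ballI)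
    fix h assume h: "h \<in> JJ"
    have "((\<lambda>h. (h, \<zeta> h)) has_derivative (\<lambda>s. (s, s *\<^sub>R \<zeta>' h))) (at h)"
      using zd[of h] h JJ(5) by (auto intro!: derivative_eq_intros simp: has_vector_derivative_def)
    from has_derivative_compose[OF this Id[OF pW(1)[OF h]]]
    have "((\<lambda>h. I (h, \<zeta> h)) has_derivative (\<lambda>s. I (h, \<zeta> h) o\<^sub>L (T' (h, \<zeta> h) (s, s *\<^sub>R \<zeta>' h) o\<^sub>L I (h, \<zeta> h)))) (at h)" .
    from bounded_linear.has_derivative[OF blinfun.bounded_linear_left this, of v]
    have "(E has_derivative (\<lambda>s. I (h, \<zeta> h) (T' (h, \<zeta> h) (s, s *\<^sub>R \<zeta>' h) (I (h, \<zeta> h) v)))) (at h)"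
      by (simp add: E_def[abs_def])
    moreover have "(s, s *\<^sub>R \<zeta>' h) = s *\<^sub>R (1, \<zeta>' h)" for s by simp
    ultimately show "(E has_vector_derivative I (h, \<zeta> h) (T' (h, \<zeta> h) (1, \<zeta>' h) (I (h, \<zeta> h) v))) (at h)"
      by (simp only: has_vector_derivative_def blinfun.scaleR_right blinfun.scaleR_left)
  next
    have p: "continuous_on JJ (\<lambda>h. (h, \<zeta> h))" "(\<lambda>h. (h, \<zeta> h)) ` JJ \<subseteq> W"
      using continuous_on_subset[OF pair JJ(5)] pW(1) by auto
    show "continuous_on JJ (\<lambda>h. I (h, \<zeta> h) (T' (h, \<zeta> h) (1, \<zeta>' h) (I (h, \<zeta> h) v)))"
      by (intro continuous_intros continuous_on_compose2[OF Ic p]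
          continuous_on_compose2[OF continuous_on_subset[OF T'c W_sub(2)] p] continuous_on_subset[OF zc' JJ(5)])
  qed
  have st: "E h \<in> L2_on D \<and> E h \<noteq> 0 \<and> T (h, \<zeta> h) (E h) = E h \<and>
         (\<forall>F. F \<noteq> 0 \<longrightarrow> T (h, \<zeta> h) F = F \<longrightarrow> (\<exists>c. c \<noteq> 0 \<and> F = c *\<^sub>C E h))" if h: "h \<in> JJ" for h
  proof (intro conjI allI impI)
    note f = facts[OF pW(1)[OF h] pW(1)[OF h] pW(1)[OF h]]
    \<comment> \<open>On the branch d = 0, so the defect in T (I v) = I v - d v disappears and
      \<open>I v\<close> is an eigenvector; it is nonzero because its coefficient under psi is
      1.\<close>
    have d0: "1 - proj_coeff D u (I (h, \<zeta> h) v) = 0" using pW(2)[OF h] by (simp add: d_def)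
    show TE: "T (h, \<zeta> h) (E h) = E h" using f(6) unfolding d0 by (simp add: E_def)
    show "E h \<in> L2_on D" using TopsW[OF pW(1)[OF h]] TE unfolding L2_ops_def by (metis (mono_tags, lifting) mem_Collect_eq rangeI subsetD)
    show "E h \<noteq> 0" using d0 by (auto simp: E_def)
    fix F assume F: "F \<noteq> 0" "T (h, \<zeta> h) F = F"
    then have "F = proj_coeff D u F *\<^sub>C E h" using f(7) by (simp add: E_def)
    then show "\<exists>c. c \<noteq> 0 \<and> F = c *\<^sub>C E h" using F(1) by (metis scaleC_zero_left)
  qed
  show ?thesis
    using JJ br uniq EC1 st by (intro exI[of _ JJ] exI[of _ \<zeta>] exI[of _ E]) blast
qed

section \<open>The kernel\<close>

text \<open>The argument is cut along the negative imaginary axis. Multiplication by - i rotates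
  this cut to the negative real axis, the cut of \<open>Ln\<close>, and adding pi / 2 to the angle
  rotates back.\<close>

lemma arg_cut_eq:
  assumes "- \<i> * w \<notin> \<real>\<^sub>\<le>\<^sub>0"
  shows "arg_cut w = Im (Ln (- \<i> * w)) + pi / 2"
proof -
  define w' where "w' = - \<i> * w"
  have w': "w' \<noteq> 0" "w' \<notin> \<real>\<^sub>\<le>\<^sub>0" using assms by (auto simp: w'_def)
  define \<theta> where "\<theta> = Im (Ln w') + pi / 2"
  have w: "w = \<i> * w'" "cmod w' = cmod w" by (auto simp: w'_def norm_mult)
  have "Im (Ln w') < pi" using w' Im_Ln_less_pi by (auto simp: complex_nonpos_Reals_iff)
  moreover have "- pi < Im (Ln w')" using w' mpi_less_Im_Ln by auto
  ultimately have \<theta>: "- pi / 2 < \<theta>" "\<theta> < 3 * pi / 2" by (auto simp: \<theta>_def)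
  have "w' = of_real (cmod w') * cis (Im (Ln w'))"
    using w' by (metis Arg_eq_Im_Ln rcis_cmod_Arg rcis_def)
  then have eq: "w = of_real (cmod w) * cis \<theta>"
    using w by (simp add: \<theta>_def cis_mult[symmetric] flip: cis_pi_half)
  show ?thesis
    unfolding arg_cut_def w'_def[symmetric] \<theta>_def[symmetric]
  proof (rule the_equality)
    show "- pi / 2 < \<theta> \<and> \<theta> < 3 * pi / 2 \<and> w = complex_of_real (cmod w) * cis \<theta>" using \<theta> eq by blast
    fix \<theta>' assume a: "- pi / 2 < \<theta>' \<and> \<theta>' < 3 * pi / 2 \<and> w = complex_of_real (cmod w) * cis \<theta>'"
    have "cmod w \<noteq> 0" using w w' by auto
    then have "cis \<theta>' = cis \<theta>" using a eq by (metis mult_cancel_left of_real_eq_0_iff)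
    then obtain k :: int where "\<i> * of_real \<theta>' = \<i> * of_real \<theta> + (of_int (2 * k) * pi) * \<i>"
      unfolding cis_conv_exp exp_eq by blast
    from arg_cong[OF this, of Im] obtain n :: int where n: "\<theta>' = \<theta> + 2 * pi * n"
      by (auto simp: mult_ac)
    have "\<bar>\<theta>' - \<theta>\<bar> < 2 * pi" using a \<theta> by (simp add: abs_less_iff)
    then have "\<bar>of_int n\<bar> < (1::real)" using n by (simp add: abs_mult)
    then have "n = 0" by linarith
    then show "\<theta>' = \<theta>" using n by simp
  qed
qed

text \<open>Through \<open>Ln\<close> the holomorphy of this branch off its cut becomes
  available.\<close>

lemma sqrt_cut_eq:
  assumes "- \<i> * w \<notin> \<real>\<^sub>\<le>\<^sub>0"
  shows "sqrt_cut w = exp ((Ln (- \<i> * w) + \<i> * (pi / 2)) / 2)"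
proof -
  have "- \<i> * w \<noteq> 0" using assms by auto
  then have "Ln (- \<i> * w) = of_real (ln (cmod w)) + \<i> * of_real (Im (Ln (- \<i> * w)))"
    by (simp add: complex_eq_iff norm_mult)
  then have "log_cut w = Ln (- \<i> * w) + \<i> * (pi / 2)"
    unfolding log_cut_def arg_cut_eq[OF assms] by (simp add: complex_eq_iff)
  then show ?thesis by (simp add: sqrt_cut_def)
qed

lemma sqrt_cut_power2:
  assumes "- \<i> * w \<notin> \<real>\<^sub>\<le>\<^sub>0"
  shows "(sqrt_cut w)\<^sup>2 = w"
proof -
  have n0: "- \<i> * w \<noteq> 0" using assms by auto
  have "(sqrt_cut w)\<^sup>2 = exp (Ln (- \<i> * w) + \<i> * (pi / 2))"
  proof -
    have "(exp (x / 2))\<^sup>2 = exp x" for x :: complex using exp_double[of "x / 2"] by simp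
    then show ?thesis unfolding sqrt_cut_eq[OF assms] .
  qed
  also have "\<dots> = (- \<i> * w) * \<i>"
    unfolding exp_add exp_Ln[OF n0] using cis_conv_exp[of "pi/2"] by simp
  also have "\<dots> = w" by (simp add: complex_eq_iff)
  finally show ?thesis .
qed

text \<open>In the left half plane arguments lie strictly between pi / 2 and 3 pi / 2; halving puts
  them between pi / 4 and 3 pi / 4, where the sine is positive. There the chosen branch gives
  decaying modes.\<close>

lemma Im_sqrt_cut_pos:
  assumes "Re w < 0"
  shows "- \<i> * w \<notin> \<real>\<^sub>\<le>\<^sub>0" "Im (sqrt_cut w) > 0"
proof -
  have im: "Im (- \<i> * w) > 0" using assms by simp
  then show nr: "- \<i> * w \<notin> \<real>\<^sub>\<le>\<^sub>0" by (auto simp: complex_nonpos_Reals_iff)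
  then have "- \<i> * w \<noteq> 0" by auto
  then have "0 < Im (Ln (- \<i> * w)) \<and> Im (Ln (- \<i> * w)) < pi"
    using Im_Ln_pos_lt im by blast
  then have "sin ((Im (Ln (- \<i> * w)) + pi / 2) / 2) > 0"
    by (intro sin_gt_zero) auto
  then show "Im (sqrt_cut w) > 0"
    unfolding sqrt_cut_eq[OF nr] Im_exp by simp
qed

text \<open>For s^2 = w the real part of w is (Re s)^2 - (Im s)^2, which forces (Im s)^2 >= b^2; the
  sign of Im s comes from the choice of branch.\<close>

lemma sqrt_cut_Im_ge:
  assumes "Re w \<le> - b\<^sup>2" "b > 0"
  shows "Im (sqrt_cut w) \<ge> b"
proof -
  have "Re w < 0" using assms by (smt (verit) zero_less_power)
  note s = Im_sqrt_cut_pos[OF this]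
  have "Re ((sqrt_cut w)\<^sup>2) = Re w" using sqrt_cut_power2[OF s(1)] by simp
  then have "(Re (sqrt_cut w))\<^sup>2 - (Im (sqrt_cut w))\<^sup>2 = Re w" by (simp add: Re_power2)
  then have "b\<^sup>2 \<le> (Im (sqrt_cut w))\<^sup>2" using assms(1) zero_le_power2[of "Re (sqrt_cut w)"] by linarith
  then show ?thesis by (rule power2_le_imp_le) (use s(2) in simp)
qed

lemma cut_planeD:
  assumes "z \<in> cut_plane kx"
  shows "- \<i> * (z - of_real ((k_mode kx m)\<^sup>2)) \<notin> \<real>\<^sub>\<le>\<^sub>0"
proof
  assume a: "- \<i> * (z - of_real ((k_mode kx m)\<^sup>2)) \<in> \<real>\<^sub>\<le>\<^sub>0"
  define s where "s = - Re (- \<i> * (z - of_real ((k_mode kx m)\<^sup>2)))"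
  have "s \<ge> 0" "z = of_real ((k_mode kx m)\<^sup>2) - \<i> * of_real s"
    using a by (auto simp: s_def complex_nonpos_Reals_iff complex_eq_iff)
  then have "z \<notin> cut_plane kx" unfolding cut_plane_def by blast
  then show False using assms by simp
qed

section \<open>The modes of the kernel; \<open>mode_sqrt\<close> is the wave number in the z
  direction\<close>

definition mode_sqrt :: "real \<Rightarrow> int \<Rightarrow> complex \<Rightarrow> complex" where
  "mode_sqrt kx m z = sqrt_cut (z - of_real ((k_mode kx m)\<^sup>2))"

definition mode_term :: "real \<Rightarrow> int \<Rightarrow> complex \<Rightarrow> real \<times> real \<Rightarrow> complex" where
  "mode_term kx m z r = exp (\<i> * (of_real (fst r * k_mode kx m) + of_real \<bar>snd r\<bar> * mode_sqrt kx m z)) / mode_sqrt kx m z"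

lemma H_kernel_eq: "H_kernel kx z r = \<i> * z / 2 * (\<Sum>\<^sub>\<infinity>m. mode_term kx m z r)"
  by (simp add: H_kernel_def mode_term_def mode_sqrt_def split_beta)

lemma mode_sqrt_nonzero:
  assumes "z \<in> cut_plane kx" shows "mode_sqrt kx m z \<noteq> 0"
  unfolding mode_sqrt_def sqrt_cut_eq[OF cut_planeD[OF assms]] by simp

lemma holomorphic_mode_sqrt:
  assumes "U \<subseteq> cut_plane kx" shows "mode_sqrt kx m holomorphic_on U"
proof -
  have "(\<lambda>z. exp ((Ln (- \<i> * (z - of_real ((k_mode kx m)\<^sup>2))) + \<i> * (pi / 2)) / 2)) holomorphic_on U"
  proof (intro holomorphic_intros)
    show "- \<i> * (z - of_real ((k_mode kx m)\<^sup>2)) \<notin> \<real>\<^sub>\<le>\<^sub>0" if "z \<in> U" for z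
      by (rule cut_planeD) (use that assms in blast)
  qed simp_all
  then show ?thesis
  proof (rule holomorphic_transform)
    fix z assume "z \<in> U"
    then have "z \<in> cut_plane kx" using assms by blast
    then show "exp ((Ln (- \<i> * (z - of_real ((k_mode kx m)\<^sup>2))) + \<i> * (pi / 2)) / 2) = mode_sqrt kx m z"
      unfolding mode_sqrt_def by (rule sqrt_cut_eq[OF cut_planeD, symmetric])
  qed
qed

lemma holomorphic_mode_term:
  assumes "U \<subseteq> cut_plane kx" shows "(\<lambda>z. mode_term kx m z r) holomorphic_on U"
  unfolding mode_term_def
proof (intro holomorphic_intros holomorphic_mode_sqrt assms)
  show "mode_sqrt kx m z \<noteq> 0" if "z \<in> U" for z
    by (rule mode_sqrt_nonzero) (use that assms in blast)
qed

lemma cmod_mode_term: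
  "cmod (mode_term kx m z r) = exp (- (\<bar>snd r\<bar> * Im (mode_sqrt kx m z))) / cmod (mode_sqrt kx m z)"
  by (simp add: mode_term_def norm_divide norm_exp_eq_Re)

text \<open>Trades exponential decay in |z| |m| for powers of both. Together with the factor 1 / |m|
  of a mode, the exponent 1/4 leaves |m|^(-5/4), which is summable, and |z|^(-1/4), which is square
  integrable near 0; any exponent strictly between 0 and 1/2 would do both.\<close>

lemma exp_minus_le_powr:
  fixes x :: real
  assumes "x > 0" shows "exp (- x) \<le> x powr (- 1 / 4)"
proof (cases "x \<le> 1")
  case True
  then have "1 \<le> x powr (- 1 / 4)" using assms powr_mono2'[of "-1/4" x 1] by simp
  moreover have "exp (- x) \<le> 1" using assms by simp
  ultimately show ?thesis by linarith
next
  case False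
  have "exp (- x) = inverse (exp x)" by (simp add: exp_minus)
  also have "\<dots> \<le> inverse x" using assms exp_ge_add_one_self[of x] by (intro le_imp_inverse_le) linarith+
  also have "\<dots> = x powr (-1)" using assms by (simp add: powr_minus)
  also have "\<dots> \<le> x powr (- 1 / 4)" using False by (intro powr_mono) auto
  finally show ?thesis .
qed

lemma summable_int_powr: "(\<lambda>m::int. (\<bar>of_int m\<bar> / 2) powr (- 5 / 4 :: real)) summable_on UNIV"
proof -
  have "summable (\<lambda>n. real n powr (- 5 / 4))" by (simp add: summable_real_powr_iff)
  then have "summable (\<lambda>n. (real n / 2) powr (- 5 / 4))"
    using summable_divide[of "\<lambda>n. real n powr (- 5 / 4)" "2 powr (- 5 / 4)"] by (simp add: powr_divide)
  then have s: "(\<lambda>n. (real n / 2) powr (- 5 / 4)) summable_on UNIV"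
    by (subst summable_on_UNIV_nonneg_real_iff) auto
  have 1: "(\<lambda>m::int. (\<bar>of_int m\<bar> / 2) powr (- 5 / 4 :: real)) summable_on range int"
    by (subst summable_on_reindex) (use s in \<open>auto simp: o_def\<close>)
  have 2: "(\<lambda>m::int. (\<bar>of_int m\<bar> / 2) powr (- 5 / 4 :: real)) summable_on range (\<lambda>n. - int n)"
    by (subst summable_on_reindex) (use s in \<open>auto simp: o_def inj_on_def\<close>)
  have "range int \<union> range (\<lambda>n. - int n) = UNIV"
    using int_cases2 by (auto simp: image_iff) metis
  then show ?thesis using summable_on_union[OF 1 2] by simp
qed

text \<open>High modes are evanescent: the imaginary part of their wave number is at least |m| / 2,
  uniformly for \<zeta> in the disc. The finitely many others are bounded on the compact disc, and
  |z| <= L lets that constant be rewritten as a multiple of |z|^(-1/4).\<close>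

lemma mode_term_bound:
  assumes \<delta>: "cball z0 \<delta> \<subseteq> cut_plane kx" and L: "L \<ge> 0"
  obtains B :: "int \<Rightarrow> real" where "B summable_on UNIV"
    "\<And>m z r. z \<in> cball z0 \<delta> \<Longrightarrow> snd r \<noteq> 0 \<Longrightarrow> \<bar>snd r\<bar> \<le> L \<Longrightarrow>
       cmod (mode_term kx m z r) \<le> B m * \<bar>snd r\<bar> powr (- 1 / 4)"
proof -
  define R where "R = cmod z0 + \<delta>"
  \<comment> \<open>For |m| >= N the term |kx| gives |k_m| >= 2 pi |m| - |kx| >= |m|, and 2 |R| + 1
    gives 2 R <= m^2. Then Re \<zeta> - k_m^2 <= - m^2 / 2 <= - (|m| / 2)^2.\<close>
  define N where "N = nat \<lceil>\<bar>kx\<bar> + 2 * \<bar>R\<bar> + 1\<rceil>"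
  have N: "real N \<ge> \<bar>kx\<bar>" "real N \<ge> 2 * \<bar>R\<bar> + 1"
  proof -
    have "\<bar>kx\<bar> + 2 * \<bar>R\<bar> + 1 \<le> real N" unfolding N_def by (rule real_nat_ceiling_ge)
    then show "real N \<ge> \<bar>kx\<bar>" "real N \<ge> 2 * \<bar>R\<bar> + 1" by linarith+
  qed
  have large: "cmod (mode_term kx m z r) \<le> (\<bar>of_int m\<bar> / 2) powr (- 5 / 4) * \<bar>snd r\<bar> powr (- 1 / 4)"
    if m: "\<not> \<bar>m\<bar> < int N" and z: "z \<in> cball z0 \<delta>" "snd r \<noteq> 0" for m z r
  proof -
    define M where "M = \<bar>real_of_int m\<bar>"
    have M: "M \<ge> real N" "M > 0" using m N by (auto simp: M_def)
    have "2 * pi * M \<le> \<bar>k_mode kx m\<bar> + \<bar>kx\<bar>"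
      unfolding k_mode_def M_def using abs_triangle_ineq4[of "kx + 2 * pi * of_int m" kx] by (simp add: abs_mult)
    moreover have "2 * M \<le> 2 * pi * M" using pi_ge_two M by simp
    ultimately have "M \<le> \<bar>k_mode kx m\<bar>" using M N by linarith
    then have k: "M\<^sup>2 \<le> (k_mode kx m)\<^sup>2" using M by (metis abs_le_square_iff abs_of_pos)
    have "Re z \<le> R" using z complex_Re_le_cmod[of z] norm_triangle_sub[of z z0]
      by (simp add: R_def dist_norm norm_minus_commute)
    moreover have "2 * R \<le> M\<^sup>2"
    proof -
      have "2 * R \<le> M" "1 \<le> M" using N M by linarith+
      then have "2 * R \<le> M * 1" "M * 1 \<le> M * M" using M by (auto intro: mult_left_mono)
      then show ?thesis by (simp add: power2_eq_square)
    qed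
    ultimately have "Re (z - of_real ((k_mode kx m)\<^sup>2)) \<le> - (M / 2)\<^sup>2"
    proof -
      have "(M / 2)\<^sup>2 = M\<^sup>2 / 4" "0 \<le> M\<^sup>2" by (simp_all add: power_divide)
      then show "Re z \<le> R \<Longrightarrow> 2 * R \<le> M\<^sup>2 \<Longrightarrow> Re (z - of_real ((k_mode kx m)\<^sup>2)) \<le> - (M / 2)\<^sup>2"
        using k by (simp only: minus_complex.sel Re_complex_of_real)
    qed
    then have Im: "Im (mode_sqrt kx m z) \<ge> M / 2"
      unfolding mode_sqrt_def using M by (intro sqrt_cut_Im_ge) auto
    then have c: "cmod (mode_sqrt kx m z) \<ge> M / 2"
      using abs_Im_le_cmod[of "mode_sqrt kx m z"] by linarith
    have "cmod (mode_term kx m z r) \<le> exp (- (\<bar>snd r\<bar> * (M / 2))) / (M / 2)"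
      unfolding cmod_mode_term using mult_left_mono[OF Im, of "\<bar>snd r\<bar>"] c M by (intro frac_le) auto
    also have "\<dots> \<le> (\<bar>snd r\<bar> * (M / 2)) powr (- 1 / 4) / (M / 2)"
      using z M by (intro divide_right_mono exp_minus_le_powr) auto
    also have "\<dots> = \<bar>snd r\<bar> powr (- 1 / 4) * ((M / 2) powr (- 1 / 4) * (M / 2) powr (- 1))"
    proof -
      have "(M / 2) powr (- 1) = 1 / (M / 2)" using M by (simp add: powr_minus_divide)
      moreover have "(\<bar>snd r\<bar> * (M / 2)) powr (- 1 / 4) = \<bar>snd r\<bar> powr (- 1 / 4) * (M / 2) powr (- 1 / 4)"
        by (rule powr_mult)
      ultimately show ?thesis by (simp only: times_divide_eq_right mult_1_right mult.assoc)
    qed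
    also have "(M / 2) powr (- 1 / 4) * (M / 2) powr (- 1) = (M / 2) powr (- 5 / 4)"
      unfolding powr_add[symmetric] by (rule arg_cong) simp
    finally show ?thesis by (simp add: M_def mult.commute)
  qed
  have "\<exists>C. \<forall>z\<in>cball z0 \<delta>. exp (L * cmod (mode_sqrt kx m z)) / cmod (mode_sqrt kx m z) \<le> C" for m
  proof -
    have "continuous_on (cball z0 \<delta>) (\<lambda>z. exp (L * cmod (mode_sqrt kx m z)) / cmod (mode_sqrt kx m z))"
    proof (intro continuous_intros holomorphic_on_imp_continuous_on holomorphic_mode_sqrt \<delta>)
      show "\<forall>z\<in>cball z0 \<delta>. cmod (mode_sqrt kx m z) \<noteq> 0"
        using mode_sqrt_nonzero \<delta> unfolding norm_eq_zero by blast
    qed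
    then have "compact ((\<lambda>z. exp (L * cmod (mode_sqrt kx m z)) / cmod (mode_sqrt kx m z)) ` cball z0 \<delta>)"
      by (rule compact_continuous_image) simp
    then have "bdd_above ((\<lambda>z. exp (L * cmod (mode_sqrt kx m z)) / cmod (mode_sqrt kx m z)) ` cball z0 \<delta>)"
      by (intro bounded_imp_bdd_above compact_imp_bounded)
    then show ?thesis by (auto simp: bdd_above_def)
  qed
  then obtain C where C: "\<And>m z. z \<in> cball z0 \<delta> \<Longrightarrow> exp (L * cmod (mode_sqrt kx m z)) / cmod (mode_sqrt kx m z) \<le> C m"
    by metis
  have small: "cmod (mode_term kx m z r) \<le> (C m * (L + 1) powr (1 / 4)) * \<bar>snd r\<bar> powr (- 1 / 4)"
    if z: "z \<in> cball z0 \<delta>" "snd r \<noteq> 0" "\<bar>snd r\<bar> \<le> L" for m z r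
  proof -
    have "- (\<bar>snd r\<bar> * Im (mode_sqrt kx m z)) \<le> \<bar>snd r\<bar> * cmod (mode_sqrt kx m z)"
      using abs_Im_le_cmod[of "mode_sqrt kx m z"] mult_left_mono[of "- Im (mode_sqrt kx m z)" "cmod (mode_sqrt kx m z)" "\<bar>snd r\<bar>"]
      by simp
    also have "\<dots> \<le> L * cmod (mode_sqrt kx m z)" using z by (intro mult_right_mono) auto
    finally have "cmod (mode_term kx m z r) \<le> exp (L * cmod (mode_sqrt kx m z)) / cmod (mode_sqrt kx m z)"
      unfolding cmod_mode_term by (intro divide_right_mono) auto
    also have "\<dots> \<le> C m" by (rule C[OF z(1)])
    finally have le: "cmod (mode_term kx m z r) \<le> C m" .
    have C0: "C m \<ge> 0" using le norm_ge_zero order.trans by blast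
    \<comment> \<open>Since |z| < L + 1, the product (L + 1)^(1/4) |z|^(-1/4) is at least 1 and may
      be multiplied onto a constant bound; the base L + 1 is positive even for L = 0.\<close>
    have "(L + 1) powr (- 1 / 4) \<le> \<bar>snd r\<bar> powr (- 1 / 4)" using z by (intro powr_mono2') auto
    then have "(L + 1) powr (1 / 4) * (L + 1) powr (- 1 / 4) \<le> (L + 1) powr (1 / 4) * \<bar>snd r\<bar> powr (- 1 / 4)"
      by (intro mult_left_mono) auto
    then have "1 \<le> (L + 1) powr (1 / 4) * \<bar>snd r\<bar> powr (- 1 / 4)"
      using L by (simp flip: powr_add)
    then have "C m * 1 \<le> C m * ((L + 1) powr (1 / 4) * \<bar>snd r\<bar> powr (- 1 / 4))"
      using C0 by (intro mult_left_mono) auto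
    then show ?thesis using le by (simp add: mult.assoc)
  qed
  define B where "B m = (if \<bar>m\<bar> < int N then C m * (L + 1) powr (1 / 4) else (\<bar>of_int m\<bar> / 2) powr (- 5 / 4))" for m :: int
  have "B summable_on {m. \<bar>m\<bar> < int N} \<union> {m. \<not> \<bar>m\<bar> < int N}"
  proof (rule summable_on_union)
    have "{m. \<bar>m\<bar> < int N} \<subseteq> {- int N..int N}" by auto
    then have "finite {m. \<bar>m\<bar> < int N}" by (rule finite_subset) simp
    then show "B summable_on {m. \<bar>m\<bar> < int N}" by (rule summable_on_finite)
    have "(\<lambda>m. (\<bar>of_int m\<bar> / 2) powr (- 5 / 4) :: real) summable_on {m. \<not> \<bar>m\<bar> < int N}"
      using summable_int_powr by (rule summable_on_subset_banach) simp
    then show "B summable_on {m. \<not> \<bar>m\<bar> < int N}"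
      by (subst summable_on_cong[of _ B "\<lambda>m. (\<bar>of_int m\<bar> / 2) powr (- 5 / 4)"]) (simp_all add: B_def)
  qed
  moreover have "{m. \<bar>m\<bar> < int N} \<union> {m. \<not> \<bar>m\<bar> < int N} = UNIV" by auto
  ultimately have "B summable_on UNIV" by simp
  then show thesis using that[of B] large small by (simp add: B_def)
qed

lemma mode_term_summable:
  assumes z: "z \<in> cut_plane kx" and r: "snd r \<noteq> 0"
  shows "(\<lambda>m. mode_term kx m z r) summable_on UNIV"
proof -
  \<comment> \<open>A disc of radius 0 specialises the locally uniform majorant to a single
    \<zeta>.\<close>
  have "cball z 0 \<subseteq> cut_plane kx" using z by simp
  obtain B where B: "B summable_on (UNIV :: int set)"
    "\<And>m. cmod (mode_term kx m z r) \<le> B m * \<bar>snd r\<bar> powr (- 1 / 4)"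
  proof (rule mode_term_bound[OF \<open>cball z 0 \<subseteq> _\<close> abs_ge_zero])
    fix B assume "B summable_on (UNIV :: int set)" "\<And>m z' ra. z' \<in> cball z 0 \<Longrightarrow> snd ra \<noteq> 0 \<Longrightarrow>
      \<bar>snd ra\<bar> \<le> \<bar>snd r\<bar> \<Longrightarrow> cmod (mode_term kx m z' ra) \<le> B m * \<bar>snd ra\<bar> powr (- 1 / 4)"
    then show thesis using that r by simp
  qed
  have "(\<lambda>m. B m * \<bar>snd r\<bar> powr (- 1 / 4)) summable_on UNIV" by (rule summable_on_cmult_left[OF B(1)])
  then have "(\<lambda>m. norm (mode_term kx m z r)) summable_on UNIV"
    by (rule Infinite_Sum.abs_summable_on_comparison_test') (rule B(2))
  then show ?thesis by (rule abs_summable_summable)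
qed

lemma H_kernel_bound:
  assumes \<delta>: "cball z0 \<delta> \<subseteq> cut_plane kx" and L: "L \<ge> 0"
  obtains C where "C \<ge> 0" "\<And>z r. z \<in> cball z0 \<delta> \<Longrightarrow> snd r \<noteq> 0 \<Longrightarrow> \<bar>snd r\<bar> \<le> L \<Longrightarrow>
       cmod (H_kernel kx z r) \<le> C * \<bar>snd r\<bar> powr (- 1 / 4)"
proof -
  obtain B where B: "B summable_on (UNIV :: int set)"
    "\<And>m z r. z \<in> cball z0 \<delta> \<Longrightarrow> snd r \<noteq> 0 \<Longrightarrow> \<bar>snd r\<bar> \<le> L \<Longrightarrow>
       cmod (mode_term kx m z r) \<le> B m * \<bar>snd r\<bar> powr (- 1 / 4)"
    using mode_term_bound[OF assms] by blast
  define C where "C = (cmod z0 + \<bar>\<delta>\<bar>) / 2 * \<bar>infsum B UNIV\<bar>"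
  show thesis
  proof (rule that[of C])
    show "C \<ge> 0" by (simp add: C_def)
    fix z and r :: "real \<times> real" assume a: "z \<in> cball z0 \<delta>" "snd r \<noteq> 0" "\<bar>snd r\<bar> \<le> L"
    have s: "(\<lambda>m. B m * \<bar>snd r\<bar> powr (- 1 / 4)) summable_on UNIV" by (rule summable_on_cmult_left[OF B(1)])
    have z: "z \<in> cut_plane kx" using a \<delta> by blast
    have "cmod (\<Sum>\<^sub>\<infinity>m. mode_term kx m z r) \<le> (\<Sum>\<^sub>\<infinity>m. B m * \<bar>snd r\<bar> powr (- 1 / 4))"
      by (rule norm_infsum_le[OF has_sum_infsum[OF mode_term_summable[OF z a(2)]] has_sum_infsum[OF s]])
         (use B(2)[OF a] in auto)
    also have "\<dots> = infsum B UNIV * \<bar>snd r\<bar> powr (- 1 / 4)" by (rule infsum_cmult_left) (use B in auto)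
    also have "\<dots> \<le> \<bar>infsum B UNIV\<bar> * \<bar>snd r\<bar> powr (- 1 / 4)" by (intro mult_right_mono) auto
    finally have 1: "cmod (\<Sum>\<^sub>\<infinity>m. mode_term kx m z r) \<le> \<bar>infsum B UNIV\<bar> * \<bar>snd r\<bar> powr (- 1 / 4)" .
    have 2: "cmod z / 2 \<le> (cmod z0 + \<bar>\<delta>\<bar>) / 2"
      using a(1) norm_triangle_sub[of z z0] by (simp add: dist_norm norm_minus_commute)
    show "cmod (H_kernel kx z r) \<le> C * \<bar>snd r\<bar> powr (- 1 / 4)"
      using mult_mono[OF 2 1] by (simp add: H_kernel_eq norm_mult norm_divide C_def mult.assoc)
  qed
qed

text \<open>The majorant of the modes is independent of \<zeta> in the disc, so the finite sums
  converge uniformly by the Weierstrass test and holomorphy survives.\<close>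

lemma holomorphic_H_kernel:
  assumes \<delta>: "cball z0 \<delta> \<subseteq> cut_plane kx" and r: "snd r \<noteq> 0"
  shows "(\<lambda>z. H_kernel kx z r) holomorphic_on ball z0 \<delta>"
proof -
  obtain B where B: "B summable_on (UNIV :: int set)"
    "\<And>m z. z \<in> cball z0 \<delta> \<Longrightarrow> cmod (mode_term kx m z r) \<le> B m * \<bar>snd r\<bar> powr (- 1 / 4)"
  proof (rule mode_term_bound[OF \<delta> abs_ge_zero])
    fix B assume "B summable_on (UNIV :: int set)" "\<And>m z ra. z \<in> cball z0 \<delta> \<Longrightarrow> snd ra \<noteq> 0 \<Longrightarrow>
      \<bar>snd ra\<bar> \<le> \<bar>snd r\<bar> \<Longrightarrow> cmod (mode_term kx m z ra) \<le> B m * \<bar>snd ra\<bar> powr (- 1 / 4)"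
    then show thesis using that r by blast
  qed
  have s: "(\<lambda>m. B m * \<bar>snd r\<bar> powr (- 1 / 4)) summable_on UNIV" by (rule summable_on_cmult_left[OF B(1)])
  have lim: "uniform_limit (cball z0 \<delta>) (\<lambda>X z. \<Sum>m\<in>X. mode_term kx m z r) (\<lambda>z. \<Sum>\<^sub>\<infinity>m. mode_term kx m z r)
      (finite_subsets_at_top UNIV)"
    by (rule Weierstrass_m_test_general[OF _ s]) (use B(2) in auto)
  have hol: "(\<lambda>z. \<Sum>m\<in>X. mode_term kx m z r) holomorphic_on cball z0 \<delta>" for X
    by (intro holomorphic_intros holomorphic_mode_term \<delta>)
  have "(\<lambda>z. \<Sum>\<^sub>\<infinity>m. mode_term kx m z r) holomorphic_on ball z0 \<delta>"
  proof (rule holomorphic_uniform_limit[OF _ lim])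
    show "\<forall>\<^sub>F X in finite_subsets_at_top UNIV. continuous_on (cball z0 \<delta>) (\<lambda>z. \<Sum>m\<in>X. mode_term kx m z r) \<and>
        (\<lambda>z. \<Sum>m\<in>X. mode_term kx m z r) holomorphic_on ball z0 \<delta>"
      using hol holomorphic_on_imp_continuous_on holomorphic_on_subset[OF hol ball_subset_cball] by (intro always_eventually) blast
  qed auto
  then show ?thesis unfolding H_kernel_eq by (intro holomorphic_intros) auto
qed

text \<open>\<open>infsum\<close> is a limit along finite sets, through which measurability does not
  pass directly; symmetric partial sums give a sequence with the same limit. On the line
  \<open>snd r = 0\<close>, where convergence is not ensured, the value is set to 0, which affects
  only a null set.\<close>

lemma measurable_H_kernel:
  assumes z: "z \<in> cut_plane kx"
  shows "(\<lambda>r. if snd r = 0 then 0 else H_kernel kx z r) \<in> borel_measurable borel"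
proof (rule borel_measurable_LIMSEQ_metric)
  show "(\<lambda>r. if snd r = 0 then 0 else \<i> * z / 2 * (\<Sum>m\<in>{- int n..int n}. mode_term kx m z r)) \<in> borel_measurable borel" for n
  proof (rule measurable_If)
    have "continuous_on UNIV (\<lambda>r. \<i> * z / 2 * (\<Sum>m\<in>{- int n..int n}. mode_term kx m z r))"
      unfolding mode_term_def using mode_sqrt_nonzero[OF z] by (intro continuous_intros) auto
    then show "(\<lambda>r. \<i> * z / 2 * (\<Sum>m\<in>{- int n..int n}. mode_term kx m z r)) \<in> borel_measurable borel"
      by (rule borel_measurable_continuous_onI)
    have "closed {r :: real \<times> real. snd r = 0}" by (intro closed_Collect_eq continuous_intros)
    then show "{r \<in> space borel. snd (r :: real \<times> real) = 0} \<in> sets borel" by simp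
  qed simp
  fix r :: "real \<times> real"
  show "(\<lambda>n. if snd r = 0 then 0 else \<i> * z / 2 * (\<Sum>m\<in>{- int n..int n}. mode_term kx m z r)) \<longlonglongrightarrow>
    (if snd r = 0 then 0 else H_kernel kx z r)"
  proof (cases "snd r = 0")
    case False
    have "filterlim (\<lambda>n. {- int n..int n}) (finite_subsets_at_top UNIV) sequentially"
      unfolding filterlim_finite_subsets_at_top
    proof (intro allI impI)
      fix X :: "int set" assume X: "finite X \<and> X \<subseteq> UNIV"
      then obtain b where b: "\<And>x. x \<in> X \<Longrightarrow> \<bar>x\<bar> \<le> b"
        using bdd_above_finite[of "abs ` X"] by (auto simp: bdd_above_def)
      show "\<forall>\<^sub>F n in sequentially. finite {- int n..int n} \<and> X \<subseteq> {- int n..int n} \<and> {- int n..int n} \<subseteq> UNIV"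
        by (rule eventually_sequentiallyI[of "nat b"]) (use b in \<open>fastforce dest: b\<close>)
    qed
    moreover have "((\<lambda>X. \<Sum>m\<in>X. mode_term kx m z r) \<longlongrightarrow> (\<Sum>\<^sub>\<infinity>m. mode_term kx m z r)) (finite_subsets_at_top UNIV)"
      using has_sum_infsum[OF mode_term_summable[OF z False]] by (simp add: has_sum_def)
    ultimately have "(\<lambda>n. \<Sum>m\<in>{- int n..int n}. mode_term kx m z r) \<longlonglongrightarrow> (\<Sum>\<^sub>\<infinity>m. mode_term kx m z r)"
      by (rule filterlim_compose[rotated])
    then have "(\<lambda>n. \<i> * z / 2 * (\<Sum>m\<in>{- int n..int n}. mode_term kx m z r)) \<longlonglongrightarrow> H_kernel kx z r"
      unfolding H_kernel_eq by (intro tendsto_mult tendsto_const)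
    then show ?thesis using False by simp
  qed simp
qed

section \<open>The integral operator\<close>

text \<open>Joint measurability in both variables is argued on the Borel product, so Lebesgue
  measurable data are first replaced by Borel versions.\<close>

lemma lebesgue_ex_borel_complex:
  fixes f :: "'a::euclidean_space \<Rightarrow> complex"
  assumes f: "f \<in> borel_measurable lebesgue"
  obtains f' where "f' \<in> borel_measurable borel" "AE x in lebesgue. f x = f' x"
proof -
  have "(\<lambda>x. Re (f x)) \<in> borel_measurable lebesgue" "(\<lambda>x. Im (f x)) \<in> borel_measurable lebesgue"
    using f by simp_all
  from this[THEN completion_ex_borel_measurable_real]
  obtain g h where g: "g \<in> borel_measurable lborel" "AE x in lborel. Re (f x) = g x"
    and h: "h \<in> borel_measurable lborel" "AE x in lborel. Im (f x) = h x"
    by blast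
  have [measurable]: "g \<in> borel_measurable borel" "h \<in> borel_measurable borel" using g h by simp_all
  have "AE x in lebesgue. f x = of_real (g x) + \<i> * of_real (h x)"
    using AE_completion[OF g(2)] AE_completion[OF h(2)] by eventually_elim (simp add: complex_eq_iff)
  moreover have "(\<lambda>x. of_real (g x) + \<i> * of_real (h x) :: complex) \<in> borel_measurable borel"
    by measurable
  ultimately show thesis using that by blast
qed

text \<open>Split at the singularity t = z: each side is at most the integral of t^(-1/2) over an
  interval of length |b - a| starting at 0, whatever z is. The power -1/2 is the square of the
  kernel bound.\<close>

lemma nn_integral_inverse_sqrt_finite:
  fixes a b :: real
  obtains K :: real where "K \<ge> 0"
    "\<And>z. z \<in> {a..b} \<Longrightarrow> (\<integral>\<^sup>+t. indicator {a..b} t * ennreal (\<bar>z - t\<bar> powr (- 1 / 2)) \<partial>lborel) \<le> ennreal K"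
proof -
  define L where "L = \<bar>b - a\<bar>"
  define g where "g t = indicator {0..L} t * ennreal (\<bar>t\<bar> powr (- 1 / 2))" for t :: real
  have [measurable]: "g \<in> borel_measurable borel" unfolding g_def by measurable
  define I where "I = L powr (- 1 / 2 + 1) / (- 1 / 2 + 1)"
  have "((\<lambda>t. t powr (- 1 / 2)) has_integral I) {0..L}"
    unfolding I_def by (rule has_integral_powr_from_0) (auto simp: L_def)
  then have "(\<integral>\<^sup>+t. ennreal (indicator {0..L} t * (t powr (- 1 / 2))) \<partial>lborel) = ennreal I"
    by (intro nn_integral_has_integral_lebesgue) auto
  also have "(\<integral>\<^sup>+t. ennreal (indicator {0..L} t * (t powr (- 1 / 2))) \<partial>lborel) = (\<integral>\<^sup>+t. g t \<partial>lborel)"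
    by (intro nn_integral_cong) (auto simp: g_def indicator_def)
  finally have I: "(\<integral>\<^sup>+t. g t \<partial>lborel) = ennreal I" .
  have I0: "I \<ge> 0" by (simp add: I_def)
  show thesis
  proof (rule that[of "2 * I"])
    fix z assume z: "z \<in> {a..b}"
    have "(\<integral>\<^sup>+t. indicator {a..b} t * ennreal (\<bar>z - t\<bar> powr (- 1 / 2)) \<partial>lborel)
       \<le> (\<integral>\<^sup>+t. g (z + (- 1) * t) + g (- z + 1 * t) \<partial>lborel)"
    proof (intro nn_integral_mono)
      fix t
      show "indicator {a..b} t * ennreal (\<bar>z - t\<bar> powr (- 1 / 2)) \<le> g (z + (- 1) * t) + g (- z + 1 * t)"
        using z by (cases "t \<le> z") (auto simp: g_def indicator_def L_def abs_minus_commute)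
    qed
    also have "\<dots> = (\<integral>\<^sup>+t. g (z + (- 1) * t) \<partial>lborel) + (\<integral>\<^sup>+t. g (- z + 1 * t) \<partial>lborel)"
      by (intro nn_integral_add) measurable
    also have "(\<integral>\<^sup>+t. g (z + (- 1) * t) \<partial>lborel) = ennreal I"
      using nn_integral_real_affine[of g "-1" z] I by simp
    also have "(\<integral>\<^sup>+t. g (- z + 1 * t) \<partial>lborel) = ennreal I"
      using nn_integral_real_affine[of g 1 "- z"] I by simp
    also have "ennreal I + ennreal I = ennreal (2 * I)" using I0 by (simp flip: ennreal_plus)
    finally show "(\<integral>\<^sup>+t. indicator {a..b} t * ennreal (\<bar>z - t\<bar> powr (- 1 / 2)) \<partial>lborel) \<le> ennreal (2 * I)" .
  qed (use I0 in simp)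
qed

text \<open>A majorant, up to a constant, of the integral kernel that is free of \<zeta> and
  \<epsilon>.\<close>

definition dom_kernel :: "real \<Rightarrow> real \<Rightarrow> real \<times> real \<Rightarrow> real \<times> real \<Rightarrow> real" where
  "dom_kernel zm zp r r0 = indicator (rect zm zp) r0 * \<bar>snd r - snd r0\<bar> powr (- 1 / 4)"

lemma dom_kernel_nonneg: "dom_kernel zm zp r r0 \<ge> 0" by (simp add: dom_kernel_def)

lemma rect_borel: "rect zm zp \<in> sets borel"
proof -
  have "closed (rect zm zp)" unfolding rect_def by (intro closed_Times) auto
  then show ?thesis by simp
qed

lemma rect_lebesgue: "rect zm zp \<in> sets lebesgue"
  by (rule sets_completionI_sets) (simp add: rect_borel)

lemma measurable_dom_kernel [measurable]: "dom_kernel zm zp r \<in> borel_measurable borel"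
proof -
  have [measurable]: "rect zm zp \<in> sets borel" by (rule rect_borel)
  have [measurable]: "(\<lambda>r0 :: real \<times> real. \<bar>snd r - snd r0\<bar>) \<in> borel_measurable borel"
    by (intro borel_measurable_continuous_onI continuous_intros)
  show ?thesis unfolding dom_kernel_def by measurable
qed

lemma dom_kernel_sq_bound:
  obtains K :: real where "K \<ge> 0"
    "\<And>r. r \<in> rect zm zp \<Longrightarrow> (\<integral>\<^sup>+r0. ennreal (dom_kernel zm zp r r0) ^ 2 \<partial>lebesgue) \<le> ennreal K"
proof -
  obtain K where K: "K \<ge> 0"
    "\<And>z. z \<in> {zm..zp} \<Longrightarrow> (\<integral>\<^sup>+t. indicator {zm..zp} t * ennreal (\<bar>z - t\<bar> powr (- 1 / 2)) \<partial>lborel) \<le> ennreal K"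
    using nn_integral_inverse_sqrt_finite[of zm zp] by blast
  show thesis
  proof (rule that[OF K(1)])
    fix r assume "r \<in> rect zm zp"
    then have z: "snd r \<in> {zm..zp}" by (auto simp: rect_def)
    define F where "F r0 = ennreal (dom_kernel zm zp r r0) ^ 2" for r0
    have [measurable]: "F \<in> borel_measurable borel" unfolding F_def by measurable
    have Fm: "F \<in> borel_measurable (borel \<Otimes>\<^sub>M lborel)"
      by (subst measurable_cong_sets[OF sets_pair_measure_cong[OF refl sets_lborel] refl]) (simp add: borel_prod)
    have eq: "F (x, t) = indicator {0..1} x * (indicator {zm..zp} t * ennreal (\<bar>snd r - t\<bar> powr (- 1 / 2)))" for x t
    proof -
      have "(\<bar>snd r - t\<bar> powr (- 1 / 4))\<^sup>2 = \<bar>snd r - t\<bar> powr (- 1 / 2)"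
        by (simp add: power2_eq_square flip: powr_add)
      then show ?thesis
        by (auto simp: F_def dom_kernel_def indicator_def rect_def ennreal_power)
    qed
    have "(\<integral>\<^sup>+r0. F r0 \<partial>lebesgue) = (\<integral>\<^sup>+r0. F r0 \<partial>(lborel \<Otimes>\<^sub>M lborel))"
      by (simp add: nn_integral_completion lborel_prod)
    also have "\<dots> = (\<integral>\<^sup>+x. \<integral>\<^sup>+t. F (x, t) \<partial>lborel \<partial>lborel)"
      by (rule lborel.nn_integral_fst[symmetric]) (simp add: lborel_prod)
    also have "\<dots> \<le> (\<integral>\<^sup>+x. ennreal K * indicator {0..1::real} x \<partial>lborel)"
    proof (intro nn_integral_mono)
      fix x :: real
      show "(\<integral>\<^sup>+t. F (x, t) \<partial>lborel) \<le> ennreal K * indicator {0..1} x"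
        using K(2)[OF z] by (cases "x \<in> {0..1}") (simp_all add: eq)
    qed
    also have "\<dots> = ennreal K" by (simp add: nn_integral_cmult)
    finally show "(\<integral>\<^sup>+r0. ennreal (dom_kernel zm zp r r0) ^ 2 \<partial>lebesgue) \<le> ennreal K" by (simp add: F_def)
  qed
qed

text \<open>Cauchy-Schwarz in \<open>r0\<close>. It applies at every \<open>r\<close> of the
  rectangle, not only at almost every one, which allows \<open>H_fun\<close> to be treated
  pointwise.\<close>

lemma dom_kernel_integrable:
  obtains K :: real where "K \<ge> 0"
    "\<And>r E. r \<in> rect zm zp \<Longrightarrow> integrable lebesgue (\<lambda>r0. dom_kernel zm zp r r0 * cmod (rep_L2 E r0))"
    "\<And>r E. r \<in> rect zm zp \<Longrightarrow> (\<integral>r0. dom_kernel zm zp r r0 * cmod (rep_L2 E r0) \<partial>lebesgue) \<le> K * norm E"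
proof -
  obtain K where K: "K \<ge> 0"
    "\<And>r. r \<in> rect zm zp \<Longrightarrow> (\<integral>\<^sup>+r0. ennreal (dom_kernel zm zp r r0) ^ 2 \<partial>lebesgue) \<le> ennreal K"
    using dom_kernel_sq_bound[of zm zp] by blast
  have nn: "(\<integral>\<^sup>+r0. ennreal (dom_kernel zm zp r r0 * cmod (rep_L2 E r0)) \<partial>lebesgue) \<le> ennreal (sqrt K * norm E)"
    (is "?I \<le> _") if r: "r \<in> rect zm zp" for r and E :: "(real \<times> real) L2"
  proof -
    have [measurable]: "rep_L2 E \<in> borel_measurable lebesgue" by (rule borel_measurable_rep)
    have [measurable]: "dom_kernel zm zp r \<in> borel_measurable lebesgue" by (intro measurable_completion) simp
    have "?I\<^sup>2 = (\<integral>\<^sup>+r0. ennreal (dom_kernel zm zp r r0) * ennreal (cmod (rep_L2 E r0)) \<partial>lebesgue)\<^sup>2"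
      by (simp add: ennreal_mult dom_kernel_nonneg)
    also have "\<dots> \<le> (\<integral>\<^sup>+r0. ennreal (dom_kernel zm zp r r0) ^ 2 \<partial>lebesgue) * (\<integral>\<^sup>+r0. ennreal (cmod (rep_L2 E r0)) ^ 2 \<partial>lebesgue)"
      by (rule Cauchy_Schwarz_nn_integral) measurable
    also have "(\<integral>\<^sup>+r0. ennreal (cmod (rep_L2 E r0)) ^ 2 \<partial>lebesgue) = ennreal ((norm E)\<^sup>2)"
      unfolding nn_norm_L2_sq[symmetric] by (simp add: ennreal_power)
    also have "(\<integral>\<^sup>+r0. ennreal (dom_kernel zm zp r r0) ^ 2 \<partial>lebesgue) * ennreal ((norm E)\<^sup>2) \<le> ennreal K * ennreal ((norm E)\<^sup>2)"
      by (intro mult_right_mono K r) simp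
    also have "\<dots> = (ennreal (sqrt K * norm E))\<^sup>2"
      using K(1) by (simp add: ennreal_power power_mult_distrib flip: ennreal_mult)
    finally have sq: "?I\<^sup>2 \<le> (ennreal (sqrt K * norm E))\<^sup>2" .
    show ?thesis
    proof (cases ?I rule: ennreal_cases)
      case (real i)
      have "i\<^sup>2 \<le> (sqrt K * norm E)\<^sup>2" using sq real K(1) by (simp add: ennreal_power)
      then have "i \<le> sqrt K * norm E" by (rule power2_le_imp_le) (use K(1) in simp)
      then show ?thesis unfolding real(2) by (rule ennreal_leI)
    next
      case top
      then show ?thesis using sq K(1) by (simp add: ennreal_power power2_eq_square[of top] top_unique)
    qed
  qed
  show thesis
  proof (rule that[of "sqrt K"])
    fix r and E :: "(real \<times> real) L2" assume r: "r \<in> rect zm zp"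
    have [measurable]: "rep_L2 E \<in> borel_measurable lebesgue" by (rule borel_measurable_rep)
    have [measurable]: "dom_kernel zm zp r \<in> borel_measurable lebesgue" by (intro measurable_completion) simp
    show i: "integrable lebesgue (\<lambda>r0. dom_kernel zm zp r r0 * cmod (rep_L2 E r0))"
      using nn[OF r, of E] by (intro integrableI_bounded) (auto simp: abs_mult dom_kernel_nonneg less_top[symmetric] top_unique)
    show "(\<integral>r0. dom_kernel zm zp r r0 * cmod (rep_L2 E r0) \<partial>lebesgue) \<le> sqrt K * norm E"
      using nn[OF r, of E] nn_integral_eq_integral[OF i] K(1) by (simp add: dom_kernel_nonneg)
  qed (use K(1) in simp)
qed

section \<open>The integrand of the operator and its measurability\<close>

lemma AE_snd_neq: "AE r0 in lebesgue. snd (r0 :: real \<times> real) \<noteq> c"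
proof -
  have "(0, 1) \<in> (Basis :: (real \<times> real) set)" by (simp add: Basis_prod_def)
  then have "negligible {r0 :: real \<times> real. r0 \<bullet> (0, 1) = c}" by (rule negligible_standard_hyperplane)
  moreover have "{r0 :: real \<times> real. r0 \<bullet> (0, 1) = c} = {r0. snd r0 = c}" by (auto simp: inner_prod_def)
  ultimately have "{r0 :: real \<times> real. snd r0 = c} \<in> null_sets lebesgue" by (simp add: negligible_iff_null_sets)
  then show ?thesis by (rule AE_I') auto
qed

definition H_integrand :: "real \<Rightarrow> (real \<times> real) set \<Rightarrow> (real \<times> real \<Rightarrow> real) \<Rightarrow> complex \<Rightarrow>
    (real \<times> real \<Rightarrow> complex) \<Rightarrow> real \<times> real \<Rightarrow> real \<times> real \<Rightarrow> complex" where
  "H_integrand kx D \<epsilon> z f r r0 = indicator D r0 *\<^sub>R (of_real (\<epsilon> r0 - 1) * H_kernel kx z (r - r0) * f r0)"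

lemma H_fun_eq: "H_fun kx D \<epsilon> z f r = (if r \<in> D then \<integral>r0. H_integrand kx D \<epsilon> z f r r0 \<partial>lebesgue else 0)"
  by (simp add: H_fun_def set_lebesgue_integral_def H_integrand_def)

lemma measurable_H_integrand:
  assumes z: "z \<in> cut_plane kx" and \<epsilon>: "\<epsilon> \<in> borel_measurable lebesgue" and f: "f \<in> borel_measurable lebesgue"
  shows "H_integrand kx (rect zm zp) \<epsilon> z f r \<in> borel_measurable lebesgue"
proof (rule borel_measurable_AE)
  define H where "H r = (if snd r = 0 then 0 else H_kernel kx z r)" for r :: "real \<times> real"
  have [measurable]: "H \<in> borel_measurable borel" unfolding H_def by (rule measurable_H_kernel[OF z])
  have [measurable]: "(\<lambda>r0. r - r0) \<in> borel_measurable borel" by (intro borel_measurable_continuous_onI continuous_intros)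
  have [measurable]: "(\<lambda>r0. H (r - r0)) \<in> borel_measurable lebesgue"
    by (rule measurable_completion) simp
  note [measurable] = \<epsilon> f rect_lebesgue[of zm zp]
  show "(\<lambda>r0. indicator (rect zm zp) r0 *\<^sub>R (of_real (\<epsilon> r0 - 1) * H (r - r0) * f r0)) \<in> borel_measurable lebesgue"
    by measurable
  show "AE r0 in lebesgue. indicator (rect zm zp) r0 *\<^sub>R (of_real (\<epsilon> r0 - 1) * H (r - r0) * f r0) =
     H_integrand kx (rect zm zp) \<epsilon> z f r r0"
    using AE_snd_neq[of "snd r"] by eventually_elim (simp add: H_def H_integrand_def)
qed

lemma H_integrand_bound:
  assumes \<delta>: "cball z0 \<delta> \<subseteq> cut_plane kx" and M: "\<And>r. \<bar>\<epsilon> r - 1\<bar> \<le> M"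
  obtains C where "C \<ge> 0"
    "\<And>z r r0 f. z \<in> cball z0 \<delta> \<Longrightarrow> r \<in> rect zm zp \<Longrightarrow> snd r0 \<noteq> snd r \<Longrightarrow>
       cmod (H_integrand kx (rect zm zp) \<epsilon> z f r r0) \<le> C * (dom_kernel zm zp r r0 * cmod (f r0))"
proof -
  obtain C where C: "C \<ge> 0" "\<And>z r. z \<in> cball z0 \<delta> \<Longrightarrow> snd r \<noteq> 0 \<Longrightarrow> \<bar>snd r\<bar> \<le> \<bar>zp - zm\<bar> \<Longrightarrow>
       cmod (H_kernel kx z r) \<le> C * \<bar>snd r\<bar> powr (- 1 / 4)"
    using H_kernel_bound[OF \<delta> abs_ge_zero] by metis
  have M0: "M \<ge> 0" using M[of 0] by linarith
  show thesis
  proof (rule that[of "M * C"])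
    fix z and r r0 :: "real \<times> real" and f :: "real \<times> real \<Rightarrow> complex"
    assume a: "z \<in> cball z0 \<delta>" "r \<in> rect zm zp" "snd r0 \<noteq> snd r"
    show "cmod (H_integrand kx (rect zm zp) \<epsilon> z f r r0) \<le> M * C * (dom_kernel zm zp r r0 * cmod (f r0))"
    proof (cases "r0 \<in> rect zm zp")
      case True
      have "\<bar>snd (r - r0)\<bar> \<le> \<bar>zp - zm\<bar>" using True a(2) by (auto simp: rect_def)
      then have H: "cmod (H_kernel kx z (r - r0)) \<le> C * \<bar>snd r - snd r0\<bar> powr (- 1 / 4)"
        using C(2)[OF a(1), of "r - r0"] a(3) by simp
      have "cmod (H_integrand kx (rect zm zp) \<epsilon> z f r r0) = \<bar>\<epsilon> r0 - 1\<bar> * cmod (H_kernel kx z (r - r0)) * cmod (f r0)"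
        using True by (simp add: H_integrand_def norm_mult del: of_real_diff)
      also have "\<dots> \<le> M * (C * \<bar>snd r - snd r0\<bar> powr (- 1 / 4)) * cmod (f r0)"
        using M M0 H by (intro mult_right_mono mult_mono) auto
      finally show ?thesis using True by (simp add: dom_kernel_def mult_ac)
    qed (simp add: H_integrand_def dom_kernel_def)
  qed (use M0 C in simp)
qed

lemma H_fun_integrable:
  assumes \<delta>: "cball z0 \<delta> \<subseteq> cut_plane kx" and \<epsilon>: "\<epsilon> \<in> borel_measurable lebesgue" and M: "\<And>r. \<bar>\<epsilon> r - 1\<bar> \<le> M"
  obtains C where "C \<ge> 0"
    "\<And>z r E. z \<in> cball z0 \<delta> \<Longrightarrow> r \<in> rect zm zp \<Longrightarrow> integrable lebesgue (H_integrand kx (rect zm zp) \<epsilon> z (rep_L2 E) r)"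
    "\<And>z r E. z \<in> cball z0 \<delta> \<Longrightarrow> cmod (H_fun kx (rect zm zp) \<epsilon> z (rep_L2 E) r) \<le> indicator (rect zm zp) r * (C * norm E)"
proof -
  obtain K where K: "K \<ge> 0"
    "\<And>r E. r \<in> rect zm zp \<Longrightarrow> integrable lebesgue (\<lambda>r0. dom_kernel zm zp r r0 * cmod (rep_L2 E r0))"
    "\<And>r E. r \<in> rect zm zp \<Longrightarrow> (\<integral>r0. dom_kernel zm zp r r0 * cmod (rep_L2 E r0) \<partial>lebesgue) \<le> K * norm E"
    using dom_kernel_integrable[of zm zp] by blast
  obtain C where C: "C \<ge> 0"
    "\<And>z r r0 f. z \<in> cball z0 \<delta> \<Longrightarrow> r \<in> rect zm zp \<Longrightarrow> snd r0 \<noteq> snd r \<Longrightarrow>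
       cmod (H_integrand kx (rect zm zp) \<epsilon> z f r r0) \<le> C * (dom_kernel zm zp r r0 * cmod (f r0))"
  proof (rule H_integrand_bound[OF \<delta> M, where zm = zm and zp = zp])
  qed (rule that)
  have ae: "AE r0 in lebesgue. cmod (H_integrand kx (rect zm zp) \<epsilon> z (rep_L2 E) r r0) \<le> C * (dom_kernel zm zp r r0 * cmod (rep_L2 E r0))"
    if "z \<in> cball z0 \<delta>" "r \<in> rect zm zp" for z r E
    using AE_snd_neq[of "snd r"] by eventually_elim (rule C(2)[OF that])
  have i: "integrable lebesgue (H_integrand kx (rect zm zp) \<epsilon> z (rep_L2 E) r)"
    if a: "z \<in> cball z0 \<delta>" "r \<in> rect zm zp" for z r E
  proof (rule Bochner_Integration.integrable_bound)
    show "integrable lebesgue (\<lambda>r0. C * (dom_kernel zm zp r r0 * cmod (rep_L2 E r0)))"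
      using K(2)[OF a(2)] by simp
    show "H_integrand kx (rect zm zp) \<epsilon> z (rep_L2 E) r \<in> borel_measurable lebesgue"
      using a \<delta> by (intro measurable_H_integrand \<epsilon> borel_measurable_rep) auto
    show "AE r0 in lebesgue. norm (H_integrand kx (rect zm zp) \<epsilon> z (rep_L2 E) r r0) \<le> norm (C * (dom_kernel zm zp r r0 * cmod (rep_L2 E r0)))"
      using ae[OF a, of E] by eventually_elim (simp add: C(1) dom_kernel_nonneg abs_mult)
  qed
  show thesis
  proof (rule that[of "C * K"])
    fix z r E assume a: "z \<in> cball z0 \<delta>"
    show "cmod (H_fun kx (rect zm zp) \<epsilon> z (rep_L2 E) r) \<le> indicator (rect zm zp) r * (C * K * norm E)"
    proof (cases "r \<in> rect zm zp")
      case True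
      have "cmod (\<integral>r0. H_integrand kx (rect zm zp) \<epsilon> z (rep_L2 E) r r0 \<partial>lebesgue) \<le>
        (\<integral>r0. cmod (H_integrand kx (rect zm zp) \<epsilon> z (rep_L2 E) r r0) \<partial>lebesgue)"
        by (rule integral_norm_bound)
      also have "\<dots> \<le> (\<integral>r0. C * (dom_kernel zm zp r r0 * cmod (rep_L2 E r0)) \<partial>lebesgue)"
        using i[OF a True] K(2)[OF True] ae[OF a True] by (intro integral_mono_AE) auto
      also have "\<dots> = C * (\<integral>r0. dom_kernel zm zp r r0 * cmod (rep_L2 E r0) \<partial>lebesgue)"
        by (rule Bochner_Integration.integral_mult_right_zero)
      also have "\<dots> \<le> C * (K * norm E)" by (intro mult_left_mono K(3) True C(1))
      finally show ?thesis using True by (simp add: H_fun_eq mult.assoc)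
    qed (simp add: H_fun_eq)
  qed (use i K C in auto)
qed

text \<open>With Borel versions of \<epsilon> and \<open>f\<close> the integrand is jointly
  measurable, hence so is its partial integral. For each fixed \<open>r\<close> the replacement
  alters the integrand on a null set of \<open>r0\<close> only, so the integrals agree at every
  \<open>r\<close>.\<close>

lemma measurable_H_fun:
  assumes z: "z \<in> cut_plane kx" and \<epsilon>: "\<epsilon> \<in> borel_measurable lebesgue" and f: "f \<in> borel_measurable lebesgue"
  shows "H_fun kx (rect zm zp) \<epsilon> z f \<in> borel_measurable lebesgue"
proof -
  define D where "D = rect zm zp"
  have [measurable]: "D \<in> sets borel" unfolding D_def by (rule rect_borel)
  obtain \<epsilon>' where [measurable]: "\<epsilon>' \<in> borel_measurable borel" and ae\<epsilon>: "AE r in lebesgue. \<epsilon> r = \<epsilon>' r"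
    using completion_ex_borel_measurable_real[OF \<epsilon>] AE_completion by auto
  obtain f' where [measurable]: "f' \<in> borel_measurable borel" and aef: "AE r in lebesgue. f r = f' r"
    using lebesgue_ex_borel_complex[OF f] .
  define H where "H r = (if snd r = 0 then 0 else H_kernel kx z r)" for r :: "real \<times> real"
  have [measurable]: "H \<in> borel_measurable borel" unfolding H_def by (rule measurable_H_kernel[OF z])
  define F where "F r r0 = indicator D r0 *\<^sub>R (of_real (\<epsilon>' r0 - 1) * H (r - r0) * f' r0)" for r r0
  have [measurable]: "(\<lambda>p :: (real \<times> real) \<times> (real \<times> real). fst p - snd p) \<in> borel_measurable (borel \<Otimes>\<^sub>M borel)"
    unfolding borel_prod by (intro borel_measurable_continuous_onI continuous_intros)
  have "(\<lambda>p. F (fst p) (snd p)) \<in> borel_measurable (borel \<Otimes>\<^sub>M borel)"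
    unfolding F_def by measurable
  then have "case_prod F \<in> borel_measurable (borel \<Otimes>\<^sub>M lborel)"
    by (subst measurable_cong_sets[OF sets_pair_measure_cong[OF refl sets_lborel] refl]) (simp add: split_beta')
  then have m: "(\<lambda>r. \<integral>r0. F r r0 \<partial>lborel) \<in> borel_measurable borel"
    by (rule lborel.borel_measurable_lebesgue_integral)
  have [measurable]: "(\<lambda>r0. r - r0) \<in> borel_measurable borel" for r :: "real \<times> real"
    by (intro borel_measurable_continuous_onI continuous_intros)
  have Fm: "F r \<in> borel_measurable borel" for r
    unfolding F_def by measurable
  have "(\<integral>r0. H_integrand kx D \<epsilon> z f r r0 \<partial>lebesgue) = (\<integral>r0. F r r0 \<partial>lborel)" for r
  proof -
    have "(\<integral>r0. H_integrand kx D \<epsilon> z f r r0 \<partial>lebesgue) = (\<integral>r0. F r r0 \<partial>lebesgue)"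
    proof (rule integral_cong_AE)
      show "H_integrand kx D \<epsilon> z f r \<in> borel_measurable lebesgue"
        unfolding D_def by (rule measurable_H_integrand[OF assms])
      show "F r \<in> borel_measurable lebesgue" using Fm by (intro measurable_completion) simp
      show "AE r0 in lebesgue. H_integrand kx D \<epsilon> z f r r0 = F r r0"
        using AE_snd_neq[of "snd r"] ae\<epsilon> aef by eventually_elim (simp add: H_integrand_def F_def H_def)
    qed
    also have "\<dots> = (\<integral>r0. F r r0 \<partial>lborel)" using Fm by (intro integral_completion) simp
    finally show ?thesis .
  qed
  then have "H_fun kx D \<epsilon> z f = (\<lambda>r. if r \<in> D then \<integral>r0. F r r0 \<partial>lborel else 0)"
    by (intro ext) (simp add: H_fun_eq)
  moreover have "(\<lambda>r. if r \<in> D then \<integral>r0. F r r0 \<partial>lborel else 0) \<in> borel_measurable borel"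
    using m by measurable
  ultimately have "H_fun kx D \<epsilon> z f \<in> borel_measurable borel" by (simp only:)
  then show ?thesis unfolding D_def by (intro measurable_completion) simp
qed


text \<open>\<open>Blinfun\<close> returns the intended map only once that map is known to be
  bounded and linear. Boundedness comes from the pointwise bound by a multiple of
  \<open>norm E\<close> on the rectangle, which has finite measure.\<close>

lemma H_op_in_L2_ops:
  assumes z: "z \<in> cut_plane kx" and \<epsilon>: "\<epsilon> \<in> borel_measurable lebesgue" and M: "\<And>r. \<bar>\<epsilon> r - 1\<bar> \<le> M"
  shows "AE r in lebesgue. rep_L2 (H_op kx (rect zm zp) \<epsilon> z E) r = H_fun kx (rect zm zp) \<epsilon> z (rep_L2 E) r"
    and "H_op kx (rect zm zp) \<epsilon> z \<in> L2_ops (rect zm zp)"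
proof -
  define D where "D = rect zm zp"
  define h where "h E = H_fun kx D \<epsilon> z (rep_L2 E)" for E
  have z0: "cball z 0 \<subseteq> cut_plane kx" using z by simp
  obtain C where C: "C \<ge> 0"
    "\<And>r E. r \<in> D \<Longrightarrow> integrable lebesgue (H_integrand kx D \<epsilon> z (rep_L2 E) r)"
    "\<And>r E. cmod (h E r) \<le> indicator D r * (C * norm E)"
  proof (rule H_fun_integrable[OF z0 \<epsilon> M, where zm = zm and zp = zp], unfold D_def[symmetric])
    fix C assume "C \<ge> 0" "\<And>z' r E. z' \<in> cball z 0 \<Longrightarrow> r \<in> D \<Longrightarrow> integrable lebesgue (H_integrand kx D \<epsilon> z' (rep_L2 E) r)"
      "\<And>z' r E. z' \<in> cball z 0 \<Longrightarrow> cmod (H_fun kx D \<epsilon> z' (rep_L2 E) r) \<le> indicator D r * (C * norm E)"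
    then show thesis using that[of C] by (simp add: h_def)
  qed
  have hm: "h E \<in> borel_measurable lebesgue" for E
    unfolding h_def D_def by (rule measurable_H_fun[OF z \<epsilon> borel_measurable_rep])
  have Dl: "D \<in> sets lebesgue" unfolding D_def by (rule rect_lebesgue)
  have "bounded D" unfolding D_def rect_def by (intro bounded_Times) auto
  then have fin: "emeasure lebesgue D < \<infinity>"
    using emeasure_bounded_finite rect_borel by (simp add: D_def)
  define m where "m = measure lebesgue D"
  have m: "emeasure lebesgue D = ennreal m" "m \<ge> 0"
    using fin by (auto simp: m_def emeasure_eq_ennreal_measure)
  have nn: "(\<integral>\<^sup>+r. ennreal ((cmod (h E r))\<^sup>2) \<partial>lebesgue) \<le> ennreal ((C * norm E)\<^sup>2 * m)" for E
  proof -
    have "(\<integral>\<^sup>+r. ennreal ((cmod (h E r))\<^sup>2) \<partial>lebesgue) \<le> (\<integral>\<^sup>+r. ennreal ((C * norm E)\<^sup>2) * indicator D r \<partial>lebesgue)"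
    proof (intro nn_integral_mono)
      fix r
      show "ennreal ((cmod (h E r))\<^sup>2) \<le> ennreal ((C * norm E)\<^sup>2) * indicator D r"
        using C(3)[of E r] by (cases "r \<in> D") (auto intro!: ennreal_leI power_mono)
    qed
    also have "\<dots> = ennreal ((C * norm E)\<^sup>2) * ennreal m" using Dl m by (simp add: nn_integral_cmult_indicator)
    finally show ?thesis by (simp add: ennreal_mult m)
  qed
  have sq: "sq_integrable (h E)" for E
    by (rule sq_integrableI_nn[OF hm]) (use nn[of E] in \<open>auto simp: less_top[symmetric] top_unique\<close>)
  have ae: "AE r in lebesgue. rep_L2 (abs_L2 (h E)) r = h E r" for E by (rule rep_abs_L2[OF sq])
  \<comment> \<open>Representatives are linear only almost everywhere, but \<open>h\<close>
    integrates them, so its linearity holds at every \<open>r\<close>.\<close>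
  have hcong: "h G r = a * h E r + b * h F r" if G: "AE r in lebesgue. rep_L2 G r = a * rep_L2 E r + b * rep_L2 F r" for G E F a b r
  proof (cases "r \<in> D")
    case True
    have "(\<integral>r0. H_integrand kx D \<epsilon> z (rep_L2 G) r r0 \<partial>lebesgue) =
      (\<integral>r0. a * H_integrand kx D \<epsilon> z (rep_L2 E) r r0 + b * H_integrand kx D \<epsilon> z (rep_L2 F) r r0 \<partial>lebesgue)"
    proof (rule integral_cong_AE)
      show "H_integrand kx D \<epsilon> z (rep_L2 G) r \<in> borel_measurable lebesgue"
        using C(2)[OF True] by (rule borel_measurable_integrable)
      show "(\<lambda>r0. a * H_integrand kx D \<epsilon> z (rep_L2 E) r r0 + b * H_integrand kx D \<epsilon> z (rep_L2 F) r r0) \<in> borel_measurable lebesgue"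
        by (intro borel_measurable_integrable Bochner_Integration.integrable_add integrable_mult_right C(2) True)
      show "AE r0 in lebesgue. H_integrand kx D \<epsilon> z (rep_L2 G) r r0 =
        a * H_integrand kx D \<epsilon> z (rep_L2 E) r r0 + b * H_integrand kx D \<epsilon> z (rep_L2 F) r r0"
        using G by eventually_elim (simp add: H_integrand_def scaleR_conv_of_real algebra_simps)
    qed
    also have "\<dots> = a * (\<integral>r0. H_integrand kx D \<epsilon> z (rep_L2 E) r r0 \<partial>lebesgue) + b * (\<integral>r0. H_integrand kx D \<epsilon> z (rep_L2 F) r r0 \<partial>lebesgue)"
      by (subst Bochner_Integration.integral_add) (auto intro!: C(2) True)
    finally show ?thesis using True by (simp add: h_def H_fun_eq)
  qed (simp add: h_def H_fun_eq)
  have lin: "abs_L2 (h G) = a *\<^sub>C abs_L2 (h E) + b *\<^sub>C abs_L2 (h F)"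
    if G: "AE r in lebesgue. rep_L2 G r = a * rep_L2 E r + b * rep_L2 F r" for G E F a b
  proof (rule L2_eqI)
    show "AE r in lebesgue. rep_L2 (abs_L2 (h G)) r = rep_L2 (a *\<^sub>C abs_L2 (h E) + b *\<^sub>C abs_L2 (h F)) r"
      using ae[of G] ae[of E] ae[of F] rep_plus_L2[of "a *\<^sub>C abs_L2 (h E)" "b *\<^sub>C abs_L2 (h F)"]
        rep_scaleC_L2[of a "abs_L2 (h E)"] rep_scaleC_L2[of b "abs_L2 (h F)"]
      by eventually_elim (simp add: hcong[OF G])
  qed
  have linC: "abs_L2 (h (c *\<^sub>C E)) = c *\<^sub>C abs_L2 (h E)" for c E
  proof -
    have "AE r in lebesgue. rep_L2 (c *\<^sub>C E) r = c * rep_L2 E r + 0 * rep_L2 E r"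
      using rep_scaleC_L2[of c E] by eventually_elim simp
    from lin[OF this] show ?thesis by simp
  qed
  have "bounded_linear (\<lambda>E. abs_L2 (h E))"
  proof (rule bounded_linear_intro[where K = "C * sqrt m"])
    show "abs_L2 (h (E + F)) = abs_L2 (h E) + abs_L2 (h F)" for E F
    proof -
      have "AE r in lebesgue. rep_L2 (E + F) r = 1 * rep_L2 E r + 1 * rep_L2 F r"
        using rep_plus_L2[of E F] by eventually_elim simp
      from lin[OF this] show ?thesis by simp
    qed
    show "abs_L2 (h (s *\<^sub>R E)) = s *\<^sub>R abs_L2 (h E)" for s E
      using linC[of "of_real s" E] by (simp add: scaleC_of_real)
    show "norm (abs_L2 (h E)) \<le> norm E * (C * sqrt m)" for E
    proof -
      have "ennreal ((norm (abs_L2 (h E)))\<^sup>2) \<le> ennreal ((C * norm E)\<^sup>2 * m)"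
        unfolding nn_norm_abs_L2_sq[OF sq] by (rule nn)
      then have "(norm (abs_L2 (h E)))\<^sup>2 \<le> (norm E * (C * sqrt m))\<^sup>2"
        using m(2) by (simp add: power_mult_distrib mult_ac)
      then show ?thesis by (rule power2_le_imp_le) (use C(1) m(2) in simp)
    qed
  qed
  then have op: "blinfun_apply (H_op kx D \<epsilon> z) = (\<lambda>E. abs_L2 (h E))"
    unfolding H_op_def h_def by (rule bounded_linear_Blinfun_apply)
  show "AE r in lebesgue. rep_L2 (H_op kx (rect zm zp) \<epsilon> z E) r = H_fun kx (rect zm zp) \<epsilon> z (rep_L2 E) r"
    using ae[of E] by (simp add: op[unfolded D_def] h_def D_def)
  show "H_op kx (rect zm zp) \<epsilon> z \<in> L2_ops (rect zm zp)"
    unfolding L2_ops_def D_def[symmetric] mem_Collect_eq op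
  proof (intro conjI allI subsetI ballI)
    show "abs_L2 (h (c *\<^sub>C E)) = c *\<^sub>C abs_L2 (h E)" for c E by (rule linC)
    fix F assume "F \<in> range (\<lambda>E. abs_L2 (h E))"
    then obtain E where F: "F = abs_L2 (h E)" by blast
    show "F \<in> L2_on D" unfolding L2_on_def F
    proof (intro CollectI)
      show "AE r in lebesgue. r \<notin> D \<longrightarrow> rep_L2 (abs_L2 (h E)) r = 0"
        using ae[of E] by eventually_elim (simp add: h_def H_fun_eq)
    qed
  next
    fix E assume E: "E \<in> L2_on (- D)"
    have "h E = (\<lambda>r. 0)"
    proof
      fix r
      have "(\<integral>r0. H_integrand kx D \<epsilon> z (rep_L2 E) r r0 \<partial>lebesgue) = 0"
        by (rule integral_eq_zero_AE) (use E in \<open>auto simp: L2_on_def H_integrand_def indicator_def elim!: eventually_mono\<close>)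
      then show "h E r = 0" by (simp add: h_def H_fun_eq)
    qed
    then show "abs_L2 (h E) = 0" by (simp add: zero_L2_def)
  qed
qed

text \<open>No bound on the derivative of the integrand is assumed: the maximum modulus estimate
  bounds its difference quotients by 2 g / r, and dominated convergence applies with this
  majorant.\<close>

lemma has_field_derivative_parametric_integral:
  fixes f :: "complex \<Rightarrow> 'b \<Rightarrow> complex"
  assumes \<delta>: "\<delta> > 0" and m: "\<And>z. z \<in> ball z0 \<delta> \<Longrightarrow> f z \<in> borel_measurable M"
    and g: "integrable M g"
    and f: "AE y in M. (\<lambda>z. f z y) holomorphic_on ball z0 \<delta> \<and> (\<forall>z\<in>ball z0 \<delta>. cmod (f z y) \<le> g y)"
  obtains c where "((\<lambda>z. \<integral>y. f z y \<partial>M) has_field_derivative c) (at z0)"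
proof -
  define u where "u w y = (f (z0 + w) y - f z0 y) / w" for w y
  define r where "r = \<delta> / 2"
  have r: "0 < r" "r < \<delta>" using \<delta> by (auto simp: r_def)
  have gm: "g \<in> borel_measurable M" using g by auto
  have um: "u w \<in> borel_measurable M" if "cmod w < r" for w
  proof -
    have "z0 + w \<in> ball z0 \<delta>" "z0 \<in> ball z0 \<delta>" using that r \<delta> by (auto simp: dist_norm)
    from this[THEN m] have [measurable]: "f (z0 + w) \<in> borel_measurable M" "f z0 \<in> borel_measurable M" .
    show ?thesis unfolding u_def by measurable
  qed
  have ub: "AE y in M. \<forall>w. cmod w < r \<and> w \<noteq> 0 \<longrightarrow> cmod (u w y) \<le> 2 * g y / r"
    using f
  proof eventually_elim
    case (elim y)
    have "cmod (f z y) \<le> g y" if "dist z0 z = r" for z using elim that r by auto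
    moreover have "cmod (f z0 y) \<le> g y" using elim \<delta> by auto
    ultimately have b: "\<And>z. z \<in> cball z0 r \<Longrightarrow> cmod (if z = z0 then deriv (\<lambda>z. f z y) z0 else (f z y - f z0 y) / (z - z0)) \<le> 2 * g y / r"
      using difference_quotient_bound(2)[of "\<lambda>z. f z y" z0 \<delta> r "g y"] elim r by blast
    show ?case
    proof (intro allI impI)
      fix w assume "cmod w < r \<and> w \<noteq> 0"
      then show "cmod (u w y) \<le> 2 * g y / r" using b[of "z0 + w"] by (simp add: u_def dist_norm)
    qed
  qed
  have ulim: "AE y in M. ((\<lambda>w. u w y) \<longlongrightarrow> deriv (\<lambda>z. f z y) z0) (at 0)"
    using f
  proof eventually_elim
    case (elim y)
    have "((\<lambda>z. f z y) has_field_derivative deriv (\<lambda>z. f z y) z0) (at z0)"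
      by (rule holomorphic_derivI[of _ "ball z0 \<delta>"]) (use elim \<delta> in auto)
    then show ?case by (simp add: DERIV_def u_def)
  qed
  \<comment> \<open>A fixed null sequence. The limit of the quotients along it is a measurable
    function that agrees almost everywhere with the pointwise derivative.\<close>
  define w0 where "w0 n = complex_of_real (r / real (n + 2))" for n
  have w0: "w0 \<longlonglongrightarrow> 0" "\<And>n. w0 n \<noteq> 0" "\<And>n. cmod (w0 n) < r"
  proof -
    have "(\<lambda>n. r / real (n + 2)) \<longlonglongrightarrow> 0"
      by (intro tendsto_divide_0[OF tendsto_const] filterlim_at_top_imp_at_infinity
          filterlim_compose[OF filterlim_real_sequentially] filterlim_add_const_nat_at_top)
    from tendsto_of_real[OF this, where 'a = complex] show "w0 \<longlonglongrightarrow> 0"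
      unfolding w0_def[abs_def] of_real_0 .
    show "cmod (w0 n) < r" "w0 n \<noteq> 0" for n
      using r unfolding w0_def norm_of_real of_real_eq_0_iff by (simp_all add: divide_less_eq)
  qed
  define F where "F y = lim (\<lambda>n. u (w0 n) y)" for y
  have Fm: "F \<in> borel_measurable M"
    unfolding F_def by (intro borel_measurable_lim_metric um w0)
  have Fd: "AE y in M. F y = deriv (\<lambda>z. f z y) z0"
    using ulim
  proof eventually_elim
    case (elim y)
    have "filterlim w0 (at 0) sequentially" using w0 by (auto simp: filterlim_at)
    from filterlim_compose[OF elim this] show ?case unfolding F_def by (rule limI)
  qed
  have int: "integrable M (f z)" if "z \<in> ball z0 \<delta>" for z
  proof (rule Bochner_Integration.integrable_bound[OF g m[OF that]])
    show "AE y in M. norm (f z y) \<le> norm (g y)"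
      using f
    proof eventually_elim
      case (elim y)
      then have "cmod (f z y) \<le> g y" using that by blast
      then show ?case by simp
    qed
  qed
  have "((\<lambda>w. ((\<integral>y. f (z0 + w) y \<partial>M) - (\<integral>y. f z0 y \<partial>M)) / w) \<longlongrightarrow> (\<integral>y. F y \<partial>M)) (at 0)"
    \<comment> \<open>Dominated convergence speaks of sequences, so the limit is tested on arbitrary
      sequences tending to 0, shifted until they stay within radius \<open>r\<close>.\<close>
    unfolding tendsto_at_iff_sequentially
  proof (intro allI impI)
    fix X :: "nat \<Rightarrow> complex" assume X: "\<forall>i. X i \<in> UNIV - {0}" "X \<longlonglongrightarrow> 0"
    have Xat: "filterlim X (at 0) sequentially" using X by (auto simp: filterlim_at)
    have "\<forall>\<^sub>F n in sequentially. cmod (X n) < r"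
      using tendstoD[OF X(2) r(1)] by simp
    then obtain N where N: "\<And>n. n \<ge> N \<Longrightarrow> cmod (X n) < r" by (auto simp: eventually_sequentially)
    define Y where "Y n = X (n + N)" for n
    have Y: "cmod (Y n) < r" "Y n \<noteq> 0" for n using N X(1) by (auto simp: Y_def)
    have Yat: "filterlim Y (at 0) sequentially"
      unfolding Y_def using filterlim_compose[OF Xat filterlim_add_const_nat_at_top] .
    have "(\<lambda>n. \<integral>y. u (Y n) y \<partial>M) \<longlonglongrightarrow> (\<integral>y. F y \<partial>M)"
    proof (rule integral_dominated_convergence[where w = "\<lambda>y. 2 * g y / r"])
      show "AE y in M. (\<lambda>n. u (Y n) y) \<longlonglongrightarrow> F y"
        using ulim Fd by eventually_elim (use filterlim_compose[OF _ Yat] in auto)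
      show "AE y in M. norm (u (Y n) y) \<le> 2 * g y / r" for n
        using ub by eventually_elim (use Y in auto)
    qed (use um Y Fm g in auto)
    also have "(\<lambda>n. \<integral>y. u (Y n) y \<partial>M) = (\<lambda>n. ((\<integral>y. f (z0 + Y n) y \<partial>M) - (\<integral>y. f z0 y \<partial>M)) / Y n)"
    proof
      fix n
      have "z0 + Y n \<in> ball z0 \<delta>" "z0 \<in> ball z0 \<delta>" using Y(1)[of n] r by (auto simp: dist_norm)
      then show "(\<integral>y. u (Y n) y \<partial>M) = ((\<integral>y. f (z0 + Y n) y \<partial>M) - (\<integral>y. f z0 y \<partial>M)) / Y n"
        unfolding u_def using int by (simp add: Bochner_Integration.integral_diff)
    qed
    finally have "(\<lambda>n. ((\<integral>y. f (z0 + X (n + N)) y \<partial>M) - (\<integral>y. f z0 y \<partial>M)) / X (n + N)) \<longlonglongrightarrow> (\<integral>y. F y \<partial>M)"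
      by (simp add: Y_def)
    then show "((\<lambda>w. ((\<integral>y. f (z0 + w) y \<partial>M) - (\<integral>y. f z0 y \<partial>M)) / w) \<circ> X) \<longlonglongrightarrow> (\<integral>y. F y \<partial>M)"
      unfolding o_def by (rule LIMSEQ_offset)
  qed
  then have "((\<lambda>z. \<integral>y. f z y \<partial>M) has_field_derivative (\<integral>y. F y \<partial>M)) (at z0)"
    by (simp add: DERIV_def)
  then show thesis by (rule that)
qed

lemma H_fun_has_field_derivative:
  assumes \<delta>: "cball z0 \<delta> \<subseteq> cut_plane kx" "\<delta> > 0" and \<epsilon>: "\<epsilon> \<in> borel_measurable lebesgue"
    and M: "\<And>r. \<bar>\<epsilon> r - 1\<bar> \<le> M"
  shows "\<exists>c. ((\<lambda>z. H_fun kx (rect zm zp) \<epsilon> z (rep_L2 E) r) has_field_derivative c) (at z0)"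
proof (cases "r \<in> rect zm zp")
  case True
  have i: "integrable lebesgue (\<lambda>r0. dom_kernel zm zp r r0 * cmod (rep_L2 E r0))"
    using dom_kernel_integrable[of zm zp] True by metis
  obtain C where C: "C \<ge> 0"
    "\<And>z r r0 f. z \<in> cball z0 \<delta> \<Longrightarrow> r \<in> rect zm zp \<Longrightarrow> snd r0 \<noteq> snd r \<Longrightarrow>
       cmod (H_integrand kx (rect zm zp) \<epsilon> z f r r0) \<le> C * (dom_kernel zm zp r r0 * cmod (f r0))"
  proof (rule H_integrand_bound[OF \<delta>(1) M, where zm = zm and zp = zp])
  qed (rule that)
  have "\<exists>c. ((\<lambda>z. \<integral>r0. H_integrand kx (rect zm zp) \<epsilon> z (rep_L2 E) r r0 \<partial>lebesgue) has_field_derivative c) (at z0)"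
  proof (rule has_field_derivative_parametric_integral[OF \<delta>(2)])
    show "H_integrand kx (rect zm zp) \<epsilon> z (rep_L2 E) r \<in> borel_measurable lebesgue" if "z \<in> ball z0 \<delta>" for z
      using that \<delta>(1) ball_subset_cball by (intro measurable_H_integrand \<epsilon> borel_measurable_rep) blast
    show "integrable lebesgue (\<lambda>r0. C * (dom_kernel zm zp r r0 * cmod (rep_L2 E r0)))" using i by simp
    show "AE r0 in lebesgue. (\<lambda>z. H_integrand kx (rect zm zp) \<epsilon> z (rep_L2 E) r r0) holomorphic_on ball z0 \<delta> \<and>
      (\<forall>z\<in>ball z0 \<delta>. cmod (H_integrand kx (rect zm zp) \<epsilon> z (rep_L2 E) r r0) \<le> C * (dom_kernel zm zp r r0 * cmod (rep_L2 E r0)))"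
      using AE_snd_neq[of "snd r"]
    proof eventually_elim
      case (elim r0)
      have "(\<lambda>z. H_kernel kx z (r - r0)) holomorphic_on ball z0 \<delta>"
        by (rule holomorphic_H_kernel[OF \<delta>(1)]) (use elim in simp)
      then have "(\<lambda>z. H_integrand kx (rect zm zp) \<epsilon> z (rep_L2 E) r r0) holomorphic_on ball z0 \<delta>"
        unfolding H_integrand_def scaleR_conv_of_real by (intro holomorphic_intros)
      then show ?case using C(2)[OF _ True elim] by auto
    qed
  qed blast
  then show ?thesis using True by (simp add: H_fun_eq)
next
  case False
  then show ?thesis by (intro exI[of _ 0]) (simp add: H_fun_eq)
qed

section \<open>Complex linearity of the derivative in \<zeta>\<close>

lemma L2_tendsto_AE_subseq:
  fixes X :: "nat \<Rightarrow> 'a::euclidean_space L2"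
  assumes "X \<longlonglongrightarrow> Y"
  obtains r where "strict_mono r" "AE x in lebesgue. (\<lambda>n. rep_L2 (X (r n)) x) \<longlonglongrightarrow> rep_L2 Y x"
proof -
  \<comment> \<open>The squared distances tend to 0 in L1, where convergence gives an almost
    everywhere convergent subsequence.\<close>
  define u where "u n x = (cmod (rep_L2 (X n - Y) x))\<^sup>2" for n x
  have "(\<lambda>n. (norm (X n - Y))\<^sup>2) \<longlonglongrightarrow> 0\<^sup>2"
    by (intro tendsto_power tendsto_norm_zero LIM_zero assms)
  then have "(\<lambda>n. \<integral>x. norm (u n x) \<partial>lebesgue) \<longlonglongrightarrow> 0"
    by (simp add: norm_L2_sq u_def)
  moreover have "integrable lebesgue (u n)" for n unfolding u_def by (rule integrable_rep)
  ultimately obtain r where r: "strict_mono r" "AE x in lebesgue. (\<lambda>n. u (r n) x) \<longlonglongrightarrow> 0"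
    using tendsto_L1_AE_subseq[of lebesgue u] by blast
  have "AE x in lebesgue. \<forall>n. rep_L2 (X (r n) - Y) x = rep_L2 (X (r n)) x - rep_L2 Y x"
    unfolding AE_all_countable by (intro allI rep_minus_L2)
  with r(2) have "AE x in lebesgue. (\<lambda>n. rep_L2 (X (r n)) x) \<longlonglongrightarrow> rep_L2 Y x"
  proof eventually_elim
    case (elim x)
    from tendsto_real_sqrt[OF elim(1)] have "(\<lambda>n. cmod (rep_L2 (X (r n) - Y) x)) \<longlonglongrightarrow> 0" by (simp add: u_def)
    then have "(\<lambda>n. rep_L2 (X (r n)) x - rep_L2 Y x) \<longlonglongrightarrow> 0"
      using elim(2) by (simp add: tendsto_norm_zero_iff)
    then show ?case by (rule LIM_zero_cancel)
  qed
  then show thesis using that r(1) by blast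
qed

lemma has_vector_derivative_tendsto_quotient:
  assumes "(f has_vector_derivative D) (at 0)"
  shows "((\<lambda>s. (1 / s) *\<^sub>R (f s - f 0)) \<longlongrightarrow> D) (at 0)"
proof -
  have "((\<lambda>s. (1 / norm s) *\<^sub>R (f s - f 0 - s *\<^sub>R D)) \<longlongrightarrow> 0) (at 0)"
    using assms by (simp add: has_vector_derivative_def has_derivative_at2 diff_diff_eq)
  then have "((\<lambda>s. (1 / s) *\<^sub>R (f s - f 0) - D) \<longlongrightarrow> 0) (at 0)"
  proof (rule Lim_null_comparison[OF _ tendsto_norm_zero, rotated])
    have "norm ((1 / s) *\<^sub>R (f s - f 0) - D) \<le> norm ((1 / norm s) *\<^sub>R (f s - f 0 - s *\<^sub>R D))" if "s \<noteq> 0" for s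
    proof -
      have "(1 / s) *\<^sub>R (f s - f 0) - D = (1 / s) *\<^sub>R (f s - f 0 - s *\<^sub>R D)"
        using that by (simp add: scaleR_diff_right)
      then show ?thesis by simp
    qed
    then show "\<forall>\<^sub>F s in at 0. norm ((1 / s) *\<^sub>R (f s - f 0) - D) \<le> norm ((1 / norm s) *\<^sub>R (f s - f 0 - s *\<^sub>R D))"
      by (simp add: eventually_at_filter)
  qed
  then show ?thesis by (rule LIM_zero_cancel)
qed

text \<open>A difference quotient that converges in \<open>L2\<close> converges almost everywhere along a subsequence,
  so its limit is the pointwise complex derivative of the integral.\<close>

lemma H_op_derivative_complex_linear:
  assumes z0: "z0 \<in> interior (cut_plane kx)" and \<epsilon>: "\<epsilon> \<in> borel_measurable lebesgue" and M: "\<And>r. \<bar>\<epsilon> r - 1\<bar> \<le> M"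
    and L: "(H_op kx (rect zm zp) \<epsilon> has_derivative L) (at z0)"
  shows "L w = scaleC_op w (L 1)"
proof -
  obtain \<delta> where \<delta>: "\<delta> > 0" "cball z0 \<delta> \<subseteq> interior (cut_plane kx)"
    using z0 open_contains_cball[of "interior (cut_plane kx)"] by auto
  then have \<delta>': "cball z0 \<delta> \<subseteq> cut_plane kx" using interior_subset by blast
  define h where "h = H_fun kx (rect zm zp) \<epsilon>"
  define T where "T = H_op kx (rect zm zp) \<epsilon>"
  \<comment> \<open>The order of quantifiers is the point: one function \<open>c\<close> serves
    every direction \<open>w\<close>, which makes \<open>L w E\<close> comparable with
    \<open>w *\<^sub>C L 1 E\<close>.\<close>
  have key: "\<exists>c. \<forall>w. AE r in lebesgue. rep_L2 (L w E) r = w * c r" for E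
  proof -
    have "\<forall>r. \<exists>c. ((\<lambda>z. h z (rep_L2 E) r) has_field_derivative c) (at z0)"
      unfolding h_def using H_fun_has_field_derivative[OF \<delta>' \<delta>(1) \<epsilon> M] by blast
    then obtain c where c: "\<And>r. ((\<lambda>z. h z (rep_L2 E) r) has_field_derivative c r) (at z0)" by metis
    have "AE r in lebesgue. rep_L2 (L w E) r = w * c r" for w
    proof -
      \<comment> \<open>With this \<open>N\<close> all points z0 + t n w lie in the disc; the added
        1 keeps \<open>t 0\<close> positive when w = 0.\<close>
      define N where "N = nat \<lceil>cmod w / \<delta>\<rceil> + 1"
      define t where "t n = 1 / real (n + N)" for n
      have N: "cmod w / \<delta> \<le> real N" "N \<ge> 1"
        unfolding N_def using real_nat_ceiling_ge[of "cmod w / \<delta>"] by auto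
      have t: "t n > 0" "t \<longlonglongrightarrow> 0" for n
      proof -
        show "t n > 0" using N by (simp add: t_def)
        show "t \<longlonglongrightarrow> 0" unfolding t_def
          by (intro tendsto_divide_0[OF tendsto_const] filterlim_at_top_imp_at_infinity
            filterlim_compose[OF filterlim_real_sequentially] filterlim_add_const_nat_at_top)
      qed
      have inb: "z0 + of_real (t n) * w \<in> cball z0 \<delta>" for n
      proof -
        have "cmod w \<le> \<delta> * real N" using N(1) \<delta>(1) by (simp add: field_simps)
        also have "\<dots> \<le> \<delta> * real (n + N)" using \<delta>(1) by (intro mult_left_mono) auto
        finally have "t n * cmod w \<le> \<delta>" using N(2) by (simp add: t_def field_simps)
        then show ?thesis using t(1)[of n] by (simp add: dist_norm norm_mult)
      qed
      have at0: "filterlim (\<lambda>n. z0 + of_real (t n) * w) (at z0) sequentially" if "w \<noteq> 0"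
      proof (rule filterlim_atI)
        have "(\<lambda>n. z0 + of_real (t n) * w) \<longlonglongrightarrow> z0 + of_real 0 * w" by (intro tendsto_intros t)
        then show "(\<lambda>n. z0 + of_real (t n) * w) \<longlonglongrightarrow> z0" by simp
        show "\<forall>\<^sub>F n in sequentially. z0 + of_real (t n) * w \<noteq> z0"
          using t(1) that by (intro always_eventually allI) (simp add: less_imp_neq[symmetric])
      qed
      define X where "X n = (1 / t n) *\<^sub>R (T (z0 + of_real (t n) * w) E - T z0 E)" for n
      have "X \<longlonglongrightarrow> L w E"
      proof -
        have "((\<lambda>s. z0 + of_real s * w) has_derivative (\<lambda>s. of_real s * w)) (at (0::real))"
          by (auto intro!: derivative_eq_intros)
        moreover have "(T has_derivative L) (at (z0 + of_real 0 * w))" using L by (simp add: T_def)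
        ultimately have "((\<lambda>s. T (z0 + of_real s * w)) has_derivative (\<lambda>s. L (of_real s * w))) (at (0::real))"
          by (rule has_derivative_compose)
        from bounded_linear.has_derivative[OF blinfun.bounded_linear_left this, of E]
        have "((\<lambda>s. T (z0 + of_real s * w) E) has_derivative (\<lambda>s. L (of_real s * w) E)) (at (0::real))" .
        also have "(\<lambda>s. L (of_real s * w) E) = (\<lambda>s. s *\<^sub>R L w E)"
          using linear_cmul[OF bounded_linear.linear[OF has_derivative_bounded_linear[OF L]], of _ w]
          by (simp add: scaleR_conv_of_real[symmetric] blinfun.scaleR_left)
        finally have "((\<lambda>s. T (z0 + of_real s * w) E) has_vector_derivative L w E) (at (0::real))"
          by (simp add: has_vector_derivative_def)
        from has_vector_derivative_tendsto_quotient[OF this]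
        have "((\<lambda>s. (1 / s) *\<^sub>R (T (z0 + of_real s * w) E - T z0 E)) \<longlongrightarrow> L w E) (at (0::real))"
          by simp
        moreover have "filterlim t (at 0) sequentially" using t by (auto simp: filterlim_at less_imp_neq[symmetric])
        ultimately show ?thesis unfolding X_def by (rule filterlim_compose)
      qed
      then obtain q where q: "strict_mono q" "AE r in lebesgue. (\<lambda>n. rep_L2 (X (q n)) r) \<longlonglongrightarrow> rep_L2 (L w E) r"
        by (rule L2_tendsto_AE_subseq)
      have opae: "AE r in lebesgue. rep_L2 (T z E) r = h z (rep_L2 E) r" if "z \<in> cball z0 \<delta>" for z
        unfolding T_def h_def using that \<delta>' by (intro H_op_in_L2_ops(1)[OF _ \<epsilon> M]) blast
      have "AE r in lebesgue. rep_L2 (X n) r =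
         (h (z0 + of_real (t n) * w) (rep_L2 E) r - h z0 (rep_L2 E) r) / of_real (t n)" for n
      proof -
        have "AE r in lebesgue. rep_L2 (X n) r = of_real (1 / t n) * rep_L2 (T (z0 + of_real (t n) * w) E - T z0 E) r"
          unfolding X_def scaleC_of_real[symmetric] by (rule rep_scaleC_L2)
        with opae[OF inb[of n]] opae[OF centre_in_cball[THEN iffD2, OF less_imp_le[OF \<delta>(1)]]]
          rep_minus_L2[of "T (z0 + of_real (t n) * w) E" "T z0 E"]
        show ?thesis by eventually_elim simp
      qed
      then have "AE r in lebesgue. \<forall>n. rep_L2 (X n) r =
         (h (z0 + of_real (t n) * w) (rep_L2 E) r - h z0 (rep_L2 E) r) / of_real (t n)"
        unfolding AE_all_countable by blast
      with q(2) show ?thesis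
      proof eventually_elim
        case (elim r)
        have "(\<lambda>n. (h (z0 + of_real (t n) * w) (rep_L2 E) r - h z0 (rep_L2 E) r) / of_real (t n)) \<longlonglongrightarrow> w * c r"
        proof (cases "w = 0")
          case False
          have "((\<lambda>z. (h z (rep_L2 E) r - h z0 (rep_L2 E) r) / (z - z0)) \<longlongrightarrow> c r) (at z0)"
            using c[of r] by (simp add: has_field_derivative_iff)
          from filterlim_compose[OF this at0[OF False]]
          have "(\<lambda>n. w * ((h (z0 + of_real (t n) * w) (rep_L2 E) r - h z0 (rep_L2 E) r) / (of_real (t n) * w))) \<longlonglongrightarrow> w * c r"
            by (intro tendsto_mult_left) simp
          then show ?thesis using False by simp
        qed simp
        then have "(\<lambda>n. rep_L2 (X n) r) \<longlonglongrightarrow> w * c r" using elim(2) by simp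
        from LIMSEQ_subseq_LIMSEQ[OF this q(1)] elim(1) show ?case
          unfolding o_def using LIMSEQ_unique by blast
      qed
    qed
    then show ?thesis by blast
  qed
  show ?thesis
  proof (rule blinfun_eqI)
    fix E
    obtain c where c: "\<And>w. AE r in lebesgue. rep_L2 (L w E) r = w * c r" using key[of E] by blast
    show "L w E = scaleC_op w (L 1) E"
      unfolding scaleC_op_apply
    proof (rule L2_eqI)
      show "AE r in lebesgue. rep_L2 (L w E) r = rep_L2 (w *\<^sub>C L 1 E) r"
        using c[of w] c[of 1] rep_scaleC_L2[of w "L 1 E"] by eventually_elim simp
    qed
  qed
qed

theorem mainTheorem1:
  fixes kx zm zp hn :: real
    and J0 :: "real set"
    and \<epsilon> :: "real \<Rightarrow> real \<times> real \<Rightarrow> real"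
    and \<zeta>n :: complex
    and En :: "(real \<times> real) L2"
    and D :: "(real \<times> real) set"
  assumes "zm < zp" and "D = rect zm zp"
    and "open J0" and "is_interval J0"
    and "\<And>h r. h \<in> J0 \<Longrightarrow> \<epsilon> h r \<ge> 1"
    and "\<And>h. h \<in> J0 \<Longrightarrow> bounded (range (\<epsilon> h))"
    and "\<And>h. h \<in> J0 \<Longrightarrow> \<epsilon> h \<in> borel_measurable lebesgue"
    and "\<And>h x z. h \<in> J0 \<Longrightarrow> \<epsilon> h (x + 1, z) = \<epsilon> h (x, z)"
    and "bounded (\<Union>h\<in>J0. strip_support (\<epsilon> h))"
    and "(\<Union>h\<in>J0. strip_support (\<epsilon> h)) \<subseteq> D"
    and "continuously_frechet_differentiable_on
           (\<lambda>(h, \<zeta>). H_op kx D (\<epsilon> h) \<zeta>) (J0 \<times> cut_plane kx)"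
    and "hn \<in> J0" and "\<zeta>n \<in> cut_plane kx"
    and "simple_pole D (cut_plane kx) (H_op kx D (\<epsilon> hn)) \<zeta>n"
    and "siegert_state kx D (\<epsilon> hn) \<zeta>n En"
  shows "\<exists>J \<zeta>. open J \<and> is_interval J \<and> hn \<in> J \<and> J \<subseteq> J0 \<and>
           simple_pole_branch kx D \<epsilon> hn \<zeta>n J \<zeta> \<and>
           (\<forall>\<eta>. simple_pole_branch kx D \<epsilon> hn \<zeta>n J \<eta> \<longrightarrow> (\<forall>h\<in>J. \<eta> h = \<zeta> h)) \<and>
           (\<exists>E. E C1_differentiable_on J \<and>
                (\<forall>h\<in>J. siegert_state kx D (\<epsilon> h) (\<zeta> h) (E h) \<and>
                   (\<forall>F. siegert_state kx D (\<epsilon> h) (\<zeta> h) F \<longrightarrow> (\<exists>c. c \<noteq> 0 \<and> F = c *\<^sub>C E h))))"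
proof -
  define T where "T = (\<lambda>(h, \<zeta>). H_op kx D (\<epsilon> h) \<zeta>)"
  have T: "T (h, \<zeta>) = H_op kx D (\<epsilon> h) \<zeta>" for h \<zeta> by (simp add: T_def)
  obtain T' where T': "\<And>p. p \<in> J0 \<times> cut_plane kx \<Longrightarrow> (T has_derivative blinfun_apply (T' p)) (at p)"
    and T'c: "continuous_on (J0 \<times> cut_plane kx) T'"
    using assms(11) unfolding continuously_frechet_differentiable_on_def T_def by blast
  have bd: "\<exists>M. \<forall>r. \<bar>\<epsilon> h r - 1\<bar> \<le> M" if h: "h \<in> J0" for h
  proof -
    obtain M where M: "\<And>r. \<bar>\<epsilon> h r\<bar> \<le> M"
      using assms(6)[OF h] unfolding bounded_iff by auto
    have "\<bar>\<epsilon> h r - 1\<bar> \<le> M + 1" for r using M[of r] by linarith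
    then show ?thesis by blast
  qed
  have ops: "T (h, \<zeta>) \<in> L2_ops D" if "h \<in> J0" "\<zeta> \<in> cut_plane kx" for h \<zeta>
    using bd[OF that(1)] H_op_in_L2_ops(2)[OF that(2) assms(7)[OF that(1)]] unfolding T assms(2) by blast
  \<comment> \<open>At fixed h the \<zeta>-derivative is the full derivative restricted to
    directions (0, w), so the complex linearity found for \<open>H_op\<close> in \<zeta> passes to
    \<open>T'\<close>.\<close>
  have lin: "T' (h, \<zeta>) (0, w) = scaleC_op w (T' (h, \<zeta>) (0, 1))"
    if h\<zeta>: "h \<in> J0" "\<zeta> \<in> interior (cut_plane kx)" for h \<zeta> w
  proof -
    obtain M where M: "\<And>r. \<bar>\<epsilon> h r - 1\<bar> \<le> M" using bd[OF h\<zeta>(1)] by blast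
    have "\<zeta> \<in> cut_plane kx" using h\<zeta>(2) interior_subset by blast
    then have "(T has_derivative T' (h, \<zeta>)) (at (h, \<zeta>))" using h\<zeta>(1) by (intro T') simp
    moreover have "((\<lambda>z. (h, z)) has_derivative (\<lambda>w. (0, w))) (at \<zeta>)"
      by (auto intro!: derivative_eq_intros)
    ultimately have "((\<lambda>z. T (h, z)) has_derivative (\<lambda>w. T' (h, \<zeta>) (0, w))) (at \<zeta>)"
      using has_derivative_compose by blast
    then have "(H_op kx (rect zm zp) (\<epsilon> h) has_derivative (\<lambda>w. T' (h, \<zeta>) (0, w))) (at \<zeta>)"
      by (simp only: T assms(2))
    from H_op_derivative_complex_linear[OF h\<zeta>(2) assms(7)[OF h\<zeta>(1)] M this] show ?thesis .
  qed
  have Dm: "D \<in> sets lebesgue" unfolding assms(2) by (rule rect_lebesgue)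
  have pole: "simple_pole D (cut_plane kx) (\<lambda>\<zeta>. T (hn, \<zeta>)) \<zeta>n" using assms(14) by (simp only: T)
  have "\<exists>J \<zeta> E. open J \<and> is_interval J \<and> hn \<in> J \<and> J \<subseteq> J0 \<and>
      simple_pole_branch kx D \<epsilon> hn \<zeta>n J \<zeta> \<and>
      (\<forall>\<eta>. simple_pole_branch kx D \<epsilon> hn \<zeta>n J \<eta> \<longrightarrow> (\<forall>h\<in>J. \<eta> h = \<zeta> h)) \<and> E C1_differentiable_on J \<and>
      (\<forall>h\<in>J. E h \<in> L2_on D \<and> E h \<noteq> 0 \<and> H_op kx D (\<epsilon> h) (\<zeta> h) (E h) = E h \<and>
         (\<forall>F. F \<noteq> 0 \<longrightarrow> H_op kx D (\<epsilon> h) (\<zeta> h) F = F \<longrightarrow> (\<exists>c. c \<noteq> 0 \<and> F = c *\<^sub>C E h)))"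
    unfolding simple_pole_branch_def
    by (rule simple_pole_branch_exists[OF Dm assms(3,12,13) ops T' T'c lin pole, unfolded T])
  then show ?thesis
  proof (elim exE conjE)
    fix J \<zeta> E
    assume J: "open J" "is_interval J" "hn \<in> J" "J \<subseteq> J0"
      and branch: "simple_pole_branch kx D \<epsilon> hn \<zeta>n J \<zeta>"
        "\<forall>\<eta>. simple_pole_branch kx D \<epsilon> hn \<zeta>n J \<eta> \<longrightarrow> (\<forall>h\<in>J. \<eta> h = \<zeta> h)"
      and E: "E C1_differentiable_on J"
        "\<forall>h\<in>J. E h \<in> L2_on D \<and> E h \<noteq> 0 \<and> H_op kx D (\<epsilon> h) (\<zeta> h) (E h) = E h \<and>
          (\<forall>F. F \<noteq> 0 \<longrightarrow> H_op kx D (\<epsilon> h) (\<zeta> h) F = F \<longrightarrow> (\<exists>c. c \<noteq> 0 \<and> F = c *\<^sub>C E h))"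
    have "\<forall>h\<in>J. siegert_state kx D (\<epsilon> h) (\<zeta> h) (E h) \<and>
        (\<forall>F. siegert_state kx D (\<epsilon> h) (\<zeta> h) F \<longrightarrow> (\<exists>c. c \<noteq> 0 \<and> F = c *\<^sub>C E h))"
      using E(2) by (simp add: siegert_state_def)
    then show ?thesis
      by (intro exI[of _ J] exI[of _ \<zeta>] exI[of _ E] conjI J branch E(1))
  qed
qed

end
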